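(* Let $d_1,d_2\in\mathbb{N}$ and let $\Phi\in\mathrm{UEB}(d_1,d_2)$, i.e. $\Phi:\mathbb{M}_{d_1}\to\mathbb{M}_{d_2}$ is a unital entanglement breaking map. Then the following are equivalent: (i) $\Phi$ is degradable. (ii) $\Phi$ is a $C^*$-extreme point of $\mathrm{UEB}(d_1,d_2)$.
   Context: $\mathbb{M}_d=\mathscr{B}(\mathbb{C}^d)$ is the algebra of complex $d\times d$ matrices. For a matrix $V\in\mathbb{M}_{d_1\times d_2}$, $\mathrm{Ad}_V(X)=V^*XV$. A completely positive (CP) linear map $\Phi:\mathbb{M}_{d_1}\to\mathbb{M}_{d_2}$ is entanglement breaking (EB) if for every $k\in\mathbb{N}$ and every positive semidefinite $\rho\in\mathbb{M}_k\otimes\mathbb{M}_{d_1}$ the matrix $(\mathrm{id}_k\otimes\Phi)(\rho)$ is separable, i.e. a finite sum of $P\otimes Q$ with $P,Q$ positive semidefinite. $\mathrm{UEB}(d_1,d_2)$ is the set of EB maps $\Phi:\mathbb{M}_{d_1}\to\mathbb{M}_{d_2}$ with $\Phi(I)=I$. A CP map $\Psi:\mathbb{M}_{d_1}\to\mathbb{M}_{d_3}$ is complementary to a CP map $\Phi:\mathbb{M}_{d_1}\to\mathbb{M}_{d_2}$ if there is a linear $A:\mathbb{C}^{d_1}\to\mathbb{C}^{d_2}\otimes\mathbb{C}^{d_3}$ with $\Phi(X)=(\mathrm{id}\otimes\operatorname{tr})(AXA^* )$ and $\Psi(X)=(\operatorname{tr}\otimes\mathrm{id})(AXA^* )$ for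 all $X$. $\Phi$ is degradable if there is a CP map $\Gamma:\mathbb{M}_{d_2}\to\mathbb{M}_{d_3}$ (some $d_3$) such that $\Gamma\circ\Phi$ is complementary to $\Phi$. $\Phi\in\mathrm{UEB}(d_1,d_2)$ is a $C^*$-extreme point of $\mathrm{UEB}(d_1,d_2)$ if whenever $\Phi=\sum_{i=1}^n\mathrm{Ad}_{T_i}\circ\Phi_i$ with $T_i\in\mathbb{M}_{d_2}$ invertible, $\sum_{i=1}^nT_i^*T_i=I_{d_2}$ and $\Phi_i\in\mathrm{UEB}(d_1,d_2)$, there exist unitaries $U_i\in\mathbb{M}_{d_2}$ such that $\Phi_i=\mathrm{Ad}_{U_i}\circ\Phi$ for all $1\le i\le n$. *)

theory Defs
  imports "Jordan_Normal_Form.Schur_Decomposition"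
begin

text \<open>
  \<open>M\<^sub>d\<close> is \<open>carrier_mat d d\<close> over the complex numbers.  A map \<open>M\<^sub>d \<rightarrow> M\<^sub>e\<close> is a HOL function on
  complex matrices of which only the values on \<open>carrier_mat d d\<close> matter; equality of two such maps
  is always stated on that carrier.

  \<open>M\<^sub>m \<otimes> M\<^sub>n\<close> is identified with \<open>M\<^sub>m\<^sub>n\<close> (and \<open>\<complex>\<^sup>m \<otimes> \<complex>\<^sup>n\<close> with \<open>\<complex>\<^sup>m\<^sup>n\<close>) by the Kronecker product: the
  basis vector \<open>e\<^sub>i \<otimes> e\<^sub>j\<close> has index \<open>i * n + j\<close>.
\<close>

type_synonym cmat = "complex mat"

definition mat_sum :: "nat \<Rightarrow> nat \<Rightarrow> (nat \<Rightarrow> cmat) \<Rightarrow> cmat" where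
  "mat_sum d n M = mat d d (\<lambda>(i, j). \<Sum>l<n. M l $$ (i, j))"

definition kron :: "cmat \<Rightarrow> cmat \<Rightarrow> cmat" where
  "kron P Q = mat (dim_row P * dim_row Q) (dim_col P * dim_col Q)
     (\<lambda>(i, j). P $$ (i div dim_row Q, j div dim_col Q) * Q $$ (i mod dim_row Q, j mod dim_col Q))"

text \<open>
  The order on the complex numbers is the one of \<^theory>\<open>HOL-Library.Complex_Order\<close>:
  \<open>0 \<le> z\<close> says that \<open>z\<close> is real and nonnegative.
\<close>

definition psd :: "nat \<Rightarrow> cmat \<Rightarrow> bool" where
  "psd d A \<longleftrightarrow> A \<in> carrier_mat d d \<and> (\<forall>v \<in> carrier_vec d. 0 \<le> (A *\<^sub>v v) \<bullet>c v)"

definition separable :: "nat \<Rightarrow> nat \<Rightarrow> cmat \<Rightarrow> bool" where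
  "separable k d X \<longleftrightarrow> (\<exists>n P Q. (\<forall>l<n. psd k (P l) \<and> psd d (Q l)) \<and>
     X = mat_sum (k * d) n (\<lambda>l. kron (P l) (Q l)))"

definition linear_map :: "nat \<Rightarrow> nat \<Rightarrow> (cmat \<Rightarrow> cmat) \<Rightarrow> bool" where
  "linear_map d1 d2 \<Phi> \<longleftrightarrow>
     (\<forall>X \<in> carrier_mat d1 d1. \<Phi> X \<in> carrier_mat d2 d2) \<and>
     (\<forall>X \<in> carrier_mat d1 d1. \<forall>Y \<in> carrier_mat d1 d1. \<Phi> (X + Y) = \<Phi> X + \<Phi> Y) \<and>
     (\<forall>c. \<forall>X \<in> carrier_mat d1 d1. \<Phi> (c \<cdot>\<^sub>m X) = c \<cdot>\<^sub>m \<Phi> X)"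

text \<open>
  \<open>id\<^sub>k \<otimes> \<Phi>\<close> applies \<open>\<Phi>\<close> to each of the \<open>k\<^sup>2\<close> blocks of size \<open>d1 \<times> d1\<close> of its argument; for linear
  \<open>\<Phi>\<close> it is the linear map determined by \<open>P \<otimes> Q \<mapsto> P \<otimes> \<Phi> Q\<close>, see \<open>id_tensor_kron\<close> below.
\<close>

definition block :: "nat \<Rightarrow> cmat \<Rightarrow> nat \<Rightarrow> nat \<Rightarrow> cmat" where
  "block d \<rho> a b = mat d d (\<lambda>(i, j). \<rho> $$ (a * d + i, b * d + j))"

definition id_tensor :: "nat \<Rightarrow> nat \<Rightarrow> nat \<Rightarrow> (cmat \<Rightarrow> cmat) \<Rightarrow> cmat \<Rightarrow> cmat" where
  "id_tensor k d1 d2 \<Phi> \<rho> = mat (k * d2) (k * d2)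
     (\<lambda>(i, j). \<Phi> (block d1 \<rho> (i div d2) (j div d2)) $$ (i mod d2, j mod d2))"

text \<open>Partial traces \<open>id \<otimes> tr\<close> and \<open>tr \<otimes> id\<close> on \<open>M\<^sub>m \<otimes> M\<^sub>n\<close>.\<close>

definition id_tensor_tr :: "nat \<Rightarrow> nat \<Rightarrow> cmat \<Rightarrow> cmat" where
  "id_tensor_tr m n Y = mat m m (\<lambda>(i, j). \<Sum>c<n. Y $$ (i * n + c, j * n + c))"

definition tr_tensor_id :: "nat \<Rightarrow> nat \<Rightarrow> cmat \<Rightarrow> cmat" where
  "tr_tensor_id m n Y = mat n n (\<lambda>(i, j). \<Sum>c<m. Y $$ (c * n + i, c * n + j))"

definition completely_positive :: "nat \<Rightarrow> nat \<Rightarrow> (cmat \<Rightarrow> cmat) \<Rightarrow> bool" where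
  "completely_positive d1 d2 \<Phi> \<longleftrightarrow> linear_map d1 d2 \<Phi> \<and>
     (\<forall>k \<rho>. psd (k * d1) \<rho> \<longrightarrow> psd (k * d2) (id_tensor k d1 d2 \<Phi> \<rho>))"

definition entanglement_breaking :: "nat \<Rightarrow> nat \<Rightarrow> (cmat \<Rightarrow> cmat) \<Rightarrow> bool" where
  "entanglement_breaking d1 d2 \<Phi> \<longleftrightarrow> completely_positive d1 d2 \<Phi> \<and>
     (\<forall>k \<rho>. psd (k * d1) \<rho> \<longrightarrow> separable k d2 (id_tensor k d1 d2 \<Phi> \<rho>))"

definition UEB :: "nat \<Rightarrow> nat \<Rightarrow> (cmat \<Rightarrow> cmat) set" where
  "UEB d1 d2 = {\<Phi>. entanglement_breaking d1 d2 \<Phi> \<and> \<Phi> (1\<^sub>m d1) = 1\<^sub>m d2}"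

text \<open>\<open>complementary d1 d2 d3 \<Phi> \<Psi>\<close>: the map \<open>\<Psi>\<close> is complementary to \<open>\<Phi>\<close>.\<close>

definition complementary ::
  "nat \<Rightarrow> nat \<Rightarrow> nat \<Rightarrow> (cmat \<Rightarrow> cmat) \<Rightarrow> (cmat \<Rightarrow> cmat) \<Rightarrow> bool" where
  "complementary d1 d2 d3 \<Phi> \<Psi> \<longleftrightarrow>
     completely_positive d1 d2 \<Phi> \<and> completely_positive d1 d3 \<Psi> \<and>
     (\<exists>A \<in> carrier_mat (d2 * d3) d1. \<forall>X \<in> carrier_mat d1 d1.
        \<Phi> X = id_tensor_tr d2 d3 (A * X * mat_adjoint A) \<and>
        \<Psi> X = tr_tensor_id d2 d3 (A * X * mat_adjoint A))"

definition degradable :: "nat \<Rightarrow> nat \<Rightarrow> (cmat \<Rightarrow> cmat) \<Rightarrow> bool" where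
  "degradable d1 d2 \<Phi> \<longleftrightarrow>
     (\<exists>d3 \<Gamma>. completely_positive d2 d3 \<Gamma> \<and> complementary d1 d2 d3 \<Phi> (\<Gamma> \<circ> \<Phi>))"

definition Ad :: "cmat \<Rightarrow> cmat \<Rightarrow> cmat" where
  "Ad V X = mat_adjoint V * X * V"

definition unitary_mat :: "nat \<Rightarrow> cmat \<Rightarrow> bool" where
  "unitary_mat d U \<longleftrightarrow> U \<in> carrier_mat d d \<and>
     mat_adjoint U * U = 1\<^sub>m d \<and> U * mat_adjoint U = 1\<^sub>m d"

definition Cstar_extreme_UEB :: "nat \<Rightarrow> nat \<Rightarrow> (cmat \<Rightarrow> cmat) \<Rightarrow> bool" where
  "Cstar_extreme_UEB d1 d2 \<Phi> \<longleftrightarrow> \<Phi> \<in> UEB d1 d2 \<and>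
     (\<forall>n T \<Phi>s.
        (\<forall>l<n. T l \<in> carrier_mat d2 d2 \<and> invertible_mat (T l) \<and> \<Phi>s l \<in> UEB d1 d2) \<and>
        mat_sum d2 n (\<lambda>l. mat_adjoint (T l) * T l) = 1\<^sub>m d2 \<and>
        (\<forall>X \<in> carrier_mat d1 d1. \<Phi> X = mat_sum d2 n (\<lambda>l. Ad (T l) (\<Phi>s l X)))
        \<longrightarrow> (\<exists>U. \<forall>l<n. unitary_mat d2 (U l) \<and>
               (\<forall>X \<in> carrier_mat d1 d1. \<Phi>s l X = Ad (U l) (\<Phi> X))))"

lemma block_index:
  fixes i k d :: nat
  assumes "i < k" "j < d"
  shows "i * d + j < k * d"
proof -
  have "i * d + j < Suc i * d" using assms by simp
  also have "\<dots> \<le> k * d" using assms by (intro mult_right_mono) auto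
  finally show ?thesis .
qed

lemma id_tensor_kron:
  assumes "linear_map d1 d2 \<Phi>" "P \<in> carrier_mat k k" "Q \<in> carrier_mat d1 d1"
  shows "id_tensor k d1 d2 \<Phi> (kron P Q) = kron P (\<Phi> Q)"
proof -
  have Q': "\<Phi> Q \<in> carrier_mat d2 d2" using assms unfolding linear_map_def by auto
  have b: "block d1 (kron P Q) a b = P $$ (a, b) \<cdot>\<^sub>m Q" if "a < k" "b < k" for a b
    by (rule eq_matI) (use assms that in \<open>auto simp: block_def kron_def block_index\<close>)
  have l: "\<Phi> (P $$ (a, b) \<cdot>\<^sub>m Q) = P $$ (a, b) \<cdot>\<^sub>m \<Phi> Q" for a b
    using assms unfolding linear_map_def by auto
  show ?thesis
  proof (rule eq_matI)
    fix i j assume "i < dim_row (kron P (\<Phi> Q))" "j < dim_col (kron P (\<Phi> Q))"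
    then have ij: "i < k * d2" "j < k * d2" using assms Q' by (auto simp: kron_def)
    then have "i div d2 < k" "j div d2 < k" "i mod d2 < d2" "j mod d2 < d2"
      by (auto simp: less_mult_imp_div_less intro!: mod_less_divisor gr0I)
    then show "id_tensor k d1 d2 \<Phi> (kron P Q) $$ (i, j) = kron P (\<Phi> Q) $$ (i, j)"
      using ij assms Q' b l by (auto simp: id_tensor_def kron_def)
  qed (use assms Q' in \<open>auto simp: id_tensor_def kron_def\<close>)
qed

lemma id_tensor_tr_kron:
  assumes "P \<in> carrier_mat m m" "Q \<in> carrier_mat n n"
  shows "id_tensor_tr m n (kron P Q) = (\<Sum>c<n. Q $$ (c, c)) \<cdot>\<^sub>m P"
  by (rule eq_matI)
    (use assms in \<open>auto simp: id_tensor_tr_def kron_def block_index sum_distrib_left mult.commute\<close>)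

lemma tr_tensor_id_kron:
  assumes "P \<in> carrier_mat m m" "Q \<in> carrier_mat n n"
  shows "tr_tensor_id m n (kron P Q) = (\<Sum>c<m. P $$ (c, c)) \<cdot>\<^sub>m Q"
  by (rule eq_matI)
    (use assms in \<open>auto simp: tr_tensor_id_def kron_def block_index sum_distrib_right\<close>)

end

theory Submission
  imports Defs "Jordan_Normal_Form.Spectral_Radius"
begin

text \<open>
  An entanglement breaking map measures and prepares: \<open>\<Phi> X\<close> is a sum of matrices
  \<open>(\<xi>\<^sub>l\<^sup>* X \<xi>\<^sub>l) \<eta>\<^sub>l \<eta>\<^sub>l\<^sup>*\<close> with unit vectors \<open>\<xi>\<^sub>l\<close> (lemma \<open>EB_holevo\<close>), and \<open>\<Phi>\<close> is unital iff the matrices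
  \<open>\<eta>\<^sub>l \<eta>\<^sub>l\<^sup>*\<close> add up to the identity.  Fix one such form.  Both degradability and \<open>C\<^sup>*\<close>-extremality
  of a unital \<open>\<Phi>\<close> are equivalent to the condition \<open>orthogonal_classes\<close>: \<open>\<eta>\<^sub>k\<close> and \<open>\<eta>\<^sub>l\<close> are orthogonal whenever \<open>\<xi>\<^sub>k\<close>
  and \<open>\<xi>\<^sub>l\<close> span different rays.  Equivalently, \<open>\<Phi>\<close> is a sum of distinct pure states times mutually
  orthogonal projections; then every \<open>\<eta>\<^sub>l\<close> is an eigenvector of every \<open>\<Phi> X\<close>.

  If \<open>\<Gamma> \<circ> \<Phi>\<close> is complementary to \<open>\<Phi>\<close>, it prepares the psd matrices \<open>\<Gamma> (\<eta>\<^sub>j \<eta>\<^sub>j\<^sup>*)\<close> after the same measurement; but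
  as a complementary map it also has the coefficients \<open>(\<eta>\<^sub>k\<^sup>* \<eta>\<^sub>l) (\<xi>\<^sub>l\<^sup>* X \<xi>\<^sub>k)\<close>.  The diagonal
  coefficients involve a single ray each, and by the Cauchy--Schwarz inequality an off-diagonal
  one for two rays must vanish (\<open>orthogonal_classes_of_degradable\<close>).  Conversely, orthogonality
  allows the numbers \<open>\<xi>\<^sub>l\<^sup>* X \<xi>\<^sub>l\<close> to be read off \<open>\<Phi> X\<close>, and they determine the complementary map
  (\<open>degradable_of_orthogonal_classes\<close>).

  Under orthogonality, a part \<open>\<Psi>\<close> of a decomposition of \<open>\<Phi>\<close> into entanglement breaking maps has the form
  \<open>\<Phi> X S\<close> with \<open>S = \<Psi> 1\<close> commuting with all \<open>\<Phi> X\<close>, and polar decomposition provides the unitary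
  that extremality asks for (\<open>Cstar_extreme_of_orthogonal_classes\<close>).  Conversely, an extreme \<open>\<Phi>\<close>
  reproduces every positive reweighting of its own terms as \<open>R\<^sup>* \<Phi> X R\<close>.  Letting the weights concentrate on one
  ray and using \<open>tr (R\<^sup>* R R R\<^sup>*) \<le> tr (R\<^sup>* R)\<^sup>2\<close> forces the part of the identity that belongs to
  this ray to be a projection (\<open>orthogonal_classes_of_Cstar_extreme\<close>), which is orthogonality.
\<close>

section \<open>Adjoints\<close>

lemma mat_adjoint_dim [simp]:
  "dim_row (mat_adjoint A) = dim_col A" "dim_col (mat_adjoint A) = dim_row A"
  by (auto simp: mat_adjoint_def)

lemma mat_adjoint_index [simp]:
  fixes A :: cmat
  assumes "i < dim_col A" "j < dim_row A"
  shows "mat_adjoint A $$ (i, j) = cnj (A $$ (j, i))"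
  using assms by (auto simp: mat_adjoint_def mat_of_rows_def)

lemma mat_adjoint_carrier [simp]:
  "A \<in> carrier_mat n m \<Longrightarrow> mat_adjoint A \<in> carrier_mat m n"
  by (intro carrier_matI) auto

lemma mat_mult_index:
  assumes "A \<in> carrier_mat n k" "B \<in> carrier_mat k m" "i < n" "j < m"
  shows "(A * B) $$ (i, j) = (\<Sum>s<k. A $$ (i, s) * B $$ (s, j))"
  using assms by (auto simp: scalar_prod_def atLeast0LessThan)

lemma mat_adjoint_mult:
  fixes A B :: cmat
  assumes "A \<in> carrier_mat n k" "B \<in> carrier_mat k m"
  shows "mat_adjoint (A * B) = mat_adjoint B * mat_adjoint A"
proof (rule eq_matI)
  fix i j assume "i < dim_row (mat_adjoint B * mat_adjoint A)" "j < dim_col (mat_adjoint B * mat_adjoint A)"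
  then have ij: "i < m" "j < n" using assms by auto
  have "mat_adjoint (A * B) $$ (i, j) = cnj ((A * B) $$ (j, i))"
    using assms ij by (intro mat_adjoint_index) auto
  also have "\<dots> = (\<Sum>s<k. mat_adjoint B $$ (i, s) * mat_adjoint A $$ (s, j))"
    using assms ij by (simp add: mat_mult_index[OF assms ij(2,1)] mult.commute del: index_mult_mat)
  also have "\<dots> = (mat_adjoint B * mat_adjoint A) $$ (i, j)"
    using assms ij by (intro mat_mult_index[symmetric]) auto
  finally show "mat_adjoint (A * B) $$ (i, j) = (mat_adjoint B * mat_adjoint A) $$ (i, j)" .
qed (use assms in auto)

lemma mat_adjoint_adjoint [simp]:
  fixes A :: cmat
  shows "mat_adjoint (mat_adjoint A) = A"
  by (rule eq_matI) auto

lemma mat_adjoint_one [simp]: "mat_adjoint (1\<^sub>m n :: cmat) = 1\<^sub>m n"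
  by (rule eq_matI) auto

lemma mat_adjoint_diag:
  "mat_adjoint (mat_diag n f :: cmat) = mat_diag n (\<lambda>i. cnj (f i))"
  by (rule eq_matI) (auto simp: mat_diag_def)

lemma mat_diag_dim_rc [simp]: "dim_row (mat_diag n f) = n" "dim_col (mat_diag n f) = n"
  by (auto simp: mat_diag_def)

lemma sandwich_diag_index:
  fixes A B :: cmat
  assumes "A \<in> carrier_mat n m" "B \<in> carrier_mat k m" "i < n" "j < k"
  shows "(A * mat_diag m f * mat_adjoint B) $$ (i, j)
           = (\<Sum>l<m. f l * A $$ (i, l) * cnj (B $$ (j, l)))"
proof -
  have "(A * mat_diag m f * mat_adjoint B) $$ (i, j)
      = (\<Sum>l<m. (A * mat_diag m f) $$ (i, l) * mat_adjoint B $$ (l, j))"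
    using assms by (intro mat_mult_index) auto
  also have "\<dots> = (\<Sum>l<m. f l * A $$ (i, l) * cnj (B $$ (j, l)))"
    unfolding mat_diag_mult_right[OF assms(1)] using assms by (intro sum.cong) auto
  finally show ?thesis .
qed

lemma mult_mat_assoc:
  fixes A B C :: cmat
  assumes "dim_col A = dim_row B" "dim_col B = dim_row C"
  shows "A * B * C = A * (B * C)"
  by (rule assoc_mult_mat[OF carrier_matI carrier_matI carrier_matI]) (use assms in auto)

lemma mat_adjoint_mult':
  fixes A B :: cmat
  assumes "dim_col A = dim_row B"
  shows "mat_adjoint (A * B) = mat_adjoint B * mat_adjoint A"
  by (rule mat_adjoint_mult[OF carrier_matI carrier_matI]) (use assms in auto)

section \<open>Unitary diagonalisation of Hermitian matrices\<close>

text \<open>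
  Gram--Schmidt orthogonalisation yields an orthogonal but unnormalised basis that starts with \<open>v\<close>;
  dividing each column by its norm makes the matrix unitary and keeps the unit vector \<open>v\<close>.
\<close>

lemma unitary_extension:
  fixes v :: "complex vec"
  assumes v: "v \<in> carrier_vec n" "v \<bullet>c v = 1"
  shows "\<exists>W. unitary_mat n W \<and> col W 0 = v"
proof -
  have n: "n \<noteq> 0"
  proof
    assume "n = 0" then show False using v by (auto simp: scalar_prod_def)
  qed
  have v0: "v \<noteq> 0\<^sub>v n" using v by auto
  interpret cof_vec_space n "TYPE(complex)" .
  define b where "b = basis_completion v"
  define ws where "ws = gram_schmidt n b"
  from basis_completion[OF v(1) v0, folded b_def]
  have dist: "distinct b" and indep: "\<not> lin_dep (set b)" and b: "set b \<subseteq> carrier_vec n"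
    and hdb: "hd b = v" and len_b: "length b = n" by auto
  from hdb len_b n obtain vs where bv: "b = v # vs" by (cases b, auto)
  from gram_schmidt_result[OF b dist indep refl, folded ws_def]
  have ws: "set ws \<subseteq> carrier_vec n" "corthogonal ws" "length ws = n" by (auto simp: len_b)
  from gram_schmidt_hd[OF v(1), of vs, folded bv] have hdws: "hd ws = v" unfolding ws_def .
  have ws0: "ws ! 0 = v" using hdws ws(3) n by (metis hd_conv_nth length_0_conv)
  define g where "g l = (\<Sum>i<n. (cmod (ws ! l $ i))\<^sup>2)" for l
  have wsc: "ws ! l \<in> carrier_vec n" if "l < n" for l using ws that by auto
  have ipl: "(ws ! l) \<bullet>c (ws ! k) = (\<Sum>i<n. ws ! l $ i * cnj (ws ! k $ i))" if "l < n" "k < n" for l k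
    using wsc[OF that(1)] wsc[OF that(2)] by (auto simp: scalar_prod_def atLeast0LessThan)
  have g: "(ws ! l) \<bullet>c (ws ! l) = of_real (g l)" if "l < n" for l
    unfolding ipl[OF that that] by (simp add: g_def flip: complex_norm_square)
  have gnz: "g l \<noteq> 0" if "l < n" for l
    using corthogonalD[OF ws(2), of l l] ws(3) that g by fastforce
  have gpos: "g l > 0" if "l < n" for l
    using gnz[OF that] by (simp add: g_def less_le sum_nonneg)
  have g0: "g 0 = 1" using g[of 0] ws0 v(2) n by (metis neq0_conv of_real_eq_1_iff)
  define W where "W = mat n n (\<lambda>(i, l). ws ! l $ i / of_real (sqrt (g l)))"
  have W: "W \<in> carrier_mat n n" by (auto simp: W_def)
  have "(mat_adjoint W * W) $$ (k, l) = (if k = l then 1 else 0)" if kl: "k < n" "l < n" for k l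
  proof -
    have "(mat_adjoint W * W) $$ (k, l)
        = (\<Sum>i<n. cnj (ws ! k $ i / of_real (sqrt (g k))) * (ws ! l $ i / of_real (sqrt (g l))))"
      using W kl by (subst mat_mult_index[of _ n n _ n]) (auto simp: W_def)
    also have "\<dots> = ((ws ! l) \<bullet>c (ws ! k)) / (of_real (sqrt (g k)) * of_real (sqrt (g l)))"
      unfolding ipl[OF kl(2,1)] sum_divide_distrib by (intro sum.cong) auto
    also have "\<dots> = (if k = l then 1 else 0)"
    proof (cases "k = l")
      case True
      have "of_real (sqrt (g l)) * of_real (sqrt (g l)) = (of_real (g l) :: complex)"
        using gpos[OF kl(2)] by (simp flip: of_real_mult)
      then show ?thesis using True g[OF kl(2)] gnz[OF kl(2)] by simp
    next
      case False
      then show ?thesis using corthogonalD[OF ws(2), of l k] ws(3) kl by simp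
    qed
    finally show ?thesis .
  qed
  then have 1: "mat_adjoint W * W = 1\<^sub>m n"
    by (intro eq_matI) (use W in auto)
  have 2: "W * mat_adjoint W = 1\<^sub>m n"
    by (rule mat_mult_left_right_inverse[OF _ W 1]) (use W in auto)
  have "col W 0 = v"
    by (rule eq_vecI) (use n v ws0 g0 in \<open>auto simp: W_def\<close>)
  then show ?thesis using 1 2 W by (auto simp: unitary_mat_def)
qed

lemma unit_eigenvector:
  fixes A :: cmat
  assumes A: "A \<in> carrier_mat n n" and n: "n \<noteq> 0"
  shows "\<exists>v e. v \<in> carrier_vec n \<and> v \<bullet>c v = 1 \<and> A *\<^sub>v v = e \<cdot>\<^sub>v v"
proof -
  from spectrum_non_empty[OF A] n obtain e where "eigenvalue A e" by (auto simp: spectrum_def)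
  then obtain u where u: "u \<in> carrier_vec n" "u \<noteq> 0\<^sub>v n" "A *\<^sub>v u = e \<cdot>\<^sub>v u"
    using A by (auto simp: eigenvalue_def eigenvector_def)
  define g where "g = (\<Sum>i<n. (cmod (u $ i))\<^sup>2)"
  have g: "u \<bullet>c u = of_real g"
    using u(1) by (auto simp: scalar_prod_def atLeast0LessThan g_def simp flip: complex_norm_square)
  have "g \<noteq> 0" using g u by (metis conjugate_square_eq_0_vec of_real_0)
  then have "g > 0" by (simp add: g_def less_le sum_nonneg)
  define v where "v = of_real (1 / sqrt g) \<cdot>\<^sub>v u"
  have "v \<bullet>c v = of_real (1 / sqrt g) * of_real (1 / sqrt g) * (u \<bullet>c u)"
    using u(1) by (auto simp: v_def scalar_prod_def sum_distrib_left mult_ac intro!: sum.cong)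
  also have "\<dots> = 1" using g \<open>g > 0\<close> by (simp flip: of_real_mult)
  finally have 1: "v \<bullet>c v = 1" .
  have "A *\<^sub>v v = e \<cdot>\<^sub>v v" using u A
    by (simp add: v_def mult_mat_vec[of _ n n] smult_smult_assoc mult.commute)
  then show ?thesis using 1 u by (intro exI[of _ v]) (auto simp: v_def)
qed

text \<open>
  Induction on the size.  A unitary \<open>W\<close> whose first column is a unit eigenvector turns \<open>A\<close> into
  a matrix \<open>B\<close> whose first column is a multiple of \<open>e\<^sub>0\<close>; as \<open>B\<close> is Hermitian, so is its first row, and
  the induction hypothesis applies to the remaining block \<open>C\<close>.
\<close>

lemma spectral_theorem:
  fixes A :: cmat
  assumes "A \<in> carrier_mat n n" "mat_adjoint A = A"
  shows "\<exists>V f. unitary_mat n V \<and> A = V * mat_diag n f * mat_adjoint V"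
  using assms
proof (induction n arbitrary: A)
  case 0
  then show ?case
    by (intro exI[of _ "1\<^sub>m 0"] exI[of _ "\<lambda>_. 0"]) (auto simp: unitary_mat_def)
next
  case (Suc n A)
  note A = Suc.prems(1) and herm = Suc.prems(2)
  obtain v e where v: "v \<in> carrier_vec (Suc n)" "v \<bullet>c v = 1" "A *\<^sub>v v = e \<cdot>\<^sub>v v"
    using unit_eigenvector[OF A] by auto
  obtain W where W: "W \<in> carrier_mat (Suc n) (Suc n)" "mat_adjoint W * W = 1\<^sub>m (Suc n)"
     "W * mat_adjoint W = 1\<^sub>m (Suc n)" and W0: "col W 0 = v"
    using unitary_extension[OF v(1,2)] by (auto simp: unitary_mat_def)
  have Wa: "mat_adjoint W \<in> carrier_mat (Suc n) (Suc n)" using W by simp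
  define B where "B = mat_adjoint W * (A * W)"
  have B: "B \<in> carrier_mat (Suc n) (Suc n)" using A W by (auto simp: B_def)
  have Bh: "mat_adjoint B = B"
  proof -
    have "mat_adjoint B = mat_adjoint (A * W) * W"
      unfolding B_def using A W by (subst mat_adjoint_mult[of _ "Suc n" "Suc n" _ "Suc n"]) auto
    also have "\<dots> = mat_adjoint W * A * W"
      using A W herm by (subst mat_adjoint_mult[of _ "Suc n" "Suc n" _ "Suc n"]) auto
    finally show ?thesis using A W by (simp add: B_def assoc_mult_mat[of _ "Suc n" "Suc n" _ "Suc n" _ "Suc n"])
  qed
  have B0: "B $$ (i, 0) = (if i = 0 then e else 0)" if i: "i < Suc n" for i
  proof -
    have "B $$ (i, 0) = row (mat_adjoint W) i \<bullet> col (A * W) 0"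
      using i A W by (auto simp: B_def)
    also have "col (A * W) 0 = e \<cdot>\<^sub>v col W 0" using A W W0 v by (subst col_mult2[OF A W(1)]) auto
    also have "row (mat_adjoint W) i \<bullet> (e \<cdot>\<^sub>v col W 0) = e * (mat_adjoint W * W) $$ (i, 0)"
      using i W(1) by (auto simp: scalar_prod_def sum_distrib_left algebra_simps intro!: sum.cong)
    also have "\<dots> = (if i = 0 then e else 0)" using i by (simp add: W(2))
    finally show ?thesis .
  qed
  have B0': "B $$ (0, i) = 0" if "0 < i" "i < Suc n" for i
  proof -
    have "B $$ (0, i) = cnj (B $$ (i, 0))"
      using Bh B that by (metis mat_adjoint_index carrier_matD zero_less_Suc)
    then show ?thesis using B0 that by simp
  qed
  define C where "C = mat n n (\<lambda>(i, j). B $$ (Suc i, Suc j))"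
  have C: "C \<in> carrier_mat n n" by (simp add: C_def)
  have "mat_adjoint C = C"
  proof (rule eq_matI)
    fix i j assume "i < dim_row C" "j < dim_col C"
    then have ij: "i < n" "j < n" using C by auto
    have "cnj (B $$ (Suc j, Suc i)) = B $$ (Suc i, Suc j)"
      using Bh B ij by (metis mat_adjoint_index carrier_matD Suc_less_eq)
    then show "mat_adjoint C $$ (i, j) = C $$ (i, j)" using ij by (simp add: C_def)
  qed (use C in auto)
  from Suc.IH[OF C this] obtain V f where V: "unitary_mat n V" and CV: "C = V * mat_diag n f * mat_adjoint V"
    by blast
  have Vc: "V \<in> carrier_mat n n" using V by (simp add: unitary_mat_def)
  have VV: "(\<Sum>s<n. cnj (V $$ (s, i)) * V $$ (s, j)) = (if i = j then 1 else 0)" if "i < n" "j < n" for i j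
  proof -
    have "(mat_adjoint V * V) $$ (i, j) = (\<Sum>s<n. cnj (V $$ (s, i)) * V $$ (s, j))"
      using Vc that by (subst mat_mult_index[of _ n n _ n]) auto
    then show ?thesis using V that by (simp add: unitary_mat_def)
  qed
  \<comment> \<open>\<open>Z\<close> is the direct sum of the one by one identity and \<open>V\<close>.\<close>
  define Z where "Z = mat (Suc n) (Suc n)
    (\<lambda>(i, j). if i = 0 then (if j = 0 then 1 else 0) else if j = 0 then 0 else V $$ (i - 1, j - 1))"
  have Z: "Z \<in> carrier_mat (Suc n) (Suc n)" by (simp add: Z_def)
  define h where "h i = (if i = 0 then e else f (i - 1))" for i
  have ZZ: "mat_adjoint Z * Z = 1\<^sub>m (Suc n)"
  proof (rule eq_matI)
    fix i j assume "i < dim_row (1\<^sub>m (Suc n) :: cmat)" "j < dim_col (1\<^sub>m (Suc n) :: cmat)"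
    then have ij: "i < Suc n" "j < Suc n" by auto
    have "(mat_adjoint Z * Z) $$ (i, j) = (\<Sum>s<Suc n. cnj (Z $$ (s, i)) * Z $$ (s, j))"
      using Z ij by (subst mat_mult_index[of _ "Suc n" "Suc n" _ "Suc n"]) auto
    also have "\<dots> = (if i = j then 1 else 0)"
      using ij VV[of "i - 1" "j - 1"] unfolding sum.lessThan_Suc_shift
      by (cases i; cases j) (auto simp: Z_def)
    finally show "(mat_adjoint Z * Z) $$ (i, j) = 1\<^sub>m (Suc n) $$ (i, j)" using ij by simp
  qed (use Z in auto)
  have BZ: "B = Z * mat_diag (Suc n) h * mat_adjoint Z"
  proof (rule eq_matI)
    fix i j assume "i < dim_row (Z * mat_diag (Suc n) h * mat_adjoint Z)"
      "j < dim_col (Z * mat_diag (Suc n) h * mat_adjoint Z)"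
    then have ij: "i < Suc n" "j < Suc n" using Z by auto
    have "(Z * mat_diag (Suc n) h * mat_adjoint Z) $$ (i, j)
        = (\<Sum>l<Suc n. h l * Z $$ (i, l) * cnj (Z $$ (j, l)))"
      by (rule sandwich_diag_index[OF Z Z ij])
    also have "\<dots> = B $$ (i, j)"
    proof (cases "i = 0 \<or> j = 0")
      case True
      then show ?thesis using ij B0 B0' unfolding sum.lessThan_Suc_shift
        by (cases i; cases j) (auto simp: Z_def h_def)
    next
      case False
      then obtain i' j' where i': "i = Suc i'" "j = Suc j'" by (metis not0_implies_Suc)
      have "C $$ (i', j') = (\<Sum>l<n. f l * V $$ (i', l) * cnj (V $$ (j', l)))"
        unfolding CV using ij i' by (intro sandwich_diag_index[OF Vc Vc]) auto
      then show ?thesis using ij i' unfolding sum.lessThan_Suc_shift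
        by (auto simp: Z_def h_def C_def)
    qed
    finally show "B $$ (i, j) = (Z * mat_diag (Suc n) h * mat_adjoint Z) $$ (i, j)" by simp
  qed (use B Z in auto)
  note dims = carrier_matD[OF A] carrier_matD[OF W(1)] carrier_matD[OF Z]
  have "W * B * mat_adjoint W = (W * mat_adjoint W) * A * (W * mat_adjoint W)"
    unfolding B_def using dims by (simp add: mult_mat_assoc)
  then have "A = W * B * mat_adjoint W" using A W(3) by simp
  also have "\<dots> = (W * Z) * mat_diag (Suc n) h * mat_adjoint (W * Z)"
    unfolding BZ using dims by (simp add: mult_mat_assoc mat_adjoint_mult[OF W(1) Z])
  finally have "A = (W * Z) * mat_diag (Suc n) h * mat_adjoint (W * Z)" .
  moreover have "unitary_mat (Suc n) (W * Z)"
  proof -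
    have "mat_adjoint (W * Z) * (W * Z) = mat_adjoint Z * (mat_adjoint W * W) * Z"
      using dims by (simp add: mult_mat_assoc mat_adjoint_mult[OF W(1) Z])
    then have 1: "mat_adjoint (W * Z) * (W * Z) = 1\<^sub>m (Suc n)" using W(2) Z ZZ by simp
    have c: "W * Z \<in> carrier_mat (Suc n) (Suc n)" using W Z by auto
    show ?thesis unfolding unitary_mat_def
      using 1 c mat_mult_left_right_inverse[OF mat_adjoint_carrier[OF c] c 1] by blast
  qed
  ultimately show ?case by blast
qed

section \<open>Positive semidefinite matrices\<close>

text \<open>
  Entries of products are expanded by explicit sums below, never by scalar products of rows and
  columns.
\<close>

declare index_mult_mat(1) [simp del]

text \<open>
  Vectors are functions on the natural numbers of which only the values below \<open>d\<close> count.  Families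
  of vectors and vectors on a product index set then carry no dimension conditions.
\<close>

definition bil :: "nat \<Rightarrow> cmat \<Rightarrow> (nat \<Rightarrow> complex) \<Rightarrow> (nat \<Rightarrow> complex) \<Rightarrow> complex" where
  "bil d X u v = (\<Sum>i<d. \<Sum>j<d. cnj (u i) * X $$ (i, j) * v j)"

lemma psd_iff_bil:
  "psd d A \<longleftrightarrow> A \<in> carrier_mat d d \<and> (\<forall>w. 0 \<le> bil d A w w)"
proof -
  have *: "(A *\<^sub>v v) \<bullet>c v = bil d A (\<lambda>i. v $ i) (\<lambda>i. v $ i)"
    if "A \<in> carrier_mat d d" "v \<in> carrier_vec d" for v
    using that
    by (auto simp: bil_def scalar_prod_def atLeast0LessThan sum_distrib_left sum_distrib_right
      mult_ac intro!: sum.cong)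
  have **: "bil d A w w = bil d A (\<lambda>i. vec d w $ i) (\<lambda>i. vec d w $ i)" for w
    by (auto simp: bil_def intro!: sum.cong)
  show ?thesis
    unfolding psd_def using * ** by (metis vec_carrier)
qed

lemma psd_bil_nonneg: "psd d A \<Longrightarrow> 0 \<le> bil d A w w"
  by (simp add: psd_iff_bil)

lemma psd_carrier: "psd d A \<Longrightarrow> A \<in> carrier_mat d d"
  by (simp add: psd_iff_bil)

lemma bil_cong:
  assumes "\<And>i. i < d \<Longrightarrow> u i = u' i" "\<And>i. i < d \<Longrightarrow> v i = v' i"
    "\<And>i j. i < d \<Longrightarrow> j < d \<Longrightarrow> X $$ (i, j) = X' $$ (i, j)"
  shows "bil d X u v = bil d X' u' v'"
  unfolding bil_def using assms by (auto intro!: sum.cong)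

lemma bil_adjoint:
  assumes "X \<in> carrier_mat d d"
  shows "bil d (mat_adjoint X) u v = cnj (bil d X v u)"
  unfolding bil_def using assms
  by (subst sum.swap) (auto simp: cnj_sum mult_ac intro!: sum.cong)

lemma bil_sandwich_diag:
  assumes "A \<in> carrier_mat d m"
  shows "bil d (A * mat_diag m f * mat_adjoint A) u v
    = (\<Sum>l<m. f l * (\<Sum>i<d. cnj (u i) * A $$ (i, l)) * cnj (\<Sum>j<d. cnj (v j) * A $$ (j, l)))"
proof -
  have "bil d (A * mat_diag m f * mat_adjoint A) u v
      = (\<Sum>i<d. \<Sum>j<d. \<Sum>l<m. cnj (u i) * (f l * A $$ (i, l) * cnj (A $$ (j, l))) * v j)"
    unfolding bil_def
    by (intro sum.cong refl) (use assms in \<open>auto simp: sandwich_diag_index sum_distrib_left sum_distrib_right\<close>)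
  also have "\<dots> = (\<Sum>l<m. \<Sum>i<d. \<Sum>j<d. cnj (u i) * (f l * A $$ (i, l) * cnj (A $$ (j, l))) * v j)"
    by (simp only: sum.swap[of _ "{..<m}"])
  also have "\<dots> = (\<Sum>l<m. f l * (\<Sum>i<d. cnj (u i) * A $$ (i, l)) * cnj (\<Sum>j<d. cnj (v j) * A $$ (j, l)))"
    by (intro sum.cong refl) (simp add: sum_product cnj_sum sum_distrib_left mult_ac)
  finally show ?thesis .
qed

lemma complex_mult_cnj_nonneg: "0 \<le> z * cnj z" for z :: complex
  by (simp add: complex_mult_cnj less_eq_complex_def)

lemma psd_sandwich_diag:
  assumes "A \<in> carrier_mat d m" "\<And>l. l < m \<Longrightarrow> 0 \<le> f l"
  shows "psd d (A * mat_diag m f * mat_adjoint A)"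
  unfolding psd_iff_bil bil_sandwich_diag[OF assms(1)]
proof (intro conjI allI sum_nonneg)
  show "A * mat_diag m f * mat_adjoint A \<in> carrier_mat d d"
    using assms(1) by (intro carrier_matI) auto
  fix w l assume "l \<in> {..<m}"
  then show "0 \<le> f l * (\<Sum>i<d. cnj (w i) * A $$ (i, l)) * cnj (\<Sum>j<d. cnj (w j) * A $$ (j, l))"
    unfolding mult.assoc using assms(2)[of l]
    by (intro mult_nonneg_nonneg complex_mult_cnj_nonneg) auto
qed

lemma psd_mult_adjoint:
  assumes "A \<in> carrier_mat d m"
  shows "psd d (A * mat_adjoint A)"
  using psd_sandwich_diag[OF assms, of "\<lambda>_. 1"] assms by (simp add: less_eq_complex_def)

lemma bil_add:
  "bil d X (\<lambda>i. u i + u' i) v = bil d X u v + bil d X u' v"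
  "bil d X u (\<lambda>i. v i + v' i) = bil d X u v + bil d X u v'"
  by (simp_all add: bil_def distrib_left distrib_right sum.distrib)

lemma bil_single:
  assumes "i < d" "j < d"
  shows "bil d X (\<lambda>s. if s = i then a else 0) (\<lambda>s. if s = j then b else 0) = cnj a * X $$ (i, j) * b"
proof -
  have "bil d X (\<lambda>s. if s = i then a else 0) (\<lambda>s. if s = j then b else 0)
      = (\<Sum>s<d. if s = i then (\<Sum>t<d. if t = j then cnj a * X $$ (s, t) * b else 0) else 0)"
    unfolding bil_def using assms by (intro sum.cong refl) (auto simp: if_distrib[of "(*) _"] sum.delta cong: if_cong)
  also have "\<dots> = cnj a * X $$ (i, j) * b"
    using assms by (simp add: sum.delta)
  finally show ?thesis .
qed

text \<open>
  Polarisation: the form is real at every vector, in particular at \<open>e\<^sub>i + e\<^sub>j\<close> and \<open>e\<^sub>i + \<i> e\<^sub>j\<close>, which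
  determines the real and the imaginary part of the \<open>(i, j)\<close> entry in terms of the \<open>(j, i)\<close> entry.
\<close>

lemma psd_hermitian:
  assumes "psd d A"
  shows "mat_adjoint A = A"
proof (rule eq_matI)
  have A: "A \<in> carrier_mat d d" using assms by (rule psd_carrier)
  fix i j assume "i < dim_row A" "j < dim_col A"
  then have ij: "i < d" "j < d" using A by auto
  have real: "bil d A w w \<in> \<real>" for w
    using psd_bil_nonneg[OF assms, of w] by (simp add: complex_is_Real_iff less_eq_complex_def)
  have e: "bil d A (\<lambda>s. (if s = i then a else 0) + (if s = j then b else 0))
                   (\<lambda>s. (if s = i then a else 0) + (if s = j then b else 0))
     = cnj a * A $$ (i, i) * a + cnj a * A $$ (i, j) * b + cnj b * A $$ (j, i) * a + cnj b * A $$ (j, j) * b"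
    for a b
    using ij by (simp add: bil_add bil_single)
  have ii: "A $$ (i, i) \<in> \<real>"
    using real[of "\<lambda>s. (if s = i then 1 else 0) + (if s = j then 0 else 0)"] unfolding e by simp
  have jj: "A $$ (j, j) \<in> \<real>"
    using real[of "\<lambda>s. (if s = i then 0 else 0) + (if s = j then 1 else 0)"] unfolding e by simp
  have 1: "A $$ (i, j) + A $$ (j, i) \<in> \<real>"
    using real[of "\<lambda>s. (if s = i then 1 else 0) + (if s = j then 1 else 0)"] ii jj
    unfolding e by (simp add: complex_is_Real_iff)
  have 2: "\<i> * A $$ (i, j) - \<i> * A $$ (j, i) \<in> \<real>"
    using real[of "\<lambda>s. (if s = i then 1 else 0) + (if s = j then \<i> else 0)"] ii jj
    unfolding e by (simp add: complex_is_Real_iff)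
  from 1 2 have "cnj (A $$ (j, i)) = A $$ (i, j)"
    by (simp add: complex_is_Real_iff complex_eq_iff)
  then show "mat_adjoint A $$ (i, j) = A $$ (i, j)" using ij A by simp
qed (use psd_carrier[OF assms] in auto)

lemma unitary_diag_bil:
  assumes V: "unitary_mat d V" and i: "i < d"
  shows "bil d (V * mat_diag d f * mat_adjoint V) (\<lambda>s. V $$ (s, i)) (\<lambda>s. V $$ (s, i)) = f i"
proof -
  have Vc: "V \<in> carrier_mat d d" "mat_adjoint V * V = 1\<^sub>m d" using V by (auto simp: unitary_mat_def)
  have "(\<Sum>s<d. cnj (V $$ (s, i)) * V $$ (s, l)) = (if i = l then 1 else 0)" if "l < d" for l
    using mat_mult_index[OF mat_adjoint_carrier[OF Vc(1)] Vc(1) i that] Vc i that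
    by (simp)
  then have "bil d (V * mat_diag d f * mat_adjoint V) (\<lambda>s. V $$ (s, i)) (\<lambda>s. V $$ (s, i))
      = (\<Sum>l<d. if i = l then f l else 0)"
    unfolding bil_sandwich_diag[OF Vc(1)] by (intro sum.cong) auto
  also have "\<dots> = f i" using i by (simp add: sum.delta)
  finally show ?thesis .
qed

lemma psd_spectral:
  assumes "psd d A"
  shows "\<exists>V f. unitary_mat d V \<and> (\<forall>i<d. 0 \<le> f i) \<and> A = V * mat_diag d (\<lambda>i. of_real (f i)) * mat_adjoint V"
proof -
  obtain V g where V: "unitary_mat d V" "A = V * mat_diag d g * mat_adjoint V"
    using spectral_theorem[OF psd_carrier[OF assms] psd_hermitian[OF assms]] by blast
  have g: "0 \<le> g i" if "i < d" for i
    using psd_bil_nonneg[OF assms, of "\<lambda>s. V $$ (s, i)"] unitary_diag_bil[OF V(1) that, of g] V(2) by simp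
  then have "mat_diag d g = mat_diag d (\<lambda>i. of_real (Re (g i)))"
    by (intro eq_matI) (auto simp: mat_diag_def less_eq_complex_def complex_eq_iff)
  then show ?thesis using V g
    by (intro exI[of _ V] exI[of _ "\<lambda>i. Re (g i)"]) (auto simp: less_eq_complex_def)
qed

lemma psd_gram:
  assumes "psd d A"
  shows "\<exists>B \<in> carrier_mat d d. A = B * mat_adjoint B"
proof -
  obtain V f where V: "unitary_mat d V" and f: "\<forall>i<d. 0 \<le> f i"
    and A: "A = V * mat_diag d (\<lambda>i. of_real (f i)) * mat_adjoint V"
    using psd_spectral[OF assms] by blast
  have Vc: "V \<in> carrier_mat d d" using V by (auto simp: unitary_mat_def)
  let ?D = "mat_diag d (\<lambda>i. of_real (sqrt (f i))) :: cmat"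
  have DD: "?D * mat_adjoint ?D = mat_diag d (\<lambda>i. of_real (f i))"
    unfolding mat_adjoint_diag mat_diag_diag
    by (intro eq_matI) (use f in \<open>auto simp: mat_diag_def simp flip: of_real_mult\<close>)
  have "A = (V * ?D) * mat_adjoint (V * ?D)"
    unfolding A DD[symmetric] using carrier_matD[OF Vc] by (simp add: mult_mat_assoc mat_adjoint_mult')
  moreover have "V * ?D \<in> carrier_mat d d" using Vc by (intro carrier_matI) auto
  ultimately show ?thesis by blast
qed

lemma bil_gram:
  assumes "B \<in> carrier_mat d m"
  shows "bil d (B * mat_adjoint B) u v
    = (\<Sum>l<m. (\<Sum>i<d. cnj (u i) * B $$ (i, l)) * cnj (\<Sum>j<d. cnj (v j) * B $$ (j, l)))"
  using bil_sandwich_diag[OF assms, of "\<lambda>_. 1" u v] assms by simp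

lemma complex_sum_mult_cnj_eq_0:
  fixes z :: "'a \<Rightarrow> complex"
  assumes "finite S" "(\<Sum>s\<in>S. z s * cnj (z s)) = 0" "s \<in> S"
  shows "z s = 0"
proof -
  have "of_real (\<Sum>s\<in>S. (cmod (z s))\<^sup>2) = (0 :: complex)"
    using assms(2) by (simp add: complex_norm_square[symmetric] del: of_real_power)
  then have "(\<Sum>s\<in>S. (cmod (z s))\<^sup>2) = 0" by (simp only: of_real_eq_0_iff)
  then show ?thesis using assms by (simp add: sum_nonneg_eq_0_iff)
qed

text \<open>
  The Cauchy--Schwarz inequality for the form of \<open>A\<close>, in its degenerate case.  With \<open>A = B B\<^sup>*\<close> the
  hypothesis says that \<open>B\<^sup>* w\<close> vanishes.
\<close>

lemma psd_bil_eq_0: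
  assumes "psd d A" "bil d A w w = 0"
  shows "bil d A w u = 0"
proof -
  obtain B where B: "B \<in> carrier_mat d d" and A: "A = B * mat_adjoint B"
    using psd_gram[OF assms(1)] by blast
  have "(\<Sum>i<d. cnj (w i) * B $$ (i, l)) = 0" if "l < d" for l
    using complex_sum_mult_cnj_eq_0[of "{..<d}" "\<lambda>l. \<Sum>i<d. cnj (w i) * B $$ (i, l)" l]
      assms(2) that unfolding A bil_gram[OF B] by simp
  then show ?thesis unfolding A bil_gram[OF B] by simp
qed

text \<open>
  The square root is taken on the eigenvalues.  A matrix commutes with \<open>S\<close> iff, in the eigenbasis of
  \<open>S\<close>, its entries link equal eigenvalues only; equal eigenvalues have equal square roots, so the
  commutant of \<open>S\<close> also commutes with \<open>Q\<close>.
\<close>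

lemma posdef_sqrt:
  assumes S: "psd d S" and def: "\<And>w. bil d S w w = 0 \<Longrightarrow> \<forall>i<d. w i = 0"
  shows "\<exists>Q R. Q \<in> carrier_mat d d \<and> R \<in> carrier_mat d d \<and> mat_adjoint Q = Q \<and> Q * Q = S
    \<and> Q * R = 1\<^sub>m d \<and> R * Q = 1\<^sub>m d
    \<and> (\<forall>X \<in> carrier_mat d d. X * S = S * X \<longrightarrow> X * Q = Q * X)"
proof -
  obtain V f where V: "unitary_mat d V" and f: "\<forall>i<d. 0 \<le> f i"
    and SV: "S = V * mat_diag d (\<lambda>i. of_real (f i)) * mat_adjoint V"
    using psd_spectral[OF S] by blast
  have Vc: "V \<in> carrier_mat d d" and V1: "mat_adjoint V * V = 1\<^sub>m d" and V2: "V * mat_adjoint V = 1\<^sub>m d"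
    using V by (auto simp: unitary_mat_def)
  note dV = carrier_matD[OF Vc]
  have V1': "mat_adjoint V * (V * Y) = Y" and V2': "V * (mat_adjoint V * Y) = Y"
    if "dim_row Y = d" for Y
    using V1 V2 dV that by (simp_all flip: mult_mat_assoc)
  have fpos: "0 < f i" if i: "i < d" for i
  proof (rule ccontr)
    assume "\<not> 0 < f i"
    then have "f i = 0" using f i by (metis less_eq_real_def)
    then have "bil d S (\<lambda>s. V $$ (s, i)) (\<lambda>s. V $$ (s, i)) = 0"
      unfolding SV using unitary_diag_bil[OF V i] by simp
    then have "\<forall>s<d. V $$ (s, i) = 0" using def by blast
    then have "(mat_adjoint V * V) $$ (i, i) = 0"
      using i Vc by (simp add: mat_mult_index[OF mat_adjoint_carrier[OF Vc] Vc i i])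
    then show False using V1 i by simp
  qed
  define g where "g i = complex_of_real (sqrt (f i))" for i
  have gg: "g i * g i = of_real (f i)" if "i < d" for i
    using fpos[OF that] by (simp add: g_def flip: of_real_mult)
  have g0: "g i \<noteq> 0" if "i < d" for i using fpos[OF that] by (simp add: g_def)
  define conj where "conj h = V * mat_diag d h * mat_adjoint V" for h :: "nat \<Rightarrow> complex"
  have cc: "conj h \<in> carrier_mat d d" for h using dV by (intro carrier_matI) (auto simp: conj_def)
  have cm: "conj h * conj k = conj (\<lambda>i. h i * k i)" for h k
    using dV by (simp add: conj_def mult_mat_assoc V1' flip: mat_diag_diag)
  have ceq: "conj h = conj k" if "\<And>i. i < d \<Longrightarrow> h i = k i" for h k
  proof -
    have "mat_diag d h = mat_diag d k" using that by (intro eq_matI) (auto simp: mat_diag_def)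
    then show ?thesis by (simp add: conj_def)
  qed
  have S': "S = conj (\<lambda>i. of_real (f i))" by (simp add: SV conj_def)
  have c1: "conj (\<lambda>i. 1) = 1\<^sub>m d" using dV V2 by (simp add: conj_def)
  have "(\<lambda>i. cnj (g i)) = g" by (simp add: g_def fun_eq_iff)
  then have "mat_adjoint (conj g) = conj g"
    using dV by (simp add: conj_def mat_adjoint_mult' mult_mat_assoc mat_adjoint_diag)
  moreover have "conj g * conj g = S"
    unfolding S' cm by (rule ceq) (simp add: gg)
  moreover have "conj g * conj (\<lambda>i. 1 / g i) = 1\<^sub>m d" "conj (\<lambda>i. 1 / g i) * conj g = 1\<^sub>m d"
    unfolding cm c1[symmetric] by (rule ceq, simp add: g0)+
  moreover have "X * conj g = conj g * X" if X: "X \<in> carrier_mat d d" and XS: "X * S = S * X" for X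
  proof -
    note dX = carrier_matD[OF X]
    define Y where "Y = mat_adjoint V * X * V"
    have Y: "Y \<in> carrier_mat d d" using dX dV by (intro carrier_matI) (auto simp: Y_def)
    have XY: "X = V * Y * mat_adjoint V"
      using dX dV V2 by (simp add: Y_def mult_mat_assoc V2')
    have comm: "X * conj h = V * (Y * mat_diag d h) * mat_adjoint V"
       "conj h * X = V * (mat_diag d h * Y) * mat_adjoint V" for h
      using dV carrier_matD[OF Y] by (simp_all add: XY conj_def mult_mat_assoc V1')
    let ?F = "\<lambda>i. complex_of_real (f i)"
    have "mat_adjoint V * (X * S) * V = mat_adjoint V * (S * X) * V" using XS by simp
    then have YF: "Y * mat_diag d ?F = mat_diag d ?F * Y"
      using dV carrier_matD[OF Y] V1 by (simp add: S' comm mult_mat_assoc V1')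
    have "Y * mat_diag d g = mat_diag d g * Y"
    proof (rule eq_matI)
      fix i j assume "i < dim_row (mat_diag d g * Y)" "j < dim_col (mat_diag d g * Y)"
      then have ij: "i < d" "j < d" using Y by auto
      have "Y $$ (i, j) * ?F j = ?F i * Y $$ (i, j)"
        using arg_cong[OF YF, of "\<lambda>Z. Z $$ (i, j)"] ij
        by (simp add: mat_diag_mult_right[OF Y] mat_diag_mult_left[OF Y])
      then have "Y $$ (i, j) = 0 \<or> f i = f j" by auto
      then have "Y $$ (i, j) * g j = g i * Y $$ (i, j)" by (auto simp: g_def)
      then show "(Y * mat_diag d g) $$ (i, j) = (mat_diag d g * Y) $$ (i, j)"
        using ij by (simp add: mat_diag_mult_right[OF Y] mat_diag_mult_left[OF Y])
    qed (use Y in auto)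
    then show ?thesis by (simp add: comm)
  qed
  ultimately show ?thesis using cc by blast
qed

text \<open>
  The column space of \<open>B\<close> is that of \<open>B B\<^sup>*\<close>, hence of \<open>A A\<^sup>*\<close>, so it lies in that of \<open>A\<close>; \<open>W\<close> is obtained
  from the pseudoinverse of \<open>A A\<^sup>*\<close>.  Applied to matrices whose columns are Kraus operators, this
  says that all Kraus representations of a map have the same span.
\<close>

lemma equal_gram_factor:
  fixes A B :: cmat
  assumes A: "A \<in> carrier_mat n p" and B: "B \<in> carrier_mat n m"
    and AB: "A * mat_adjoint A = B * mat_adjoint B"
  shows "\<exists>W \<in> carrier_mat p m. B = A * W"
proof -
  note dA = carrier_matD[OF A] carrier_matD[OF B]
  from psd_spectral[OF psd_mult_adjoint[OF A]] obtain V f where V: "unitary_mat n V"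
    and AV: "A * mat_adjoint A = V * mat_diag n (\<lambda>i. of_real (f i)) * mat_adjoint V" by blast
  have Vc: "V \<in> carrier_mat n n" and V1: "mat_adjoint V * V = 1\<^sub>m n" and V2: "V * mat_adjoint V = 1\<^sub>m n"
    using V by (auto simp: unitary_mat_def)
  note dV = carrier_matD[OF Vc]
  define C where "C = mat_adjoint V * B"
  have C: "C \<in> carrier_mat n m" using dV dA by (intro carrier_matI) (auto simp: C_def)
  have C0: "C $$ (i, l) = 0" if i: "i < n" and fi: "f i = 0" and l: "l < m" for i l
  proof -
    have "bil n (B * mat_adjoint B) (\<lambda>s. V $$ (s, i)) (\<lambda>s. V $$ (s, i)) = 0"
      using unitary_diag_bil[OF V i] fi by (simp flip: AB add: AV)
    then have "(\<Sum>s<n. cnj (V $$ (s, i)) * B $$ (s, l)) = 0"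
      using complex_sum_mult_cnj_eq_0[of "{..<m}" "\<lambda>l. \<Sum>s<n. cnj (V $$ (s, i)) * B $$ (s, l)" l] l
      unfolding bil_gram[OF B] by simp
    then show ?thesis
      using i l dV by (simp add: C_def mat_mult_index[OF mat_adjoint_carrier[OF Vc] B i l])
  qed
  let ?F = "mat_diag n (\<lambda>i. complex_of_real (f i))"
  let ?E = "mat_diag n (\<lambda>i. complex_of_real (inverse (f i)))"
  \<comment> \<open>\<open>?F ?E\<close> is the projection to the nonzero eigenvalues, because \<open>inverse 0 = 0\<close>.\<close>
  have FE: "?F * (?E * C) = C"
  proof -
    have "?F * (?E * C) = mat_diag n (\<lambda>i. complex_of_real (f i) * complex_of_real (inverse (f i))) * C"
      using carrier_matD[OF C] by (simp flip: mult_mat_assoc mat_diag_diag)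
    also have "\<dots> = C"
      unfolding mat_diag_mult_left[OF C]
    proof (rule eq_matI)
      fix i l assume "i < dim_row C" "l < dim_col C"
      then have il: "i < n" "l < m" using C by auto
      then show "mat n m (\<lambda>(i, j). complex_of_real (f i) * complex_of_real (inverse (f i)) * C $$ (i, j)) $$ (i, l)
          = C $$ (i, l)"
        using C0[of i l] by (cases "f i = 0") auto
    qed (use C in auto)
    finally show ?thesis .
  qed
  define W where "W = mat_adjoint A * (V * (?E * C))"
  have W: "W \<in> carrier_mat p m" using dA dV carrier_matD[OF C] by (intro carrier_matI) (auto simp: W_def)
  have "A * W = V * ?F * mat_adjoint V * (V * (?E * C))"
    unfolding AV[symmetric] W_def using dA dV carrier_matD[OF C] by (simp add: mult_mat_assoc)
  also have "\<dots> = V * (?F * ((mat_adjoint V * V) * (?E * C)))"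
    using dA dV carrier_matD[OF C] by (simp add: mult_mat_assoc)
  also have "\<dots> = V * C" using V1 carrier_matD[OF C] FE by simp
  also have "\<dots> = (V * mat_adjoint V) * B" using dV dA by (simp add: C_def mult_mat_assoc)
  also have "\<dots> = B" using V2 dA by simp
  finally show ?thesis using W by metis
qed

section \<open>Entanglement breaking maps measure and prepare\<close>

lemma sum_lessThan_mult:
  fixes f :: "nat \<Rightarrow> 'a :: comm_monoid_add"
  shows "(\<Sum>s<k * d. f s) = (\<Sum>a<k. \<Sum>i<d. f (a * d + i))"
proof -
  have "(\<Sum>i = a * d..<a * d + d. f i) = (\<Sum>i<d. f (a * d + i))" for a
    by (simp add: sum.atLeastLessThan_shift_0 atLeast0LessThan)
  then show ?thesis by (simp flip: sum.nat_group)
qed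

lemma bil_product_index:
  "bil (k * d) X u v = (\<Sum>a<k. \<Sum>b<k. \<Sum>i<d. \<Sum>j<d.
     cnj (u (a * d + i)) * X $$ (a * d + i, b * d + j) * v (b * d + j))"
  unfolding bil_def sum_lessThan_mult
  by (rule sum.cong[OF refl], rule sum.swap)

lemma psd_kron:
  assumes P: "psd k P" and Q: "psd d Q"
  shows "psd (k * d) (kron P Q)"
proof -
  obtain A where A: "A \<in> carrier_mat k k" and PA: "P = A * mat_adjoint A" using psd_gram[OF P] by blast
  obtain B where B: "B \<in> carrier_mat d d" and QB: "Q = B * mat_adjoint B" using psd_gram[OF Q] by blast
  have Pc: "P \<in> carrier_mat k k" and Qc: "Q \<in> carrier_mat d d" using P Q by (auto dest: psd_carrier)
  have Pi: "P $$ (a, b) = (\<Sum>s<k. A $$ (a, s) * cnj (A $$ (b, s)))" if "a < k" "b < k" for a b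
    unfolding PA using A that by (subst mat_mult_index[of _ k k _ k]) auto
  have Qi: "Q $$ (a, b) = (\<Sum>s<d. B $$ (a, s) * cnj (B $$ (b, s)))" if "a < d" "b < d" for a b
    unfolding QB using B that by (subst mat_mult_index[of _ d d _ d]) auto
  define K where "K = kron A B"
  have K: "K \<in> carrier_mat (k * d) (k * d)" using A B by (simp add: K_def kron_def)
  have "kron P Q = K * mat_adjoint K"
  proof (rule eq_matI)
    fix i j assume "i < dim_row (K * mat_adjoint K)" "j < dim_col (K * mat_adjoint K)"
    then have ij: "i < k * d" "j < k * d" using K by auto
    then have dm: "i div d < k" "j div d < k" "i mod d < d" "j mod d < d"
      by (auto simp: less_mult_imp_div_less intro!: mod_less_divisor gr0I)
    have Ki: "K $$ (i, a * d + b) = A $$ (i div d, a) * B $$ (i mod d, b)"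
      if "i < k * d" "a < k" "b < d" for i a b
      using that A B by (simp add: K_def kron_def block_index)
    have "(K * mat_adjoint K) $$ (i, j) = (\<Sum>s<k * d. K $$ (i, s) * cnj (K $$ (j, s)))"
      using K ij by (subst mat_mult_index[of _ "k * d" "k * d" _ "k * d"]) auto
    also have "\<dots> = (\<Sum>a<k. \<Sum>b<d. A $$ (i div d, a) * cnj (A $$ (j div d, a)) *
        (B $$ (i mod d, b) * cnj (B $$ (j mod d, b))))"
      unfolding sum_lessThan_mult using ij by (intro sum.cong refl) (simp add: Ki)
    also have "\<dots> = P $$ (i div d, j div d) * Q $$ (i mod d, j mod d)"
      using dm by (simp add: Pi Qi sum_product)
    finally show "kron P Q $$ (i, j) = (K * mat_adjoint K) $$ (i, j)"
      using ij Pc Qc by (simp add: kron_def)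
  qed (use K Pc Qc in \<open>auto simp: kron_def\<close>)
  then show ?thesis using psd_mult_adjoint[OF K] by simp
qed

lemma bil_mat_sum:
  "bil d (mat_sum d n M) u v = (\<Sum>l<n. bil d (M l) u v)"
proof -
  have "bil d (mat_sum d n M) u v = (\<Sum>i<d. \<Sum>j<d. \<Sum>l<n. cnj (u i) * M l $$ (i, j) * v j)"
    unfolding bil_def by (intro sum.cong refl) (simp add: mat_sum_def sum_distrib_left sum_distrib_right)
  also have "\<dots> = (\<Sum>l<n. bil d (M l) u v)"
    unfolding bil_def by (simp only: sum.swap[of _ "{..<n}"])
  finally show ?thesis .
qed

lemma separable_psd:
  assumes "separable k d X"
  shows "psd (k * d) X"
proof -
  obtain n P Q where PQ: "\<forall>l<n. psd k (P l) \<and> psd d (Q l)"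
    and X: "X = mat_sum (k * d) n (\<lambda>l. kron (P l) (Q l))"
    using assms by (auto simp: separable_def)
  have "0 \<le> bil (k * d) X w w" for w
    unfolding X bil_mat_sum using PQ by (intro sum_nonneg psd_bil_nonneg psd_kron) auto
  then show ?thesis by (simp add: psd_iff_bil X mat_sum_def)
qed

lemma bil_linear:
  assumes "X \<in> carrier_mat d d" "Y \<in> carrier_mat d d"
  shows "bil d (X + Y) u v = bil d X u v + bil d Y u v" "bil d (c \<cdot>\<^sub>m X) u v = c * bil d X u v"
proof -
  have "bil d (X + Y) u v = (\<Sum>i<d. \<Sum>j<d. cnj (u i) * X $$ (i, j) * v j + cnj (u i) * Y $$ (i, j) * v j)"
    unfolding bil_def by (intro sum.cong refl) (use assms in \<open>auto simp: algebra_simps\<close>)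
  then show "bil d (X + Y) u v = bil d X u v + bil d Y u v" by (simp add: sum.distrib bil_def)
  show "bil d (c \<cdot>\<^sub>m X) u v = c * bil d X u v"
    unfolding bil_def sum_distrib_left by (intro sum.cong refl) (use assms in auto)
qed

text \<open>
  The map measures its input with the vectors \<open>\<xi> l\<close> and prepares the columns of \<open>H\<close>.  On one half of a
  bipartite matrix the measurement leaves the psd matrix \<open>P l\<close> on the other half, next to the prepared
  rank one matrix \<open>Q l\<close>.
\<close>

lemma holevo_EB:
  assumes H: "H \<in> carrier_mat d2 m"
    and \<Phi>: "\<And>X. X \<in> carrier_mat d1 d1 \<Longrightarrow>
      \<Phi> X = H * mat_diag m (\<lambda>l. bil d1 X (\<xi> l) (\<xi> l)) * mat_adjoint H"
  shows "entanglement_breaking d1 d2 \<Phi>"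
proof -
  have idx: "\<Phi> X $$ (i, j) = (\<Sum>l<m. bil d1 X (\<xi> l) (\<xi> l) * H $$ (i, l) * cnj (H $$ (j, l)))"
    if "X \<in> carrier_mat d1 d1" "i < d2" "j < d2" for X i j
    using \<Phi>[OF that(1)] sandwich_diag_index[OF H H that(2,3)] by simp
  have car: "\<Phi> X \<in> carrier_mat d2 d2" if "X \<in> carrier_mat d1 d1" for X
    using \<Phi>[OF that] H by (intro carrier_matI) auto
  have lin: "linear_map d1 d2 \<Phi>"
    unfolding linear_map_def
  proof (intro conjI ballI allI)
    fix X Y :: cmat and c :: complex assume X: "X \<in> carrier_mat d1 d1"
    show "\<Phi> X \<in> carrier_mat d2 d2" by (rule car[OF X])
    show "\<Phi> (c \<cdot>\<^sub>m X) = c \<cdot>\<^sub>m \<Phi> X"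
      by (rule eq_matI) (use X car[OF X] car[of "c \<cdot>\<^sub>m X"] in
        \<open>auto simp: idx bil_linear sum_distrib_left mult_ac\<close>)
    assume Y: "Y \<in> carrier_mat d1 d1"
    show "\<Phi> (X + Y) = \<Phi> X + \<Phi> Y"
      by (rule eq_matI) (use X Y car[OF X] car[OF Y] car[of "X + Y"] in
        \<open>auto simp: idx bil_linear sum.distrib algebra_simps\<close>)
  qed
  have sep: "separable k d2 (id_tensor k d1 d2 \<Phi> \<rho>)" if \<rho>: "psd (k * d1) \<rho>" for k \<rho>
  proof -
    define P where "P l = mat k k (\<lambda>(a, b). bil d1 (block d1 \<rho> a b) (\<xi> l) (\<xi> l))" for l
    define Q where "Q l = mat d2 d2 (\<lambda>(i, j). H $$ (i, l) * cnj (H $$ (j, l)))" for l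
    have "psd k (P l)" for l
    proof -
      have "bil k (P l) v v = bil (k * d1) \<rho> (\<lambda>s. v (s div d1) * \<xi> l (s mod d1)) (\<lambda>s. v (s div d1) * \<xi> l (s mod d1))" for v
      proof -
        have "bil k (P l) v v = (\<Sum>a<k. \<Sum>b<k. cnj (v a) * bil d1 (block d1 \<rho> a b) (\<xi> l) (\<xi> l) * v b)"
          unfolding bil_def[of k] by (intro sum.cong refl) (auto simp: P_def)
        also have "\<dots> = (\<Sum>a<k. \<Sum>b<k. \<Sum>i<d1. \<Sum>j<d1.
            cnj (v a * \<xi> l i) * \<rho> $$ (a * d1 + i, b * d1 + j) * (v b * \<xi> l j))"
          by (intro sum.cong refl)
            (auto simp: bil_def block_def sum_distrib_left sum_distrib_right mult_ac intro!: sum.cong)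
        also have "\<dots> = bil (k * d1) \<rho> (\<lambda>s. v (s div d1) * \<xi> l (s mod d1)) (\<lambda>s. v (s div d1) * \<xi> l (s mod d1))"
          unfolding bil_product_index by (intro sum.cong refl) auto
        finally show ?thesis .
      qed
      then show ?thesis using psd_bil_nonneg[OF \<rho>] by (simp add: psd_iff_bil P_def)
    qed
    moreover have "psd d2 (Q l)" for l
    proof -
      have "bil d2 (Q l) v v = (\<Sum>i<d2. cnj (v i) * H $$ (i, l)) * cnj (\<Sum>i<d2. cnj (v i) * H $$ (i, l))" for v
        unfolding bil_def cnj_sum sum_product by (intro sum.cong refl) (auto simp: Q_def)
      then have "0 \<le> bil d2 (Q l) v v" for v by (simp only: complex_mult_cnj_nonneg)
      then show ?thesis by (simp add: psd_iff_bil Q_def)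
    qed
    moreover have "id_tensor k d1 d2 \<Phi> \<rho> = mat_sum (k * d2) m (\<lambda>l. kron (P l) (Q l))"
    proof (rule eq_matI)
      fix i j assume "i < dim_row (mat_sum (k * d2) m (\<lambda>l. kron (P l) (Q l)))"
        "j < dim_col (mat_sum (k * d2) m (\<lambda>l. kron (P l) (Q l)))"
      then have ij: "i < k * d2" "j < k * d2" by (auto simp: mat_sum_def)
      then have dm: "i div d2 < k" "j div d2 < k" "i mod d2 < d2" "j mod d2 < d2"
        by (auto simp: less_mult_imp_div_less intro!: mod_less_divisor gr0I)
      show "id_tensor k d1 d2 \<Phi> \<rho> $$ (i, j) = mat_sum (k * d2) m (\<lambda>l. kron (P l) (Q l)) $$ (i, j)"
        using ij dm by (auto simp: id_tensor_def mat_sum_def kron_def P_def Q_def idx block_def mult.assoc)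
    qed (auto simp: id_tensor_def mat_sum_def)
    ultimately show ?thesis unfolding separable_def by blast
  qed
  show ?thesis
    unfolding entanglement_breaking_def completely_positive_def
    using lin sep separable_psd by blast
qed

definition elem_mat :: "nat \<Rightarrow> nat \<times> nat \<Rightarrow> cmat" where
  "elem_mat d p = mat d d (\<lambda>q. if q = p then 1 else 0)"

lemma elem_mat_carrier [simp]: "elem_mat d p \<in> carrier_mat d d"
  by (simp add: elem_mat_def)

text \<open>
  By induction on a set \<open>K\<close> of positions for the matrix that agrees with \<open>X\<close> on \<open>K\<close> and is zero elsewhere.
\<close>

lemma linear_map_expand:
  assumes \<Phi>: "linear_map d1 d2 \<Phi>" and X: "X \<in> carrier_mat d1 d1" and ij: "i < d2" "j < d2"
  shows "\<Phi> X $$ (i, j) = (\<Sum>a<d1. \<Sum>b<d1. X $$ (a, b) * \<Phi> (elem_mat d1 (a, b)) $$ (i, j))"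
proof -
  define R where "R K = mat d1 d1 (\<lambda>p. if p \<in> K then X $$ p else 0)" for K
  have R: "R K \<in> carrier_mat d1 d1" for K by (simp add: R_def)
  have E: "elem_mat d1 p \<in> carrier_mat d1 d1" for p by (simp add: elem_mat_def)
  note lin = \<Phi>[unfolded linear_map_def]
  have "\<Phi> (R K) $$ (i, j) = (\<Sum>p\<in>K. X $$ p * \<Phi> (elem_mat d1 p) $$ (i, j))"
    if "finite K" "K \<subseteq> {..<d1} \<times> {..<d1}" for K
    using that
  proof (induction K rule: finite_induct)
    case empty
    have "R {} = 0 \<cdot>\<^sub>m X" using X by (intro eq_matI) (auto simp: R_def)
    then have "\<Phi> (R {}) = 0 \<cdot>\<^sub>m \<Phi> X" using lin X by auto
    moreover have "\<Phi> X \<in> carrier_mat d2 d2" using lin X by auto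
    ultimately show ?case using ij by auto
  next
    case (insert p K)
    have "R (insert p K) = R K + X $$ p \<cdot>\<^sub>m elem_mat d1 p"
      using insert.hyps by (intro eq_matI) (auto simp: R_def elem_mat_def)
    then have "\<Phi> (R (insert p K)) = \<Phi> (R K) + X $$ p \<cdot>\<^sub>m \<Phi> (elem_mat d1 p)"
      using lin R E by auto
    moreover have "\<Phi> (R K) \<in> carrier_mat d2 d2" "\<Phi> (elem_mat d1 p) \<in> carrier_mat d2 d2"
      using lin R E by auto
    ultimately show ?case using insert ij by auto
  qed
  from this[of "{..<d1} \<times> {..<d1}"]
  have "\<Phi> (R ({..<d1} \<times> {..<d1})) $$ (i, j) = (\<Sum>a<d1. \<Sum>b<d1. X $$ (a, b) * \<Phi> (elem_mat d1 (a, b)) $$ (i, j))"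
    by (simp add: sum.cartesian_product)
  moreover have "R ({..<d1} \<times> {..<d1}) = X" using X by (intro eq_matI) (auto simp: R_def)
  ultimately show ?thesis by simp
qed

definition unit_vecs :: "nat \<Rightarrow> nat \<Rightarrow> (nat \<Rightarrow> nat \<Rightarrow> complex) \<Rightarrow> bool" where
  "unit_vecs d m \<xi> \<longleftrightarrow> (\<forall>l<m. (\<Sum>i<d. cnj (\<xi> l i) * \<xi> l i) = 1)"

text \<open>
  Measure-and-prepare (Holevo) form: \<open>\<Phi> X\<close> is the sum of the matrices \<open>(\<xi>\<^sub>l\<^sup>* X \<xi>\<^sub>l) \<eta>\<^sub>l \<eta>\<^sub>l\<^sup>*\<close> where \<open>\<eta>\<^sub>l\<close> is
  the \<open>l\<close>-th column of \<open>H\<close>.  The norm of \<open>\<xi>\<^sub>l\<close> is absorbed in \<open>\<eta>\<^sub>l\<close>, so that unitality of \<open>\<Phi>\<close> reads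
  \<open>H H\<^sup>* = 1\<close>.
\<close>

definition holevo :: "nat \<Rightarrow> nat \<Rightarrow> nat \<Rightarrow> (nat \<Rightarrow> nat \<Rightarrow> complex) \<Rightarrow> cmat \<Rightarrow> (cmat \<Rightarrow> cmat) \<Rightarrow> bool" where
  "holevo d1 d2 m \<xi> H \<Phi> \<longleftrightarrow> H \<in> carrier_mat d2 m \<and> unit_vecs d1 m \<xi> \<and>
     (\<forall>X \<in> carrier_mat d1 d1.
        \<Phi> X = H * mat_diag m (\<lambda>l. bil d1 X (\<xi> l) (\<xi> l)) * mat_adjoint H)"

text \<open>
  The Choi matrix is separable; splitting its factors into rank one matrices gives the entries of
  \<open>\<Phi>\<close> at the matrix units.
\<close>

lemma EB_holevo:
  assumes EB: "entanglement_breaking d1 d2 \<Phi>"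
  shows "\<exists>m \<xi> H. holevo d1 d2 m \<xi> H \<Phi>"
proof -
  have lin: "linear_map d1 d2 \<Phi>" using EB by (simp add: entanglement_breaking_def completely_positive_def)
  \<comment> \<open>The unnormalised maximally entangled matrix: its blocks are the matrix units.\<close>
  define \<rho> where "\<rho> = mat (d1 * d1) (d1 * d1)
    (\<lambda>(s, t). if s div d1 = s mod d1 \<and> t div d1 = t mod d1 then 1 else 0 :: complex)"
  have "psd (d1 * d1) \<rho>"
  proof -
    have "bil (d1 * d1) \<rho> w w = (\<Sum>s<d1 * d1. if s div d1 = s mod d1 then cnj (w s) else 0)
        * cnj (\<Sum>s<d1 * d1. if s div d1 = s mod d1 then cnj (w s) else 0)" for w
      unfolding bil_def cnj_sum sum_product by (intro sum.cong refl) (auto simp: \<rho>_def)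
    then have "0 \<le> bil (d1 * d1) \<rho> w w" for w by (simp only: complex_mult_cnj_nonneg)
    then show ?thesis by (simp add: psd_iff_bil \<rho>_def)
  qed
  then have "separable d1 d2 (id_tensor d1 d1 d2 \<Phi> \<rho>)" using EB by (simp add: entanglement_breaking_def)
  then obtain n P Q where PQ: "\<And>l. l < n \<Longrightarrow> psd d1 (P l)" "\<And>l. l < n \<Longrightarrow> psd d2 (Q l)"
    and C: "id_tensor d1 d1 d2 \<Phi> \<rho> = mat_sum (d1 * d2) n (\<lambda>l. kron (P l) (Q l))"
    by (auto simp: separable_def)
  have blk: "block d1 \<rho> a b = elem_mat d1 (a, b)" if "a < d1" "b < d1" for a b
    by (rule eq_matI) (use that in \<open>auto simp: block_def \<rho>_def elem_mat_def block_index\<close>)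
  have \<Phi>E: "\<Phi> (elem_mat d1 (a, b)) $$ (i, j) = (\<Sum>l<n. P l $$ (a, b) * Q l $$ (i, j))"
    if "a < d1" "b < d1" "i < d2" "j < d2" for a b i j
  proof -
    have "\<Phi> (elem_mat d1 (a, b)) $$ (i, j) = id_tensor d1 d1 d2 \<Phi> \<rho> $$ (a * d2 + i, b * d2 + j)"
      using that by (simp add: id_tensor_def block_index blk)
    also have "\<dots> = (\<Sum>l<n. kron (P l) (Q l) $$ (a * d2 + i, b * d2 + j))"
      unfolding C using that by (simp add: mat_sum_def block_index)
    also have "\<dots> = (\<Sum>l<n. P l $$ (a, b) * Q l $$ (i, j))"
    proof (intro sum.cong refl)
      fix l assume "l \<in> {..<n}"
      then have "dim_row (P l) = d1" "dim_col (P l) = d1" "dim_row (Q l) = d2" "dim_col (Q l) = d2"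
        using PQ[THEN psd_carrier, of l] by auto
      then show "kron (P l) (Q l) $$ (a * d2 + i, b * d2 + j) = P l $$ (a, b) * Q l $$ (i, j)"
        using that by (simp add: kron_def block_index)
    qed
    finally show ?thesis .
  qed
  have "\<forall>l. \<exists>A. l < n \<longrightarrow> A \<in> carrier_mat d1 d1 \<and> P l = A * mat_adjoint A" using psd_gram PQ(1) by blast
  then obtain A where A: "\<And>l. l < n \<Longrightarrow> A l \<in> carrier_mat d1 d1" "\<And>l. l < n \<Longrightarrow> P l = A l * mat_adjoint (A l)"
    by metis
  have "\<forall>l. \<exists>B. l < n \<longrightarrow> B \<in> carrier_mat d2 d2 \<and> Q l = B * mat_adjoint B" using psd_gram PQ(2) by blast
  then obtain B where B: "\<And>l. l < n \<Longrightarrow> B l \<in> carrier_mat d2 d2" "\<And>l. l < n \<Longrightarrow> Q l = B l * mat_adjoint (B l)"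
    by metis
  have Pi: "P l $$ (a, b) = (\<Sum>s<d1. A l $$ (a, s) * cnj (A l $$ (b, s)))" if "l < n" "a < d1" "b < d1" for l a b
    unfolding A(2)[OF that(1)] using A(1)[OF that(1)] that by (subst mat_mult_index[of _ d1 d1 _ d1]) auto
  have Qi: "Q l $$ (a, b) = (\<Sum>s<d2. B l $$ (a, s) * cnj (B l $$ (b, s)))" if "l < n" "a < d2" "b < d2" for l a b
    unfolding B(2)[OF that(1)] using B(1)[OF that(1)] that by (subst mat_mult_index[of _ d2 d2 _ d2]) auto
  define I where "I = {..<n} \<times> {..<d1} \<times> {..<d2}"
  define p where "p x a = cnj (A (fst x) $$ (a, fst (snd x)))" for x :: "nat \<times> nat \<times> nat" and a
  define q where "q x i = B (fst x) $$ (i, snd (snd x))" for x :: "nat \<times> nat \<times> nat" and i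
  have \<Phi>X: "\<Phi> X $$ (i, j) = (\<Sum>x\<in>I. bil d1 X (p x) (p x) * q x i * cnj (q x j))"
    if X: "X \<in> carrier_mat d1 d1" and ij: "i < d2" "j < d2" for X i j
  proof -
    have *: "\<Phi> (elem_mat d1 (a, b)) $$ (i, j) = (\<Sum>x\<in>I. cnj (p x a) * p x b * q x i * cnj (q x j))"
      if "a < d1" "b < d1" for a b
    proof -
      have "\<Phi> (elem_mat d1 (a, b)) $$ (i, j)
          = (\<Sum>l<n. \<Sum>s<d1. \<Sum>t<d2. A l $$ (a, s) * cnj (A l $$ (b, s)) * (B l $$ (i, t) * cnj (B l $$ (j, t))))"
        unfolding \<Phi>E[OF that ij] using that ij by (intro sum.cong refl) (simp add: Pi Qi sum_product)
      also have "\<dots> = (\<Sum>x\<in>I. cnj (p x a) * p x b * q x i * cnj (q x j))"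
        unfolding I_def p_def q_def sum.cartesian_product
        by (intro sum.cong refl) (auto simp: mult_ac)
      finally show ?thesis .
    qed
    have "\<Phi> X $$ (i, j) = (\<Sum>a<d1. \<Sum>b<d1. \<Sum>x\<in>I. X $$ (a, b) * (cnj (p x a) * p x b * q x i * cnj (q x j)))"
      unfolding linear_map_expand[OF lin X ij] by (intro sum.cong refl) (auto simp: * sum_distrib_left)
    also have "\<dots> = (\<Sum>x\<in>I. \<Sum>a<d1. \<Sum>b<d1. X $$ (a, b) * (cnj (p x a) * p x b * q x i * cnj (q x j)))"
      by (simp only: sum.swap[of _ I])
    also have "\<dots> = (\<Sum>x\<in>I. bil d1 X (p x) (p x) * q x i * cnj (q x j))"
      unfolding bil_def sum_distrib_right by (intro sum.cong refl) (simp add: mult_ac)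
    finally show ?thesis .
  qed
  define N where "N x = (\<Sum>a<d1. (cmod (p x a))\<^sup>2)" for x
  \<comment> \<open>Terms with a zero vector contribute nothing and cannot be normalised.\<close>
  define J where "J = {x \<in> I. N x \<noteq> 0}"
  have "finite J" by (simp add: J_def I_def)
  then obtain e where e: "bij_betw e {..<card J} J"
    using ex_bij_betw_nat_finite by (metis atLeast0LessThan)
  have eJ: "e l \<in> J" if "l < card J" for l using e that by (auto simp: bij_betw_def)
  have Npos: "N x > 0" if "x \<in> J" for x
    using that by (simp add: J_def N_def less_le sum_nonneg)
  define r where "r x = complex_of_real (sqrt (N x))" for x
  have rr: "cnj (r x) = r x" "r x * r x = of_real (N x)" "r x \<noteq> 0" if "x \<in> J" for x
    using Npos[OF that] by (auto simp: r_def simp flip: of_real_mult)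
  define \<xi> where "\<xi> l a = p (e l) a / r (e l)" for l a
  define H where "H = mat d2 (card J) (\<lambda>(i, l). r (e l) * q (e l) i)"
  have "unit_vecs d1 (card J) \<xi>"
    unfolding unit_vecs_def
  proof (intro allI impI)
    fix l assume l: "l < card J"
    have "(\<Sum>i<d1. cnj (\<xi> l i) * \<xi> l i) = (\<Sum>i<d1. p (e l) i * cnj (p (e l) i)) / (r (e l) * r (e l))"
      unfolding sum_divide_distrib \<xi>_def using rr(1,3)[OF eJ[OF l]] by (intro sum.cong refl) (simp add: mult_ac)
    also have "(\<Sum>i<d1. p (e l) i * cnj (p (e l) i)) = of_real (N (e l))"
      by (simp add: N_def complex_norm_square[symmetric] del: of_real_power)
    finally show "(\<Sum>i<d1. cnj (\<xi> l i) * \<xi> l i) = 1"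
      using rr(2)[OF eJ[OF l]] Npos[OF eJ[OF l]] by simp
  qed
  moreover have H: "H \<in> carrier_mat d2 (card J)" by (simp add: H_def)
  moreover have "\<Phi> X = H * mat_diag (card J) (\<lambda>l. bil d1 X (\<xi> l) (\<xi> l)) * mat_adjoint H"
    if X: "X \<in> carrier_mat d1 d1" for X
  proof (rule eq_matI)
    have \<Phi>c: "\<Phi> X \<in> carrier_mat d2 d2" using lin X by (simp add: linear_map_def)
    fix i j assume "i < dim_row (H * mat_diag (card J) (\<lambda>l. bil d1 X (\<xi> l) (\<xi> l)) * mat_adjoint H)"
      "j < dim_col (H * mat_diag (card J) (\<lambda>l. bil d1 X (\<xi> l) (\<xi> l)) * mat_adjoint H)"
    then have ij: "i < d2" "j < d2" using H by auto
    have scale: "bil d1 X (p (e l)) (p (e l)) = bil d1 X (\<xi> l) (\<xi> l) * (r (e l) * r (e l))" if "l < card J" for l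
      unfolding bil_def \<xi>_def sum_distrib_right using rr(1,3)[OF eJ[OF that]]
      by (intro sum.cong refl) (simp add: field_simps)
    have zero: "bil d1 X (p x) (p x) = 0" if "N x = 0" for x
    proof -
      have "p x a = 0" if "a < d1" for a
        using \<open>N x = 0\<close> that by (auto simp: N_def sum_nonneg_eq_0_iff)
      then show ?thesis by (simp add: bil_def)
    qed
    have "\<Phi> X $$ (i, j) = (\<Sum>x\<in>J. bil d1 X (p x) (p x) * q x i * cnj (q x j))"
      unfolding \<Phi>X[OF X ij] by (rule sum.mono_neutral_right) (auto simp: J_def I_def zero)
    also have "\<dots> = (\<Sum>l<card J. bil d1 X (p (e l)) (p (e l)) * q (e l) i * cnj (q (e l) j))"
      by (rule sum.reindex_bij_betw[OF e, symmetric])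
    also have "\<dots> = (\<Sum>l<card J. bil d1 X (\<xi> l) (\<xi> l) * H $$ (i, l) * cnj (H $$ (j, l)))"
      using rr eJ ij by (intro sum.cong refl) (auto simp: scale H_def)
    also have "\<dots> = (H * mat_diag (card J) (\<lambda>l. bil d1 X (\<xi> l) (\<xi> l)) * mat_adjoint H) $$ (i, j)"
      by (rule sandwich_diag_index[OF H H ij, symmetric])
    finally show "\<Phi> X $$ (i, j) = (H * mat_diag (card J) (\<lambda>l. bil d1 X (\<xi> l) (\<xi> l)) * mat_adjoint H) $$ (i, j)" .
  qed (use H lin X in \<open>auto simp: linear_map_def\<close>)
  ultimately show ?thesis unfolding holevo_def by blast
qed

section \<open>Orthogonality of prepared vectors on different rays\<close>

text \<open>
  For unit vectors: \<open>x\<close> and \<open>y\<close> differ by a phase.  Comparing the rank one projections avoids naming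
  that phase.
\<close>

definition same_ray :: "nat \<Rightarrow> (nat \<Rightarrow> complex) \<Rightarrow> (nat \<Rightarrow> complex) \<Rightarrow> bool" where
  "same_ray d x y \<longleftrightarrow> (\<forall>i<d. \<forall>j<d. x i * cnj (x j) = y i * cnj (y j))"

text \<open>
  The condition on the Holevo form that both properties of the theorem amount to: columns of \<open>H\<close> that
  belong to different rays are orthogonal.
\<close>

definition orthogonal_classes :: "nat \<Rightarrow> nat \<Rightarrow> (nat \<Rightarrow> nat \<Rightarrow> complex) \<Rightarrow> cmat \<Rightarrow> bool" where
  "orthogonal_classes d m \<xi> H \<longleftrightarrow>
     (\<forall>k<m. \<forall>l<m. (mat_adjoint H * H) $$ (k, l) \<noteq> 0 \<longrightarrow> same_ray d (\<xi> k) (\<xi> l))"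

lemma same_ray_refl [simp]: "same_ray d x x"
  by (simp add: same_ray_def)

lemma same_ray_sym: "same_ray d x y \<Longrightarrow> same_ray d y x"
  by (simp add: same_ray_def)

lemma same_ray_trans: "same_ray d x y \<Longrightarrow> same_ray d y z \<Longrightarrow> same_ray d x z"
  by (simp add: same_ray_def)

lemma same_ray_bil:
  assumes "same_ray d x y"
  shows "bil d X x x = bil d X y y"
proof -
  have "bil d X z z = (\<Sum>i<d. \<Sum>j<d. X $$ (i, j) * (z j * cnj (z i)))" for z
    unfolding bil_def by (intro sum.cong refl) (simp add: mult_ac)
  moreover have "(\<Sum>i<d. \<Sum>j<d. X $$ (i, j) * (x j * cnj (x i))) = (\<Sum>i<d. \<Sum>j<d. X $$ (i, j) * (y j * cnj (y i)))"
    using assms by (intro sum.cong refl) (simp add: same_ray_def)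
  ultimately show ?thesis by simp
qed

lemma bil_one: "bil d (1\<^sub>m d) u v = (\<Sum>i<d. cnj (u i) * v i)"
proof -
  have "bil d (1\<^sub>m d) u v = (\<Sum>i<d. \<Sum>j<d. if j = i then cnj (u i) * v i else 0)"
    unfolding bil_def by (intro sum.cong refl) auto
  then show ?thesis by simp
qed

text \<open>
  The projection to the orthogonal complement of the unit vector \<open>x\<close>.  It serves as
  test matrix: among unit vectors its form vanishes exactly on the ray of \<open>x\<close>.
\<close>

definition ray_complement :: "nat \<Rightarrow> (nat \<Rightarrow> complex) \<Rightarrow> cmat" where
  "ray_complement d x = 1\<^sub>m d - mat d d (\<lambda>(i, j). x i * cnj (x j))"

lemma ray_complement_carrier [simp]: "ray_complement d x \<in> carrier_mat d d"
  by (auto simp: ray_complement_def)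

text \<open>
  Pythagoras: the form is the squared distance of \<open>z\<close> from its projection to the line of \<open>x\<close>.
\<close>

lemma bil_ray_complement:
  assumes x: "(\<Sum>i<d. cnj (x i) * x i) = 1"
  defines "c \<equiv> \<lambda>z. \<Sum>i<d. cnj (x i) * z i"
  shows "bil d (ray_complement d x) z z = (\<Sum>i<d. (z i - c z * x i) * cnj (z i - c z * x i))"
proof -
  have cc: "cnj (c z) = (\<Sum>i<d. cnj (z i) * x i)" by (simp add: c_def cnj_sum mult.commute)
  have "bil d (ray_complement d x) z z
      = (\<Sum>i<d. \<Sum>j<d. cnj (z i) * 1\<^sub>m d $$ (i, j) * z j - (cnj (z i) * x i) * (cnj (x j) * z j))"
    unfolding bil_def by (intro sum.cong refl) (auto simp: ray_complement_def algebra_simps)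
  also have "\<dots> = (\<Sum>i<d. cnj (z i) * z i) - cnj (c z) * c z"
    unfolding sum_subtractf bil_one[unfolded bil_def] cc unfolding c_def sum_product ..
  finally have 1: "bil d (ray_complement d x) z z = (\<Sum>i<d. cnj (z i) * z i) - cnj (c z) * c z" .
  have "(\<Sum>i<d. (z i - c z * x i) * cnj (z i - c z * x i))
      = (\<Sum>i<d. cnj (z i) * z i - cnj (c z) * (cnj (x i) * z i) - c z * (cnj (z i) * x i)
           + c z * cnj (c z) * (cnj (x i) * x i))"
    by (intro sum.cong refl) (simp add: algebra_simps)
  also have "\<dots> = (\<Sum>i<d. cnj (z i) * z i) - cnj (c z) * c z - c z * cnj (c z) + c z * cnj (c z) * 1"
    unfolding sum.distrib sum_subtractf sum_distrib_left[symmetric] x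
    by (simp add: cc) (simp add: c_def)
  finally show ?thesis using 1 by simp
qed

lemma bil_ray_complement_self:
  assumes "(\<Sum>i<d. cnj (x i) * x i) = 1"
  shows "bil d (ray_complement d x) x x = 0"
  unfolding bil_ray_complement[OF assms] using assms by simp

lemma psd_ray_complement:
  assumes "(\<Sum>i<d. cnj (x i) * x i) = 1"
  shows "psd d (ray_complement d x)"
  unfolding psd_iff_bil bil_ray_complement[OF assms]
  by (simp only: ray_complement_carrier) (intro conjI TrueI allI sum_nonneg complex_mult_cnj_nonneg)

lemma bil_ray_complement_eq_0:
  assumes x: "(\<Sum>i<d. cnj (x i) * x i) = 1" and z: "(\<Sum>i<d. cnj (z i) * z i) = 1"
    and 0: "bil d (ray_complement d x) z z = 0"
  shows "same_ray d z x"
proof -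
  define c where "c = (\<Sum>i<d. cnj (x i) * z i)"
  have zx: "z i = c * x i" if "i < d" for i
    using complex_sum_mult_cnj_eq_0[of "{..<d}" "\<lambda>i. z i - c * x i" i] that 0
    unfolding bil_ray_complement[OF x] c_def by simp
  have "1 = (\<Sum>i<d. (c * cnj c) * (cnj (x i) * x i))"
    unfolding z[symmetric] by (intro sum.cong refl) (simp add: zx)
  also have "\<dots> = c * cnj c" unfolding sum_distrib_left[symmetric] x by simp
  finally have cc: "c * cnj c = 1" by simp
  have "z i * cnj (z j) = x i * cnj (x j)" if "i < d" "j < d" for i j
  proof -
    have "z i * cnj (z j) = (c * cnj c) * (x i * cnj (x j))" using that by (simp add: zx)
    then show ?thesis using cc by simp
  qed
  then show ?thesis by (simp add: same_ray_def)
qed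

lemma gram_entry:
  fixes H :: cmat
  assumes "H \<in> carrier_mat d m" "k < m" "l < m"
  shows "(mat_adjoint H * H) $$ (k, l) = (\<Sum>i<d. cnj (H $$ (i, k)) * H $$ (i, l))"
  using assms by (subst mat_mult_index[of _ m d _ m]) auto

lemma bil_elem_mat:
  assumes "a < d" "b < d"
  shows "bil d (elem_mat d (a, b)) u v = cnj (u a) * v b"
proof -
  have "bil d (elem_mat d (a, b)) u v = (\<Sum>i<d. \<Sum>j<d. if j = b then if i = a then cnj (u a) * v b else 0 else 0)"
    unfolding bil_def by (intro sum.cong refl) (auto simp: elem_mat_def)
  then show ?thesis using assms by simp
qed

section \<open>Degradable maps\<close>

lemma linear_map_sandwich_diag:
  assumes \<Gamma>: "linear_map d e \<Gamma>" and H: "H \<in> carrier_mat d m" and ij: "i < e" "j < e"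
  shows "\<Gamma> (H * mat_diag m f * mat_adjoint H) $$ (i, j)
    = (\<Sum>l<m. f l * \<Gamma> (mat d d (\<lambda>(a, b). H $$ (a, l) * cnj (H $$ (b, l)))) $$ (i, j))"
proof -
  have c: "H * mat_diag m f * mat_adjoint H \<in> carrier_mat d d" using H by (intro carrier_matI) auto
  have "\<Gamma> (H * mat_diag m f * mat_adjoint H) $$ (i, j)
     = (\<Sum>a<d. \<Sum>b<d. \<Sum>l<m. f l * (H $$ (a, l) * cnj (H $$ (b, l)) * \<Gamma> (elem_mat d (a, b)) $$ (i, j)))"
    unfolding linear_map_expand[OF \<Gamma> c ij]
    by (intro sum.cong refl) (use H in \<open>auto simp: sandwich_diag_index sum_distrib_left sum_distrib_right mult_ac\<close>)
  also have "\<dots> = (\<Sum>l<m. \<Sum>a<d. \<Sum>b<d. f l * (H $$ (a, l) * cnj (H $$ (b, l)) * \<Gamma> (elem_mat d (a, b)) $$ (i, j)))"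
    by (simp only: sum.swap[of _ "{..<m}"])
  also have "\<dots> = (\<Sum>l<m. f l * \<Gamma> (mat d d (\<lambda>(a, b). H $$ (a, l) * cnj (H $$ (b, l)))) $$ (i, j))"
    by (intro sum.cong refl, subst linear_map_expand[OF \<Gamma> _ ij]) (simp_all add: sum_distrib_left)
  finally show ?thesis .
qed

lemma sum_swap_3_2:
  "(\<Sum>i\<in>A. \<Sum>a\<in>B. \<Sum>b\<in>C. \<Sum>c\<in>D. \<Sum>d\<in>E. F i a b c d)
    = (\<Sum>c\<in>D. \<Sum>d\<in>E. \<Sum>i\<in>A. \<Sum>a\<in>B. \<Sum>b\<in>C. F i a b c d)"
  by (simp only: sum.swap[of _ D]) (simp only: sum.swap[of _ E])

lemma completely_positive_psd:
  assumes "completely_positive d e \<Gamma>" "psd d X"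
  shows "psd e (\<Gamma> X)"
proof -
  have X: "X \<in> carrier_mat d d" using assms(2) by (rule psd_carrier)
  have c: "\<Gamma> X \<in> carrier_mat e e" using assms(1) X by (simp add: completely_positive_def linear_map_def)
  have "psd (1 * d) X" using assms(2) by simp
  then have "psd (1 * e) (id_tensor 1 d e \<Gamma> X)" using assms(1) unfolding completely_positive_def by blast
  moreover have "block d X 0 0 = X" using X by (intro eq_matI) (auto simp: block_def)
  then have "id_tensor 1 d e \<Gamma> X = \<Gamma> X" using c by (intro eq_matI) (auto simp: id_tensor_def)
  ultimately show ?thesis by simp
qed

lemma kraus_index:
  assumes A: "A \<in> carrier_mat n d" and X: "X \<in> carrier_mat d d" and "s < n" "t < n"
  shows "(A * X * mat_adjoint A) $$ (s, t) = bil d X (\<lambda>a. cnj (A $$ (s, a))) (\<lambda>b. cnj (A $$ (t, b)))"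
proof -
  have "(A * X * mat_adjoint A) $$ (s, t) = (\<Sum>b<d. (\<Sum>a<d. A $$ (s, a) * X $$ (a, b)) * cnj (A $$ (t, b)))"
    using assms by (subst mat_mult_index[of _ n d _ n])
      (auto simp: mat_mult_index[OF A X] intro!: sum.cong)
  also have "\<dots> = bil d X (\<lambda>a. cnj (A $$ (s, a))) (\<lambda>b. cnj (A $$ (t, b)))"
    unfolding bil_def by (subst sum.swap) (simp add: sum_distrib_right)
  finally show ?thesis .
qed

text \<open>
  The Kraus operators \<open>\<eta>\<^sub>l \<xi>\<^sub>l\<^sup>*\<close> of the Holevo form are linear combinations of the Kraus operators \<open>A\<^sub>c\<close> in \<open>A\<close>.
  Hence the complementary map \<open>\<Gamma> \<circ> \<Phi>\<close>, whose entries are the traces of \<open>A\<^sub>c X A\<^sub>d\<^sup>*\<close>, determines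
  \<open>(\<eta>\<^sub>k\<^sup>* \<eta>\<^sub>l) (\<xi>\<^sub>l\<^sup>* X \<xi>\<^sub>k)\<close>; but \<open>\<Gamma> \<circ> \<Phi>\<close> is itself of measure-and-prepare form with the same
  vectors \<open>\<xi>\<^sub>j\<close> and psd matrices \<open>\<Gamma> (\<eta>\<^sub>j \<eta>\<^sub>j\<^sup>*)\<close>.  For \<open>k = l\<close> only a single ray can occur in that form, and for
  \<open>k\<close>, \<open>l\<close> on different rays the Cauchy--Schwarz inequality leaves no ray at all.
\<close>

lemma orthogonal_classes_of_degradable:
  assumes hol: "holevo d1 d2 m \<xi> H \<Phi>" and deg: "degradable d1 d2 \<Phi>"
  shows "orthogonal_classes d1 m \<xi> H"
proof -
  have H: "H \<in> carrier_mat d2 m" and unit: "\<And>l. l < m \<Longrightarrow> (\<Sum>i<d1. cnj (\<xi> l i) * \<xi> l i) = 1"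
    and \<Phi>: "\<And>X. X \<in> carrier_mat d1 d1 \<Longrightarrow>
      \<Phi> X = H * mat_diag m (\<lambda>l. bil d1 X (\<xi> l) (\<xi> l)) * mat_adjoint H"
    using hol by (auto simp: holevo_def unit_vecs_def)
  obtain d3 \<Gamma> A where \<Gamma>: "completely_positive d2 d3 \<Gamma>" and A: "A \<in> carrier_mat (d2 * d3) d1"
    and \<Phi>A: "\<And>X. X \<in> carrier_mat d1 d1 \<Longrightarrow> \<Phi> X = id_tensor_tr d2 d3 (A * X * mat_adjoint A)"
    and \<Psi>A: "\<And>X. X \<in> carrier_mat d1 d1 \<Longrightarrow> \<Gamma> (\<Phi> X) = tr_tensor_id d2 d3 (A * X * mat_adjoint A)"
    using deg unfolding degradable_def complementary_def comp_def by metis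
  have AXA: "(A * X * mat_adjoint A) $$ (i * d3 + c, j * d3 + d)
      = bil d1 X (\<lambda>a. cnj (A $$ (i * d3 + c, a))) (\<lambda>b. cnj (A $$ (j * d3 + d, b)))"
    if X: "X \<in> carrier_mat d1 d1" and "i < d2" "j < d2" "c < d3" "d < d3" for X i j c d
    using that by (intro kraus_index[OF A X]) (auto simp: block_index)
  \<comment> \<open>The two Kraus families of \<open>\<Phi>\<close>, one operator per column.\<close>
  define KA where "KA = mat (d2 * d1) d3 (\<lambda>(s, c). A $$ ((s div d1) * d3 + c, s mod d1))"
  define KB where "KB = mat (d2 * d1) m (\<lambda>(s, l). H $$ (s div d1, l) * cnj (\<xi> l (s mod d1)))"
  have KA: "KA \<in> carrier_mat (d2 * d1) d3" and KB: "KB \<in> carrier_mat (d2 * d1) m"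
    by (auto simp: KA_def KB_def)
  have "KA * mat_adjoint KA = KB * mat_adjoint KB"
  proof (rule eq_matI)
    fix s t assume "s < dim_row (KB * mat_adjoint KB)" "t < dim_col (KB * mat_adjoint KB)"
    then have st: "s < d2 * d1" "t < d2 * d1" using KB by auto
    then have dm: "s div d1 < d2" "t div d1 < d2" "s mod d1 < d1" "t mod d1 < d1"
      by (auto simp: less_mult_imp_div_less intro!: mod_less_divisor gr0I)
    let ?X = "elem_mat d1 (s mod d1, t mod d1)"
    have X: "?X \<in> carrier_mat d1 d1" by (simp add: elem_mat_def)
    have "(KA * mat_adjoint KA) $$ (s, t) = (\<Sum>c<d3. KA $$ (s, c) * cnj (KA $$ (t, c)))"
      using KA st by (subst mat_mult_index[of _ "d2 * d1" d3 _ "d2 * d1"]) auto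
    also have "\<dots> = (\<Sum>c<d3. (A * ?X * mat_adjoint A) $$ ((s div d1) * d3 + c, (t div d1) * d3 + c))"
      using st dm X by (intro sum.cong refl) (simp add: KA_def AXA bil_elem_mat)
    also have "\<dots> = \<Phi> ?X $$ (s div d1, t div d1)"
      unfolding \<Phi>A[OF X] id_tensor_tr_def using dm by simp
    also have "\<dots> = (\<Sum>l<m. KB $$ (s, l) * cnj (KB $$ (t, l)))"
      unfolding \<Phi>[OF X] sandwich_diag_index[OF H H dm(1,2)] using st dm
      by (intro sum.cong refl) (simp add: KB_def bil_elem_mat mult_ac)
    also have "\<dots> = (KB * mat_adjoint KB) $$ (s, t)"
      using KB st by (subst mat_mult_index[of _ "d2 * d1" m _ "d2 * d1"]) auto
    finally show "(KA * mat_adjoint KA) $$ (s, t) = (KB * mat_adjoint KB) $$ (s, t)" .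
  qed (use KA KB in auto)
  then obtain W where W: "W \<in> carrier_mat d3 m" and KW: "KB = KA * W"
    using equal_gram_factor[OF KA KB] by blast
  have BW: "H $$ (i, l) * cnj (\<xi> l a) = (\<Sum>c<d3. A $$ (i * d3 + c, a) * W $$ (c, l))"
    if "i < d2" "a < d1" "l < m" for i a l
  proof -
    have "KB $$ (i * d1 + a, l) = (\<Sum>c<d3. KA $$ (i * d1 + a, c) * W $$ (c, l))"
      unfolding KW using that by (intro mat_mult_index[OF KA W]) (auto simp: block_index)
    then show ?thesis using that by (simp add: KA_def KB_def block_index)
  qed
  define E where "E j = mat d2 d2 (\<lambda>(a, b). H $$ (a, j) * cnj (H $$ (b, j)))" for j
  define w where "w l c = cnj (W $$ (c, l))" for l c
  define \<beta> where "\<beta> j l k = bil d3 (\<Gamma> (E j)) (w l) (w k)" for j l k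
  have \<Gamma>E: "psd d3 (\<Gamma> (E j))" for j
  proof -
    have "bil d2 (E j) v v = (\<Sum>i<d2. cnj (v i) * H $$ (i, j)) * cnj (\<Sum>i<d2. cnj (v i) * H $$ (i, j))" for v
      unfolding bil_def cnj_sum sum_product by (intro sum.cong refl) (auto simp: E_def)
    then have "0 \<le> bil d2 (E j) v v" for v by (simp only: complex_mult_cnj_nonneg)
    then have "psd d2 (E j)" by (simp add: psd_iff_bil E_def)
    then show ?thesis by (rule completely_positive_psd[OF \<Gamma>])
  qed
  \<comment> \<open>Both descriptions of the complementary map, paired with the columns \<open>l\<close> and \<open>k\<close> of \<open>W\<close>.\<close>
  have key: "(mat_adjoint H * H) $$ (k, l) * bil d1 X (\<xi> l) (\<xi> k) = (\<Sum>j<m. bil d1 X (\<xi> j) (\<xi> j) * \<beta> j l k)"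
    if X: "X \<in> carrier_mat d1 d1" and kl: "k < m" "l < m" for X k l
  proof -
    have \<Psi>i: "(\<Sum>i<d2. \<Sum>a<d1. \<Sum>b<d1. A $$ (i * d3 + c, a) * X $$ (a, b) * cnj (A $$ (i * d3 + d, b)))
        = (\<Sum>j<m. bil d1 X (\<xi> j) (\<xi> j) * \<Gamma> (E j) $$ (c, d))" if "c < d3" "d < d3" for c d
    proof -
      have "(\<Sum>i<d2. \<Sum>a<d1. \<Sum>b<d1. A $$ (i * d3 + c, a) * X $$ (a, b) * cnj (A $$ (i * d3 + d, b)))
         = \<Gamma> (\<Phi> X) $$ (c, d)"
        unfolding \<Psi>A[OF X] tr_tensor_id_def using that by (simp add: AXA[OF X] bil_def)
      also have "\<dots> = (\<Sum>j<m. bil d1 X (\<xi> j) (\<xi> j) * \<Gamma> (E j) $$ (c, d))"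
        unfolding \<Phi>[OF X] E_def using \<Gamma> H that
        by (intro linear_map_sandwich_diag) (auto simp: completely_positive_def)
      finally show ?thesis .
    qed
    have "(mat_adjoint H * H) $$ (k, l) * bil d1 X (\<xi> l) (\<xi> k)
        = (\<Sum>i<d2. \<Sum>a<d1. \<Sum>b<d1. (H $$ (i, l) * cnj (\<xi> l a)) * X $$ (a, b) * cnj (H $$ (i, k) * cnj (\<xi> k b)))"
      unfolding gram_entry[OF H kl] bil_def sum_distrib_right unfolding sum_distrib_left
      by (intro sum.cong refl) (simp add: mult_ac)
    also have "\<dots> = (\<Sum>i<d2. \<Sum>a<d1. \<Sum>b<d1. \<Sum>c<d3. \<Sum>d<d3. (W $$ (c, l) * cnj (W $$ (d, k))) *
        (A $$ (i * d3 + c, a) * X $$ (a, b) * cnj (A $$ (i * d3 + d, b))))"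
    proof (intro sum.cong refl)
      fix i a b assume "i \<in> {..<d2}" "a \<in> {..<d1}" "b \<in> {..<d1}"
      then have iab: "i < d2" "a < d1" "b < d1" by auto
      have "(H $$ (i, l) * cnj (\<xi> l a)) * X $$ (a, b) * cnj (H $$ (i, k) * cnj (\<xi> k b))
        = (H $$ (i, l) * cnj (\<xi> l a)) * cnj (H $$ (i, k) * cnj (\<xi> k b)) * X $$ (a, b)"
        by (simp add: mult_ac)
      also have "\<dots> = (\<Sum>c<d3. \<Sum>d<d3. (W $$ (c, l) * cnj (W $$ (d, k))) *
        (A $$ (i * d3 + c, a) * X $$ (a, b) * cnj (A $$ (i * d3 + d, b))))"
        unfolding BW[OF iab(1,2) kl(2)] BW[OF iab(1,3) kl(1)] cnj_sum unfolding sum_product unfolding sum_distrib_right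
        by (intro sum.cong refl) (simp add: mult_ac)
      finally show "(H $$ (i, l) * cnj (\<xi> l a)) * X $$ (a, b) * cnj (H $$ (i, k) * cnj (\<xi> k b))
        = (\<Sum>c<d3. \<Sum>d<d3. (W $$ (c, l) * cnj (W $$ (d, k))) *
        (A $$ (i * d3 + c, a) * X $$ (a, b) * cnj (A $$ (i * d3 + d, b))))" .
    qed
    also have "\<dots> = (\<Sum>c<d3. \<Sum>d<d3. (W $$ (c, l) * cnj (W $$ (d, k))) *
        (\<Sum>i<d2. \<Sum>a<d1. \<Sum>b<d1. A $$ (i * d3 + c, a) * X $$ (a, b) * cnj (A $$ (i * d3 + d, b))))"
      unfolding sum_distrib_left by (rule sum_swap_3_2)
    also have "\<dots> = (\<Sum>c<d3. \<Sum>d<d3. \<Sum>j<m. (W $$ (c, l) * cnj (W $$ (d, k))) *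
        (bil d1 X (\<xi> j) (\<xi> j) * \<Gamma> (E j) $$ (c, d)))"
      by (intro sum.cong refl) (simp add: \<Psi>i sum_distrib_left)
    also have "\<dots> = (\<Sum>j<m. \<Sum>c<d3. \<Sum>d<d3. (W $$ (c, l) * cnj (W $$ (d, k))) *
        (bil d1 X (\<xi> j) (\<xi> j) * \<Gamma> (E j) $$ (c, d)))"
      by (simp only: sum.swap[of _ "{..<m}"])
    also have "\<dots> = (\<Sum>j<m. bil d1 X (\<xi> j) (\<xi> j) * \<beta> j l k)"
      unfolding \<beta>_def bil_def[of d3] w_def sum_distrib_left by (intro sum.cong refl) (simp add: mult_ac)
    finally show ?thesis .
  qed
  have diag: "same_ray d1 (\<xi> j) (\<xi> l)" if jl: "j < m" "l < m" and nz: "\<beta> j l l \<noteq> 0" for j l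
  proof -
    let ?X = "ray_complement d1 (\<xi> l)"
    have "(\<Sum>j<m. bil d1 ?X (\<xi> j) (\<xi> j) * \<beta> j l l) = 0"
      using key[of ?X l l] jl bil_ray_complement_self[OF unit] by simp
    moreover have "0 \<le> bil d1 ?X (\<xi> j) (\<xi> j) * \<beta> j l l" for j
      unfolding \<beta>_def
      by (intro mult_nonneg_nonneg psd_bil_nonneg[OF \<Gamma>E] psd_bil_nonneg[OF psd_ray_complement] unit jl)
    ultimately have "bil d1 ?X (\<xi> j) (\<xi> j) * \<beta> j l l = 0"
      using jl(1) by (simp add: sum_nonneg_eq_0_iff)
    then show ?thesis using nz bil_ray_complement_eq_0[OF unit unit] jl by simp
  qed
  have "same_ray d1 (\<xi> k) (\<xi> l)" if kl: "k < m" "l < m" and nz: "(mat_adjoint H * H) $$ (k, l) \<noteq> 0" for k l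
  proof (rule ccontr)
    assume ns: "\<not> same_ray d1 (\<xi> k) (\<xi> l)"
    have "\<beta> j l k = 0" if j: "j < m" for j
    proof (cases "\<beta> j l l = 0")
      case True
      then show ?thesis unfolding \<beta>_def by (rule psd_bil_eq_0[OF \<Gamma>E])
    next
      case False
      then have "\<beta> j k k = 0" using diag j kl ns by (meson same_ray_sym same_ray_trans)
      then have "bil d3 (\<Gamma> (E j)) (w k) (w l) = 0" unfolding \<beta>_def by (rule psd_bil_eq_0[OF \<Gamma>E])
      then show ?thesis
        using bil_adjoint[OF psd_carrier[OF \<Gamma>E], of j "w l" "w k"] psd_hermitian[OF \<Gamma>E, of j]
        by (simp add: \<beta>_def)
    qed
    then have 0: "bil d1 X (\<xi> l) (\<xi> k) = 0" if "X \<in> carrier_mat d1 d1" for X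
      using key[OF that kl] nz by simp
    \<comment> \<open>Two unit vectors cannot have a vanishing outer product.\<close>
    have "cnj (\<xi> l a) * \<xi> k b = 0" if "a < d1" "b < d1" for a b
      using 0[of "elem_mat d1 (a, b)"] that by (simp add: bil_elem_mat)
    moreover obtain a where "a < d1" "\<xi> l a \<noteq> 0"
      using unit[OF kl(2)] by (metis (no_types, lifting) lessThan_iff mult_zero_right sum.neutral zero_neq_one)
    moreover obtain b where "b < d1" "\<xi> k b \<noteq> 0"
      using unit[OF kl(1)] by (metis (no_types, lifting) lessThan_iff mult_zero_right sum.neutral zero_neq_one)
    ultimately show False by (metis complex_cnj_zero_iff mult_eq_0_iff)
  qed
  then show ?thesis by (simp add: orthogonal_classes_def)
qed

lemma mat_diag_cong:
  assumes "\<And>l. l < m \<Longrightarrow> f l = g l"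
  shows "mat_diag m f = mat_diag m g"
  by (rule eq_matI) (use assms in \<open>auto simp: mat_diag_def\<close>)

lemma holevo_unital:
  assumes hol: "holevo d1 d2 m \<xi> H \<Phi>"
  shows "\<Phi> (1\<^sub>m d1) = H * mat_adjoint H"
proof -
  have "\<Phi> (1\<^sub>m d1) = H * mat_diag m (\<lambda>l. bil d1 (1\<^sub>m d1) (\<xi> l) (\<xi> l)) * mat_adjoint H"
    using hol by (simp add: holevo_def)
  also have "mat_diag m (\<lambda>l. bil d1 (1\<^sub>m d1) (\<xi> l) (\<xi> l)) = mat_diag m (\<lambda>l. 1)"
    using hol by (intro mat_diag_cong) (auto simp: bil_one holevo_def unit_vecs_def)
  finally show ?thesis using hol by (auto simp: holevo_def)
qed

lemma same_ray_inner:
  assumes "same_ray d x y" and x: "(\<Sum>i<d. cnj (x i) * x i) = 1"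
  shows "(\<Sum>i<d. cnj (x i) * y i) * (\<Sum>j<d. cnj (y j) * z j) = (\<Sum>i<d. cnj (x i) * z i)"
proof -
  have "(\<Sum>i<d. cnj (x i) * y i) * (\<Sum>j<d. cnj (y j) * z j)
      = (\<Sum>i<d. \<Sum>j<d. cnj (x i) * (y i * cnj (y j)) * z j)"
    unfolding sum_product by (intro sum.cong refl) (simp add: mult_ac)
  also have "\<dots> = (\<Sum>i<d. \<Sum>j<d. cnj (x i) * (x i * cnj (x j)) * z j)"
    using assms(1) by (intro sum.cong refl) (simp add: same_ray_def)
  also have "\<dots> = (\<Sum>i<d. cnj (x i) * x i) * (\<Sum>j<d. cnj (x j) * z j)"
    unfolding sum_product by (intro sum.cong refl) (simp add: mult_ac)
  finally show ?thesis using x by simp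
qed

lemma same_ray_bil_right:
  assumes "same_ray d x y" and y: "(\<Sum>i<d. cnj (y i) * y i) = 1"
  shows "bil d X x x * (\<Sum>i<d. cnj (x i) * y i) = bil d X x y"
proof -
  have "bil d X x x * (\<Sum>i<d. cnj (x i) * y i)
      = (\<Sum>i<d. \<Sum>j<d. \<Sum>a<d. cnj (x i) * X $$ (i, j) * (x j * cnj (x a)) * y a)"
    unfolding bil_def sum_distrib_right unfolding sum_distrib_left by (intro sum.cong refl) (simp add: mult_ac)
  also have "\<dots> = (\<Sum>i<d. \<Sum>j<d. \<Sum>a<d. cnj (x i) * X $$ (i, j) * (y j * cnj (y a)) * y a)"
    using assms(1) by (intro sum.cong refl) (simp add: same_ray_def)
  also have "\<dots> = bil d X x y * (\<Sum>i<d. cnj (y i) * y i)"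
    unfolding bil_def sum_distrib_right unfolding sum_distrib_left by (intro sum.cong refl) (simp add: mult_ac)
  finally show ?thesis using y by simp
qed

lemma bil_scale:
  "bil d X (\<lambda>a. x * u a) (\<lambda>b. y * v b) = cnj x * y * bil d X u v"
  unfolding bil_def sum_distrib_left by (intro sum.cong refl) (simp add: mult_ac)

lemma completely_positive_comp:
  assumes \<Phi>: "completely_positive d1 d2 \<Phi>" and \<Gamma>: "completely_positive d2 d3 \<Gamma>"
  shows "completely_positive d1 d3 (\<Gamma> \<circ> \<Phi>)"
proof -
  have lin: "linear_map d1 d2 \<Phi>" "linear_map d2 d3 \<Gamma>" using \<Phi> \<Gamma> by (auto simp: completely_positive_def)
  have "id_tensor k d1 d3 (\<Gamma> \<circ> \<Phi>) \<rho> = id_tensor k d2 d3 \<Gamma> (id_tensor k d1 d2 \<Phi> \<rho>)" for k \<rho>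
  proof (rule eq_matI)
    have blk: "block d2 (id_tensor k d1 d2 \<Phi> \<rho>) a b = \<Phi> (block d1 \<rho> a b)" if "a < k" "b < k" for a b
    proof -
      have "\<Phi> (block d1 \<rho> a b) \<in> carrier_mat d2 d2" using lin by (auto simp: linear_map_def block_def)
      then show ?thesis
        using that by (intro eq_matI) (auto simp: block_def id_tensor_def block_index)
    qed
    fix i j assume "i < dim_row (id_tensor k d2 d3 \<Gamma> (id_tensor k d1 d2 \<Phi> \<rho>))"
      "j < dim_col (id_tensor k d2 d3 \<Gamma> (id_tensor k d1 d2 \<Phi> \<rho>))"
    then have ij: "i < k * d3" "j < k * d3" by (auto simp: id_tensor_def)
    then have "i div d3 < k" "j div d3 < k" by (auto simp: less_mult_imp_div_less)
    then show "id_tensor k d1 d3 (\<Gamma> \<circ> \<Phi>) \<rho> $$ (i, j)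
        = id_tensor k d2 d3 \<Gamma> (id_tensor k d1 d2 \<Phi> \<rho>) $$ (i, j)"
      using ij blk by (simp add: id_tensor_def[of k d1 d3] id_tensor_def[of k d2 d3])
  qed (auto simp: id_tensor_def)
  moreover have "linear_map d1 d3 (\<Gamma> \<circ> \<Phi>)" using lin by (auto simp: linear_map_def)
  ultimately show ?thesis using \<Phi> \<Gamma> by (auto simp: completely_positive_def)
qed

lemma gram_projection:
  fixes H :: cmat
  assumes H: "H \<in> carrier_mat d m" and HH: "H * mat_adjoint H = 1\<^sub>m d" and kl: "k < m" "l < m"
  shows "(\<Sum>s<m. (mat_adjoint H * H) $$ (k, s) * (mat_adjoint H * H) $$ (s, l)) = (mat_adjoint H * H) $$ (k, l)"
proof -
  have G: "mat_adjoint H * H \<in> carrier_mat m m" using H by (intro carrier_matI) auto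
  have "(mat_adjoint H * H) * (mat_adjoint H * H) = mat_adjoint H * ((H * mat_adjoint H) * H)"
    using carrier_matD[OF H] by (simp add: mult_mat_assoc)
  also have "\<dots> = mat_adjoint H * H" unfolding HH using H by simp
  finally show ?thesis using mat_mult_index[OF G G kl] by simp
qed

lemma gram_hermitian:
  fixes H :: cmat
  assumes "H \<in> carrier_mat d m" "k < m" "l < m"
  shows "cnj ((mat_adjoint H * H) $$ (k, l)) = (mat_adjoint H * H) $$ (l, k)"
  using assms by (simp add: gram_entry cnj_sum mult.commute)

text \<open>
  Under the orthogonality condition \<open>\<eta>\<^sub>l\<close> is an eigenvector of \<open>\<Phi> X\<close> with eigenvalue \<open>\<xi>\<^sub>l\<^sup>* X \<xi>\<^sub>l\<close>, since
  only columns on the ray of \<open>\<xi>\<^sub>l\<close> meet \<open>\<eta>\<^sub>l\<close>, and they carry the same factor \<open>\<xi>\<^sub>l\<^sup>* X \<xi>\<^sub>l\<close>.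
\<close>

lemma bil_holevo_col:
  assumes hol: "holevo d1 d2 m \<xi> H \<Phi>" and HH: "H * mat_adjoint H = 1\<^sub>m d2"
    and orth: "orthogonal_classes d1 m \<xi> H" and X: "X \<in> carrier_mat d1 d1" and l: "l < m"
  shows "bil d2 (\<Phi> X) (\<lambda>i. H $$ (i, l)) (\<lambda>i. H $$ (i, l))
    = bil d1 X (\<xi> l) (\<xi> l) * (mat_adjoint H * H) $$ (l, l)"
proof -
  let ?G = "mat_adjoint H * H"
  have H: "H \<in> carrier_mat d2 m" using hol by (simp add: holevo_def)
  have \<Phi>: "\<Phi> X = H * mat_diag m (\<lambda>l. bil d1 X (\<xi> l) (\<xi> l)) * mat_adjoint H"
    using hol X by (simp add: holevo_def)
  have "bil d2 (\<Phi> X) (\<lambda>i. H $$ (i, l)) (\<lambda>i. H $$ (i, l))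
      = (\<Sum>k<m. bil d1 X (\<xi> k) (\<xi> k) * ?G $$ (l, k) * cnj (?G $$ (l, k)))"
    unfolding \<Phi> bil_sandwich_diag[OF H] using H l by (intro sum.cong refl) (simp add: gram_entry)
  also have "\<dots> = (\<Sum>k<m. bil d1 X (\<xi> l) (\<xi> l) * (?G $$ (l, k) * ?G $$ (k, l)))"
  proof (intro sum.cong refl)
    fix k assume "k \<in> {..<m}"
    then have k: "k < m" by simp
    show "bil d1 X (\<xi> k) (\<xi> k) * ?G $$ (l, k) * cnj (?G $$ (l, k)) = bil d1 X (\<xi> l) (\<xi> l) * (?G $$ (l, k) * ?G $$ (k, l))"
    proof (cases "?G $$ (l, k) = 0")
      case False
      then have "same_ray d1 (\<xi> l) (\<xi> k)" using orth k l by (auto simp: orthogonal_classes_def)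
      then show ?thesis using gram_hermitian[OF H l k] by (simp add: same_ray_bil)
    qed simp
  qed
  also have "\<dots> = bil d1 X (\<xi> l) (\<xi> l) * ?G $$ (l, l)"
    unfolding sum_distrib_left[symmetric] gram_projection[OF H HH l l] ..
  finally show ?thesis .
qed

text \<open>
  Take the Stinespring operator \<open>A\<close> with blocks \<open>\<eta>\<^sub>l \<xi>\<^sub>l\<^sup>*\<close>.  Its complementary map has the entries
  \<open>(\<eta>\<^sub>k\<^sup>* \<eta>\<^sub>l) (\<xi>\<^sub>l\<^sup>* X \<xi>\<^sub>k)\<close>, which by orthogonality equal \<open>(\<xi>\<^sub>l\<^sup>* X \<xi>\<^sub>l) J\<^sub>l\<^sub>k\<close> for a projection \<open>J\<close> that commutes with the
  diagonal matrix of the numbers \<open>\<xi>\<^sub>l\<^sup>* X \<xi>\<^sub>l\<close>.  These numbers can be read off \<open>\<Phi> X\<close>, because \<open>\<eta>\<^sub>l\<close> is an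
  eigenvector of it; so \<open>\<Gamma>\<close> measures with the normalised \<open>\<eta>\<^sub>l\<close> and prepares the columns of \<open>J\<close>.
\<close>

lemma degradable_of_orthogonal_classes:
  assumes hol: "holevo d1 d2 m \<xi> H \<Phi>" and cp: "completely_positive d1 d2 \<Phi>"
    and HH: "H * mat_adjoint H = 1\<^sub>m d2" and orth: "orthogonal_classes d1 m \<xi> H"
  shows "degradable d1 d2 \<Phi>"
proof -
  have H: "H \<in> carrier_mat d2 m" and unit: "\<And>l. l < m \<Longrightarrow> (\<Sum>i<d1. cnj (\<xi> l i) * \<xi> l i) = 1"
    and \<Phi>: "\<And>X. X \<in> carrier_mat d1 d1 \<Longrightarrow>
      \<Phi> X = H * mat_diag m (\<lambda>l. bil d1 X (\<xi> l) (\<xi> l)) * mat_adjoint H"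
    using hol by (auto simp: holevo_def unit_vecs_def)
  define G where "G = mat_adjoint H * H"
  have ray: "same_ray d1 (\<xi> k) (\<xi> l)" if "k < m" "l < m" "G $$ (k, l) \<noteq> 0" for k l
    using orth that by (simp add: orthogonal_classes_def G_def)
  define ip where "ip l k = (\<Sum>i<d1. cnj (\<xi> l i) * \<xi> k i)" for l k
  have ipc: "cnj (ip l k) = ip k l" for l k by (simp add: ip_def cnj_sum mult.commute)
  define J where "J = mat m m (\<lambda>(l, k). ip l k * G $$ (k, l))"
  have J: "J \<in> carrier_mat m m" by (simp add: J_def)
  define g where "g l = (\<Sum>i<d2. (cmod (H $$ (i, l)))\<^sup>2)" for l
  have Gll: "G $$ (l, l) = of_real (g l)" if "l < m" for l
    unfolding G_def gram_entry[OF H that that] g_def of_real_sum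
    by (intro sum.cong refl) (simp only: complex_norm_square mult.commute)
  define r where "r l = complex_of_real (sqrt (g l))" for l
  have g0: "0 \<le> g l" for l by (simp add: g_def sum_nonneg)
  have rr: "r l * r l = G $$ (l, l)" "cnj (r l) = r l" if "l < m" for l
    using g0[of l] Gll[OF that] by (auto simp: r_def simp flip: of_real_mult)
  \<comment> \<open>The normalised column; a zero column stays zero since \<open>inverse 0 = 0\<close>.\<close>
  define \<gamma> where "\<gamma> l i = inverse (r l) * H $$ (i, l)" for l i
  define \<Gamma> where "\<Gamma> Y = J * mat_diag m (\<lambda>l. bil d2 Y (\<gamma> l) (\<gamma> l)) * mat_adjoint J" for Y
  have \<Gamma>cp: "completely_positive d2 m \<Gamma>"
    using holevo_EB[OF J, of d2 \<Gamma> \<gamma>] by (simp add: \<Gamma>_def entanglement_breaking_def)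
  have fs: "bil d2 (\<Phi> X) (\<gamma> s) (\<gamma> s) * J $$ (l, s) = bil d1 X (\<xi> l) (\<xi> l) * J $$ (l, s)"
    if X: "X \<in> carrier_mat d1 d1" and ls: "l < m" "s < m" for X l s
  proof (cases "G $$ (s, l) = 0")
    case True
    then show ?thesis using ls by (simp add: J_def)
  next
    case False
    have "G $$ (s, s) \<noteq> 0"
    proof
      assume "G $$ (s, s) = 0"
      then have "g s = 0" using Gll[OF ls(2)] by simp
      then have "H $$ (i, s) = 0" if "i < d2" for i
        using that by (auto simp: g_def sum_nonneg_eq_0_iff)
      then have "G $$ (s, l) = 0" unfolding G_def gram_entry[OF H ls(2,1)] by simp
      then show False using False by simp
    qed
    moreover have "bil d2 (\<Phi> X) (\<gamma> s) (\<gamma> s)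
        = inverse (r s) * inverse (r s) * (bil d1 X (\<xi> s) (\<xi> s) * G $$ (s, s))"
      unfolding \<gamma>_def bil_scale bil_holevo_col[OF hol HH orth X ls(2)] G_def
      using rr(2)[OF ls(2)] by simp
    moreover have "inverse (r s) * inverse (r s) * (z * (r s * r s)) = z" if "r s * r s \<noteq> 0" for z
      using that by (simp add: field_simps)
    ultimately have "bil d2 (\<Phi> X) (\<gamma> s) (\<gamma> s) = bil d1 X (\<xi> s) (\<xi> s)"
      unfolding rr(1)[OF ls(2), symmetric] by metis
    then show ?thesis using same_ray_bil[OF ray[OF ls(2,1) False]] by simp
  qed
  have JJ: "J $$ (l, s) * cnj (J $$ (k, s)) = ip l k * (G $$ (k, s) * G $$ (s, l))"
    if "l < m" "k < m" "s < m" for l k s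
  proof (cases "G $$ (s, l) = 0")
    case True
    then show ?thesis using that by (simp add: J_def)
  next
    case False
    have "ip l s * ip s k = ip l k"
      unfolding ip_def using ray[OF that(3,1) False] unit[OF that(1)]
      by (intro same_ray_inner) (auto intro: same_ray_sym)
    moreover have "cnj (G $$ (s, k)) = G $$ (k, s)"
      unfolding G_def by (rule gram_hermitian[OF H that(3,2)])
    ultimately show ?thesis using that by (simp add: J_def ipc mult_ac)
  qed
  have \<Gamma>\<Phi>: "\<Gamma> (\<Phi> X) $$ (l, k) = G $$ (k, l) * bil d1 X (\<xi> l) (\<xi> k)"
    if X: "X \<in> carrier_mat d1 d1" and lk: "l < m" "k < m" for X l k
  proof -
    have "\<Gamma> (\<Phi> X) $$ (l, k) = (\<Sum>s<m. bil d2 (\<Phi> X) (\<gamma> s) (\<gamma> s) * J $$ (l, s) * cnj (J $$ (k, s)))"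
      unfolding \<Gamma>_def by (rule sandwich_diag_index[OF J J lk])
    also have "\<dots> = (\<Sum>s<m. bil d1 X (\<xi> l) (\<xi> l) * ip l k * (G $$ (k, s) * G $$ (s, l)))"
      using lk X by (intro sum.cong refl) (simp add: fs JJ mult.assoc)
    also have "\<dots> = bil d1 X (\<xi> l) (\<xi> l) * ip l k * G $$ (k, l)"
      unfolding sum_distrib_left[symmetric] G_def gram_projection[OF H HH lk(2,1)] ..
    also have "\<dots> = G $$ (k, l) * bil d1 X (\<xi> l) (\<xi> k)"
    proof (cases "G $$ (k, l) = 0")
      case False
      then show ?thesis
        using same_ray_bil_right[OF same_ray_sym[OF ray[OF lk(2,1) False]] unit[OF lk(2)], of X]
        by (simp add: ip_def)
    qed simp
    finally show ?thesis .
  qed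
  define A where "A = mat (d2 * m) d1 (\<lambda>(s, a). H $$ (s div m, s mod m) * cnj (\<xi> (s mod m) a))"
  have A: "A \<in> carrier_mat (d2 * m) d1" by (simp add: A_def)
  have AXA: "(A * X * mat_adjoint A) $$ (i * m + l, j * m + k)
      = H $$ (i, l) * cnj (H $$ (j, k)) * bil d1 X (\<xi> l) (\<xi> k)"
    if X: "X \<in> carrier_mat d1 d1" and "i < d2" "j < d2" "l < m" "k < m" for X i j l k
  proof -
    have "(A * X * mat_adjoint A) $$ (i * m + l, j * m + k)
        = bil d1 X (\<lambda>a. cnj (A $$ (i * m + l, a))) (\<lambda>b. cnj (A $$ (j * m + k, b)))"
      using that by (intro kraus_index[OF A X]) (auto simp: block_index)
    also have "\<dots> = bil d1 X (\<lambda>a. cnj (H $$ (i, l)) * \<xi> l a) (\<lambda>b. cnj (H $$ (j, k)) * \<xi> k b)"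
      using that by (intro bil_cong) (auto simp: A_def block_index)
    finally show ?thesis by (simp add: bil_scale)
  qed
  have 1: "\<Phi> X = id_tensor_tr d2 m (A * X * mat_adjoint A)" if X: "X \<in> carrier_mat d1 d1" for X
  proof (rule eq_matI)
    fix i j assume "i < dim_row (id_tensor_tr d2 m (A * X * mat_adjoint A))"
      "j < dim_col (id_tensor_tr d2 m (A * X * mat_adjoint A))"
    then have ij: "i < d2" "j < d2" by (auto simp: id_tensor_tr_def)
    have "\<Phi> X $$ (i, j) = (\<Sum>l<m. bil d1 X (\<xi> l) (\<xi> l) * H $$ (i, l) * cnj (H $$ (j, l)))"
      unfolding \<Phi>[OF X] by (rule sandwich_diag_index[OF H H ij])
    also have "\<dots> = id_tensor_tr d2 m (A * X * mat_adjoint A) $$ (i, j)"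
      using ij X by (auto simp: id_tensor_tr_def AXA mult_ac intro!: sum.cong)
    finally show "\<Phi> X $$ (i, j) = id_tensor_tr d2 m (A * X * mat_adjoint A) $$ (i, j)" .
  qed (use H in \<open>auto simp: \<Phi>[OF X] id_tensor_tr_def\<close>)
  have 2: "\<Gamma> (\<Phi> X) = tr_tensor_id d2 m (A * X * mat_adjoint A)" if X: "X \<in> carrier_mat d1 d1" for X
  proof (rule eq_matI)
    fix l k assume "l < dim_row (tr_tensor_id d2 m (A * X * mat_adjoint A))"
      "k < dim_col (tr_tensor_id d2 m (A * X * mat_adjoint A))"
    then have lk: "l < m" "k < m" by (auto simp: tr_tensor_id_def)
    show "\<Gamma> (\<Phi> X) $$ (l, k) = tr_tensor_id d2 m (A * X * mat_adjoint A) $$ (l, k)"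
      unfolding \<Gamma>\<Phi>[OF X lk] G_def gram_entry[OF H lk(2,1)] sum_distrib_right
      using lk X by (auto simp: tr_tensor_id_def AXA mult_ac intro!: sum.cong)
  qed (use J in \<open>auto simp: \<Gamma>_def tr_tensor_id_def\<close>)
  show ?thesis
    unfolding degradable_def complementary_def
    using \<Gamma>cp cp completely_positive_comp[OF cp \<Gamma>cp] A 1 2
    by (intro exI[of _ m] exI[of _ \<Gamma>] conjI bexI[of _ A] ballI) (simp_all only: comp_def)
qed

section \<open>From orthogonality to \<open>C\<^sup>*\<close>-extremality\<close>

lemma psd_congruence:
  assumes Y: "psd d Y" and T: "T \<in> carrier_mat d e"
  shows "psd e (mat_adjoint T * Y * T)"
proof -
  obtain B where B: "B \<in> carrier_mat d d" and YB: "Y = B * mat_adjoint B" using psd_gram[OF Y] by blast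
  have "mat_adjoint T * Y * T = (mat_adjoint T * B) * mat_adjoint (mat_adjoint T * B)"
    unfolding YB using carrier_matD[OF B] carrier_matD[OF T] by (simp add: mult_mat_assoc mat_adjoint_mult')
  moreover have "mat_adjoint T * B \<in> carrier_mat e d" using B T by (intro carrier_matI) auto
  ultimately show ?thesis using psd_mult_adjoint by metis
qed

lemma invertible_mat_inverse:
  assumes "T \<in> carrier_mat d d" "invertible_mat T"
  obtains R where "R \<in> carrier_mat d d" "T * R = 1\<^sub>m d" "R * T = 1\<^sub>m d"
proof -
  obtain R where R: "T * R = 1\<^sub>m (dim_row T)" "R * T = 1\<^sub>m (dim_row R)"
    using assms(2) by (auto simp: invertible_mat_def inverts_mat_def)
  have "dim_col R = d" using arg_cong[OF R(1), of dim_col] assms(1) by simp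
  moreover have "dim_row R = d" using arg_cong[OF R(2), of dim_col] assms(1) by simp
  ultimately show ?thesis using that[of R] R assms(1) by auto
qed

lemma holevo_adjoint:
  assumes hol: "holevo d1 d2 m \<xi> H \<Phi>" and X: "X \<in> carrier_mat d1 d1"
  shows "mat_adjoint (\<Phi> X) = \<Phi> (mat_adjoint X)"
proof -
  have H: "H \<in> carrier_mat d2 m" using hol by (simp add: holevo_def)
  have "mat_adjoint (\<Phi> X) = H * mat_diag m (\<lambda>l. cnj (bil d1 X (\<xi> l) (\<xi> l))) * mat_adjoint H"
    using hol X carrier_matD[OF H]
    by (simp add: holevo_def mat_adjoint_mult' mult_mat_assoc mat_adjoint_diag)
  also have "\<dots> = \<Phi> (mat_adjoint X)"
    using hol X by (simp add: holevo_def bil_adjoint)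
  finally show ?thesis .
qed

text \<open>
  Each summand \<open>\<Psi> = Ad\<^sub>T \<circ> \<Phi>\<^sub>t\<close> of a decomposition of \<open>\<Phi>\<close> lies below \<open>\<Phi>\<close>.  At \<open>\<eta>\<^sub>l\<close> and the projection
  orthogonal to \<open>\<xi>\<^sub>l\<close> the form of \<open>\<Phi>\<close> vanishes, hence so does that of \<open>\<Psi>\<close>: a vector \<open>\<theta>\<^sub>s\<close> prepared by \<open>\<Psi>\<close> meets
  \<open>\<eta>\<^sub>l\<close> only if it belongs to the ray of \<open>\<xi>\<^sub>l\<close>.  This gives \<open>\<Psi> X = S \<Phi> X = \<Phi> X S\<close> with \<open>S = T\<^sup>* T\<close>.  The positive
  root \<open>Q\<close> of \<open>S\<close> then commutes with every \<open>\<Phi> X\<close>, and the unitary factor \<open>U = Q T\<^sup>-\<^sup>1\<close> conjugates \<open>\<Phi>\<close> into \<open>\<Phi>\<^sub>t\<close>.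
\<close>

lemma Cstar_extreme_of_orthogonal_classes:
  assumes UEB: "\<Phi> \<in> UEB d1 d2" and hol: "holevo d1 d2 m \<xi> H \<Phi>"
    and orth: "orthogonal_classes d1 m \<xi> H"
  shows "Cstar_extreme_UEB d1 d2 \<Phi>"
proof -
  have H: "H \<in> carrier_mat d2 m" and unit: "\<And>l. l < m \<Longrightarrow> (\<Sum>i<d1. cnj (\<xi> l i) * \<xi> l i) = 1"
    and \<Phi>: "\<And>X. X \<in> carrier_mat d1 d1 \<Longrightarrow>
      \<Phi> X = H * mat_diag m (\<lambda>l. bil d1 X (\<xi> l) (\<xi> l)) * mat_adjoint H"
    using hol by (auto simp: holevo_def unit_vecs_def)
  note dH = carrier_matD[OF H]
  have HH: "H * mat_adjoint H = 1\<^sub>m d2" using holevo_unital[OF hol] UEB by (simp add: UEB_def)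
  have \<Phi>c: "\<Phi> X \<in> carrier_mat d2 d2" if "X \<in> carrier_mat d1 d1" for X
    using \<Phi>[OF that] dH by (intro carrier_matI) auto
  have step: "\<exists>U. unitary_mat d2 U \<and> (\<forall>X \<in> carrier_mat d1 d1. \<Phi>s t X = Ad U (\<Phi> X))"
    if T: "\<forall>l<n. T l \<in> carrier_mat d2 d2 \<and> invertible_mat (T l) \<and> \<Phi>s l \<in> UEB d1 d2"
      and dec: "\<forall>X \<in> carrier_mat d1 d1. \<Phi> X = mat_sum d2 n (\<lambda>l. Ad (T l) (\<Phi>s l X))"
      and t: "t < n"
    for n T \<Phi>s t
  proof -
    have Tc: "T t \<in> carrier_mat d2 d2" using T t by blast
    note dT = carrier_matD[OF Tc]
    obtain R where R: "R \<in> carrier_mat d2 d2" "T t * R = 1\<^sub>m d2" "R * T t = 1\<^sub>m d2"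
      using invertible_mat_inverse[OF Tc] T t by blast
    note dR = carrier_matD[OF R(1)]
    have EBt: "entanglement_breaking d1 d2 (\<Phi>s t)" and unital: "\<Phi>s t (1\<^sub>m d1) = 1\<^sub>m d2"
      using T t by (auto simp: UEB_def)
    obtain m' \<zeta> K where holt: "holevo d1 d2 m' \<zeta> K (\<Phi>s t)" using EB_holevo[OF EBt] by blast
    have K: "K \<in> carrier_mat d2 m'" and unit': "\<And>s. s < m' \<Longrightarrow> (\<Sum>i<d1. cnj (\<zeta> s i) * \<zeta> s i) = 1"
      and \<Phi>t: "\<And>X. X \<in> carrier_mat d1 d1 \<Longrightarrow>
        \<Phi>s t X = K * mat_diag m' (\<lambda>s. bil d1 X (\<zeta> s) (\<zeta> s)) * mat_adjoint K"
      using holt by (auto simp: holevo_def unit_vecs_def)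
    note dK = carrier_matD[OF K]
    have KK: "K * mat_adjoint K = 1\<^sub>m d2" using holevo_unital[OF holt] unital by simp
    define L where "L = mat_adjoint (T t) * K"
    have L: "L \<in> carrier_mat d2 m'" using dT dK by (intro carrier_matI) (auto simp: L_def)
    note dL = carrier_matD[OF L]
    define S where "S = mat_adjoint (T t) * T t"
    have S: "S \<in> carrier_mat d2 d2" using dT by (intro carrier_matI) (auto simp: S_def)
    have LL: "L * mat_adjoint L = S"
    proof -
      have "L * mat_adjoint L = mat_adjoint (T t) * ((K * mat_adjoint K) * T t)"
        using dT dK by (simp add: L_def mat_adjoint_mult' mult_mat_assoc)
      then show ?thesis unfolding KK using dT by (simp add: S_def)
    qed
    have AdL: "Ad (T t) (\<Phi>s t X) = L * mat_diag m' (\<lambda>s. bil d1 X (\<zeta> s) (\<zeta> s)) * mat_adjoint L"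
      if "X \<in> carrier_mat d1 d1" for X
      unfolding Ad_def \<Phi>t[OF that] L_def using dT dK by (simp add: mat_adjoint_mult' mult_mat_assoc)
    define Z where "Z = mat_adjoint L * H"
    have Z: "Z \<in> carrier_mat m' m" using dL dH by (intro carrier_matI) (auto simp: Z_def)
    have Zi: "Z $$ (s, l) = cnj (\<Sum>i<d2. cnj (H $$ (i, l)) * L $$ (i, s))" if "s < m'" "l < m" for s l
      unfolding Z_def using that L H
      by (subst mat_mult_index[of _ m' d2 _ m]) (auto simp: cnj_sum mult.commute)
    have ray: "same_ray d1 (\<zeta> s) (\<xi> l)" if s: "s < m'" and l: "l < m" and nz: "Z $$ (s, l) \<noteq> 0" for s l
    proof -
      let ?X = "ray_complement d1 (\<xi> l)" and ?h = "\<lambda>i. H $$ (i, l)"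
      have pX: "psd d1 ?X" by (rule psd_ray_complement[OF unit[OF l]])
      have pos: "psd d2 (Ad (T i) (\<Phi>s i ?X))" if "i < n" for i
      proof -
        have "T i \<in> carrier_mat d2 d2" "completely_positive d1 d2 (\<Phi>s i)"
          using T that unfolding UEB_def entanglement_breaking_def by blast+
        then show ?thesis unfolding Ad_def by (rule psd_congruence[OF completely_positive_psd[OF _ pX], rotated])
      qed
      have "(\<Sum>i<n. bil d2 (Ad (T i) (\<Phi>s i ?X)) ?h ?h) = bil d2 (\<Phi> ?X) ?h ?h"
        using dec by (simp add: bil_mat_sum)
      also have "\<dots> = 0"
        unfolding bil_holevo_col[OF hol HH orth ray_complement_carrier l]
        using bil_ray_complement_self[OF unit[OF l]] by simp
      finally have "bil d2 (Ad (T t) (\<Phi>s t ?X)) ?h ?h = 0"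
        using t pos psd_bil_nonneg by (subst (asm) sum_nonneg_eq_0_iff) auto
      then have "(\<Sum>s<m'. bil d1 ?X (\<zeta> s) (\<zeta> s) * (cnj (Z $$ (s, l)) * cnj (cnj (Z $$ (s, l))))) = 0"
        unfolding AdL[OF ray_complement_carrier] bil_sandwich_diag[OF L] using Zi l by (simp add: mult.assoc)
      moreover have "0 \<le> bil d1 ?X (\<zeta> s) (\<zeta> s) * (cnj (Z $$ (s, l)) * cnj (cnj (Z $$ (s, l))))" for s
        by (intro mult_nonneg_nonneg complex_mult_cnj_nonneg psd_bil_nonneg[OF pX])
      ultimately have "bil d1 ?X (\<zeta> s) (\<zeta> s) * (cnj (Z $$ (s, l)) * cnj (cnj (Z $$ (s, l)))) = 0"
        using s by (subst (asm) sum_nonneg_eq_0_iff) auto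
      then show ?thesis using nz by (intro bil_ray_complement_eq_0[OF unit[OF l] unit'[OF s]]) simp
    qed
    have S\<Phi>: "Ad (T t) (\<Phi>s t X) = S * \<Phi> X" if X: "X \<in> carrier_mat d1 d1" for X
    proof -
      let ?r = "mat_diag m' (\<lambda>s. bil d1 X (\<zeta> s) (\<zeta> s))" and ?q = "mat_diag m (\<lambda>l. bil d1 X (\<xi> l) (\<xi> l))"
      have rZ: "?r * Z = Z * ?q"
      proof (rule eq_matI)
        fix s l assume "s < dim_row (Z * ?q)" "l < dim_col (Z * ?q)"
        then have sl: "s < m'" "l < m" using Z by auto
        show "(?r * Z) $$ (s, l) = (Z * ?q) $$ (s, l)"
          unfolding mat_diag_mult_left[OF Z] mat_diag_mult_right[OF Z]
          using sl same_ray_bil[OF ray[OF sl]] by (cases "Z $$ (s, l) = 0") auto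
      qed (use Z in auto)
      have "Ad (T t) (\<Phi>s t X) = L * ?r * mat_adjoint L * (H * mat_adjoint H)"
        unfolding AdL[OF X] HH using dL by simp
      also have "\<dots> = L * (?r * Z) * mat_adjoint H"
        unfolding Z_def using dL dH by (simp add: mult_mat_assoc)
      also have "\<dots> = L * (Z * ?q) * mat_adjoint H" unfolding rZ ..
      also have "\<dots> = (L * mat_adjoint L) * (H * ?q * mat_adjoint H)"
        unfolding Z_def using dL dH by (simp add: mult_mat_assoc)
      finally show ?thesis unfolding LL \<Phi>[OF X] .
    qed
    have comm: "\<Phi> X * S = S * \<Phi> X" if X: "X \<in> carrier_mat d1 d1" for X
    proof -
      have Xa: "mat_adjoint X \<in> carrier_mat d1 d1" using X by simp
      have Sh: "mat_adjoint S = S" using dT by (simp add: S_def mat_adjoint_mult')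
      have \<Phi>tc: "\<Phi>s t Y \<in> carrier_mat d2 d2" if "Y \<in> carrier_mat d1 d1" for Y
        using \<Phi>t[OF that] dK by (intro carrier_matI) auto
      have "\<Phi> X * S = mat_adjoint (S * \<Phi> (mat_adjoint X))"
        using carrier_matD[OF S] carrier_matD[OF \<Phi>c[OF Xa]] Sh holevo_adjoint[OF hol Xa]
        by (simp add: mat_adjoint_mult')
      also have "\<dots> = mat_adjoint (mat_adjoint (T t) * (\<Phi>s t (mat_adjoint X) * T t))"
        unfolding S\<Phi>[OF Xa, symmetric] Ad_def
        using dT carrier_matD[OF \<Phi>tc[OF Xa]] by (simp add: mult_mat_assoc)
      also have "\<dots> = Ad (T t) (\<Phi>s t X)"
        unfolding Ad_def using dT carrier_matD[OF \<Phi>tc[OF Xa]] carrier_matD[OF \<Phi>tc[OF X]]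
        by (simp add: mat_adjoint_mult' holevo_adjoint[OF holt Xa] mult_mat_assoc)
      finally show ?thesis using S\<Phi>[OF X] by simp
    qed
    have Spsd: "psd d2 S"
      using psd_mult_adjoint[of "mat_adjoint (T t)" d2 d2] Tc by (simp add: S_def)
    have Sdef: "\<forall>i<d2. w i = 0" if w0: "bil d2 S w w = 0" for w
    proof (intro allI impI)
      fix i assume i: "i < d2"
      have Ta: "mat_adjoint (T t) \<in> carrier_mat d2 d2" using Tc by simp
      have S2: "S = mat_adjoint (T t) * mat_adjoint (mat_adjoint (T t))" by (simp add: S_def)
      have "(\<Sum>l<d2. (\<Sum>i<d2. cnj (w i) * mat_adjoint (T t) $$ (i, l))
          * cnj (\<Sum>i<d2. cnj (w i) * mat_adjoint (T t) $$ (i, l))) = 0"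
        using w0 unfolding S2 bil_gram[OF Ta] .
      then have c0: "(\<Sum>i<d2. cnj (w i) * mat_adjoint (T t) $$ (i, l)) = 0" if "l < d2" for l
        using complex_sum_mult_cnj_eq_0[of "{..<d2}" "\<lambda>l. \<Sum>i<d2. cnj (w i) * mat_adjoint (T t) $$ (i, l)" l] that
        by simp
      have TR: "mat_adjoint (T t) * mat_adjoint R = 1\<^sub>m d2"
        using arg_cong[OF R(3), of mat_adjoint] dT dR by (simp add: mat_adjoint_mult')
      have "cnj (w i) = (\<Sum>k<d2. cnj (w k) * (mat_adjoint (T t) * mat_adjoint R) $$ (k, i))"
        unfolding TR using i by (simp add: if_distrib[of "(*) _"] cong: if_cong)
      also have "\<dots> = (\<Sum>k<d2. \<Sum>l<d2. cnj (w k) * mat_adjoint (T t) $$ (k, l) * mat_adjoint R $$ (l, i))"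
        using i by (intro sum.cong refl)
          (simp add: mat_mult_index[OF Ta mat_adjoint_carrier[OF R(1)]] sum_distrib_left mult.assoc)
      also have "\<dots> = (\<Sum>l<d2. (\<Sum>k<d2. cnj (w k) * mat_adjoint (T t) $$ (k, l)) * mat_adjoint R $$ (l, i))"
        by (subst sum.swap) (simp add: sum_distrib_right)
      also have "\<dots> = 0" using c0 by (intro sum.neutral) auto
      finally show "w i = 0" by simp
    qed
    from posdef_sqrt[OF Spsd Sdef] obtain Q Q' where Q: "Q \<in> carrier_mat d2 d2" "Q' \<in> carrier_mat d2 d2"
      "mat_adjoint Q = Q" "Q * Q = S" "Q * Q' = 1\<^sub>m d2" "Q' * Q = 1\<^sub>m d2"
      and Qcomm: "\<And>X. X \<in> carrier_mat d2 d2 \<Longrightarrow> X * S = S * X \<Longrightarrow> X * Q = Q * X"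
      by metis
    note dQ = carrier_matD[OF Q(1)]
    define U where "U = Q * R"
    have U: "U \<in> carrier_mat d2 d2" using dQ dR by (intro carrier_matI) (auto simp: U_def)
    have RT: "mat_adjoint R * mat_adjoint (T t) = 1\<^sub>m d2"
      using arg_cong[OF R(2), of mat_adjoint] dT dR by (simp add: mat_adjoint_mult')
    have "mat_adjoint U * U = mat_adjoint R * (Q * Q) * R"
      using dQ dR Q(3) by (simp add: U_def mat_adjoint_mult' mult_mat_assoc)
    also have "\<dots> = (mat_adjoint R * mat_adjoint (T t)) * (T t * R)"
      unfolding Q(4) S_def using dT dR by (simp add: mult_mat_assoc)
    also have "\<dots> = 1\<^sub>m d2" unfolding RT R(2) by simp
    finally have UU: "mat_adjoint U * U = 1\<^sub>m d2" .
    have "unitary_mat d2 U"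
      unfolding unitary_mat_def
      using U UU mat_mult_left_right_inverse[OF mat_adjoint_carrier[OF U] U UU] by blast
    moreover have "\<Phi>s t X = Ad U (\<Phi> X)" if X: "X \<in> carrier_mat d1 d1" for X
    proof -
      note dP = carrier_matD[OF \<Phi>c[OF X]]
      have \<Phi>tc: "\<Phi>s t X \<in> carrier_mat d2 d2"
        using \<Phi>t[OF X] dK by (intro carrier_matI) auto
      note dPt = carrier_matD[OF \<Phi>tc]
      have "Ad U (\<Phi> X) = mat_adjoint R * (Q * (\<Phi> X * Q)) * R"
        using dQ dR dP Q(3) by (simp add: Ad_def U_def mat_adjoint_mult' mult_mat_assoc)
      also have "Q * (\<Phi> X * Q) = Q * Q * \<Phi> X"
        using Qcomm[OF \<Phi>c[OF X] comm[OF X]] dQ dP by (simp add: mult_mat_assoc)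
      also have "\<dots> = mat_adjoint (T t) * \<Phi>s t X * T t"
        unfolding Q(4) using S\<Phi>[OF X] by (simp add: Ad_def)
      also have "mat_adjoint R * (mat_adjoint (T t) * \<Phi>s t X * T t) * R
          = (mat_adjoint R * mat_adjoint (T t)) * \<Phi>s t X * (T t * R)"
        using dR dT dPt by (simp add: mult_mat_assoc)
      also have "\<dots> = \<Phi>s t X" unfolding RT R(2) using dPt by simp
      finally show ?thesis by simp
    qed
    ultimately show ?thesis by blast
  qed
  have "\<exists>U. \<forall>l<n. unitary_mat d2 (U l) \<and> (\<forall>X \<in> carrier_mat d1 d1. \<Phi>s l X = Ad (U l) (\<Phi> X))"
    if T: "\<forall>l<n. T l \<in> carrier_mat d2 d2 \<and> invertible_mat (T l) \<and> \<Phi>s l \<in> UEB d1 d2"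
      and dec: "\<forall>X \<in> carrier_mat d1 d1. \<Phi> X = mat_sum d2 n (\<lambda>l. Ad (T l) (\<Phi>s l X))"
    for n T \<Phi>s
  proof -
    have "\<forall>l\<in>{..<n}. \<exists>U. unitary_mat d2 U \<and> (\<forall>X \<in> carrier_mat d1 d1. \<Phi>s l X = Ad U (\<Phi> X))"
      using step[OF T dec] by simp
    from bchoice[OF this] show ?thesis by auto
  qed
  then show ?thesis unfolding Cstar_extreme_UEB_def using UEB by blast
qed

section \<open>From \<open>C\<^sup>*\<close>-extremality to orthogonality\<close>

definition trace_mult :: "nat \<Rightarrow> cmat \<Rightarrow> cmat \<Rightarrow> complex" where
  "trace_mult d A B = (\<Sum>i<d. \<Sum>j<d. A $$ (i, j) * B $$ (j, i))"

lemma trace_mult_commute: "trace_mult d A B = trace_mult d B A"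
  unfolding trace_mult_def by (subst sum.swap) (simp add: mult.commute)

lemma trace_mult_mult_shift:
  assumes "A \<in> carrier_mat d d" "B \<in> carrier_mat d d" "C \<in> carrier_mat d d"
  shows "trace_mult d (A * B) C = trace_mult d A (B * C)"
proof -
  have "trace_mult d (A * B) C = (\<Sum>i<d. \<Sum>j<d. \<Sum>s<d. A $$ (i, s) * B $$ (s, j) * C $$ (j, i))"
    unfolding trace_mult_def by (intro sum.cong refl) (simp add: mat_mult_index[OF assms(1,2)] sum_distrib_right)
  also have "\<dots> = (\<Sum>i<d. \<Sum>s<d. \<Sum>j<d. A $$ (i, s) * B $$ (s, j) * C $$ (j, i))"
    by (rule sum.cong[OF refl], rule sum.swap)
  also have "\<dots> = trace_mult d A (B * C)"
    unfolding trace_mult_def by (intro sum.cong refl) (simp add: mat_mult_index[OF assms(2,3)] sum_distrib_left mult.assoc)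
  finally show ?thesis .
qed

lemma trace_mult_self_adjoint_nonneg:
  assumes "A \<in> carrier_mat d d" "mat_adjoint A = A"
  shows "0 \<le> trace_mult d A A"
  unfolding trace_mult_def
proof (intro sum_nonneg)
  fix i j assume "i \<in> {..<d}" "j \<in> {..<d}"
  then have "A $$ (j, i) = cnj (A $$ (i, j))"
    using assms by (metis carrier_matD lessThan_iff mat_adjoint_index)
  then show "0 \<le> A $$ (i, j) * A $$ (j, i)" using complex_mult_cnj_nonneg by simp
qed

lemma trace_mult_diff:
  assumes "A \<in> carrier_mat d d" "B \<in> carrier_mat d d"
  shows "trace_mult d (A - B) (A - B) = trace_mult d A A - trace_mult d A B - trace_mult d B A + trace_mult d B B"
proof -
  have "trace_mult d (A - B) (A - B) = (\<Sum>i<d. \<Sum>j<d. A $$ (i, j) * A $$ (j, i) - A $$ (i, j) * B $$ (j, i)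
      - B $$ (i, j) * A $$ (j, i) + B $$ (i, j) * B $$ (j, i))"
    unfolding trace_mult_def by (intro sum.cong refl) (use assms in \<open>auto simp: algebra_simps\<close>)
  then show ?thesis by (simp add: trace_mult_def sum.distrib sum_subtractf)
qed

text \<open>
  \<open>N = R\<^sup>* R\<close> and \<open>M = R R\<^sup>*\<close> satisfy \<open>tr M\<^sup>2 = tr N\<^sup>2\<close>, and \<open>tr (N - M)\<^sup>2\<close> is nonnegative.
\<close>

lemma trace_mult_polar_le:
  fixes R :: cmat
  assumes R: "R \<in> carrier_mat d d"
  shows "trace_mult d (mat_adjoint R * R) (R * mat_adjoint R) \<le> trace_mult d (mat_adjoint R * R) (mat_adjoint R * R)"
proof -
  note dR = carrier_matD[OF R]
  define N where "N = mat_adjoint R * R"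
  define M where "M = R * mat_adjoint R"
  have Ra: "mat_adjoint R \<in> carrier_mat d d" using R by simp
  have N: "N \<in> carrier_mat d d" and M: "M \<in> carrier_mat d d" using R by (auto simp: N_def M_def)
  have "mat_adjoint (N - M) = N - M"
  proof (rule eq_matI)
    fix i j assume "i < dim_row (N - M)" "j < dim_col (N - M)"
    then have ij: "i < d" "j < d" using M by auto
    have "mat_adjoint N = N" "mat_adjoint M = M"
      using dR by (simp_all add: N_def M_def mat_adjoint_mult')
    then have "cnj (N $$ (j, i)) = N $$ (i, j)" "cnj (M $$ (j, i)) = M $$ (i, j)"
      using N M ij by (metis carrier_matD mat_adjoint_index)+
    then show "mat_adjoint (N - M) $$ (i, j) = (N - M) $$ (i, j)" using ij N M by simp
  qed (use N M in auto)
  then have "0 \<le> trace_mult d (N - M) (N - M)" using N M by (intro trace_mult_self_adjoint_nonneg) auto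
  also have "\<dots> = trace_mult d N N - trace_mult d N M - trace_mult d M N + trace_mult d M M" by (rule trace_mult_diff[OF N M])
  also have "trace_mult d M N = trace_mult d N M" by (rule trace_mult_commute)
  also have "trace_mult d M M = trace_mult d N N"
  proof -
    have "trace_mult d M M = trace_mult d R (mat_adjoint R * M)" unfolding M_def by (rule trace_mult_mult_shift[OF R Ra M[unfolded M_def]])
    also have "\<dots> = trace_mult d (mat_adjoint R * M) R" by (rule trace_mult_commute)
    also have "mat_adjoint R * M = N * mat_adjoint R" using dR by (simp add: M_def N_def mult_mat_assoc)
    also have "trace_mult d (N * mat_adjoint R) R = trace_mult d N (mat_adjoint R * R)" by (rule trace_mult_mult_shift[OF N Ra R])
    finally show ?thesis by (simp add: N_def)
  qed
  finally have "0 \<le> 2 * (trace_mult d N N - trace_mult d N M)" by simp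
  then have "0 \<le> trace_mult d N N - trace_mult d N M" by (simp add: less_eq_complex_def)
  then show ?thesis by (simp add: N_def M_def)
qed

lemma trace_mult_sandwich_diag:
  assumes H: "H \<in> carrier_mat d m"
  shows "trace_mult d (H * mat_diag m f * mat_adjoint H) B = (\<Sum>l<m. f l * bil d B (\<lambda>i. H $$ (i, l)) (\<lambda>i. H $$ (i, l)))"
proof -
  have "trace_mult d (H * mat_diag m f * mat_adjoint H) B
      = (\<Sum>i<d. \<Sum>j<d. \<Sum>l<m. f l * (cnj (H $$ (j, l)) * B $$ (j, i) * H $$ (i, l)))"
    unfolding trace_mult_def
    by (intro sum.cong refl) (use H in \<open>auto simp: sandwich_diag_index sum_distrib_left sum_distrib_right mult_ac\<close>)
  also have "\<dots> = (\<Sum>l<m. \<Sum>i<d. \<Sum>j<d. f l * (cnj (H $$ (j, l)) * B $$ (j, i) * H $$ (i, l)))"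
    by (simp only: sum.swap[of _ "{..<m}"])
  also have "\<dots> = (\<Sum>l<m. \<Sum>j<d. \<Sum>i<d. f l * (cnj (H $$ (j, l)) * B $$ (j, i) * H $$ (i, l)))"
    by (rule sum.cong[OF refl], rule sum.swap)
  also have "\<dots> = (\<Sum>l<m. f l * bil d B (\<lambda>i. H $$ (i, l)) (\<lambda>i. H $$ (i, l)))"
    unfolding bil_def sum_distrib_left ..
  finally show ?thesis .
qed

text \<open>
  The weights and \<open>R\<close> are absorbed in the prepared vectors, the columns of \<open>K = R\<^sup>* H diag (sqrt c)\<close>.
\<close>

lemma holevo_reweight_UEB:
  assumes H: "H \<in> carrier_mat d2 m"
    and R: "R \<in> carrier_mat d2 d2"
    and unital: "mat_adjoint R * (H * mat_diag m (\<lambda>l. complex_of_real (c l)) * mat_adjoint H) * R = 1\<^sub>m d2"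
    and c: "\<And>l. l < m \<Longrightarrow> 0 \<le> c l" and unit: "unit_vecs d1 m \<xi>"
  shows "(\<lambda>X. mat_adjoint R * (H * mat_diag m (\<lambda>l. complex_of_real (c l) * bil d1 X (\<xi> l) (\<xi> l)) * mat_adjoint H) * R)
     \<in> UEB d1 d2"
proof -
  note dH = carrier_matD[OF H] and dR = carrier_matD[OF R]
  let ?s = "\<lambda>l. complex_of_real (sqrt (c l))"
  define K where "K = mat_adjoint R * (H * mat_diag m ?s)"
  have K: "K \<in> carrier_mat d2 m" using dH dR by (intro carrier_matI) (auto simp: K_def)
  have split: "mat_diag m (\<lambda>l. complex_of_real (c l) * f l) = mat_diag m ?s * (mat_diag m f * mat_diag m ?s)" for f
    unfolding mat_diag_diag
  proof (rule mat_diag_cong)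
    fix l assume "l < m"
    then have "?s l * ?s l = complex_of_real (c l)" using c by (simp flip: of_real_mult)
    then show "complex_of_real (c l) * f l = ?s l * (f l * ?s l)" by (simp add: mult_ac)
  qed
  have K2: "mat_adjoint R * (H * mat_diag m (\<lambda>l. complex_of_real (c l) * f l) * mat_adjoint H) * R
      = K * mat_diag m f * mat_adjoint K" for f
    unfolding split using dH dR
    by (simp add: K_def mat_adjoint_mult' mult_mat_assoc mat_adjoint_diag del: mat_diag_diag)
  let ?\<Psi> = "\<lambda>X. mat_adjoint R * (H * mat_diag m (\<lambda>l. complex_of_real (c l) * bil d1 X (\<xi> l) (\<xi> l)) * mat_adjoint H) * R"
  have "entanglement_breaking d1 d2 ?\<Psi>" by (rule holevo_EB[OF K]) (rule K2)
  moreover have "?\<Psi> (1\<^sub>m d1) = 1\<^sub>m d2"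
  proof -
    have "mat_diag m (\<lambda>l. complex_of_real (c l) * bil d1 (1\<^sub>m d1) (\<xi> l) (\<xi> l)) = mat_diag m (\<lambda>l. complex_of_real (c l))"
      using unit by (intro mat_diag_cong) (simp add: bil_one unit_vecs_def)
    then show ?thesis using unital by simp
  qed
  ultimately show ?thesis by (simp add: UEB_def)
qed

text \<open>
  \<open>S\<close> is positive definite: a vector at which its form vanishes is orthogonal to all columns of \<open>H\<close>,
  and these span the space.
\<close>

lemma weighted_frame_sqrt:
  assumes H: "H \<in> carrier_mat d m" and HH: "H * mat_adjoint H = 1\<^sub>m d"
    and c: "\<And>l. l < m \<Longrightarrow> 0 < c l"
  defines "S \<equiv> H * mat_diag m (\<lambda>l. complex_of_real (c l)) * mat_adjoint H"
  shows "\<exists>Q R. Q \<in> carrier_mat d d \<and> R \<in> carrier_mat d d \<and> mat_adjoint Q = Q \<and> mat_adjoint R = R \<and>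
    Q * Q = S \<and> Q * R = 1\<^sub>m d \<and> R * Q = 1\<^sub>m d \<and> R * S * R = 1\<^sub>m d"
proof -
  have psd: "psd d S" unfolding S_def using c
    by (intro psd_sandwich_diag[OF H]) (simp add: less_eq_complex_def less_imp_le)
  have def: "\<forall>i<d. w i = 0" if w0: "bil d S w w = 0" for w
  proof (intro allI impI)
    fix i assume i: "i < d"
    define z where "z l = (\<Sum>i<d. cnj (w i) * H $$ (i, l))" for l
    have "(\<Sum>l<m. complex_of_real (c l) * (z l * cnj (z l))) = 0"
      using w0 unfolding S_def bil_sandwich_diag[OF H] z_def by (simp only: mult.assoc)
    moreover have "0 \<le> complex_of_real (c l) * (z l * cnj (z l))" if "l < m" for l
      using c[OF that] by (intro mult_nonneg_nonneg complex_mult_cnj_nonneg) (simp add: less_eq_complex_def)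
    ultimately have "complex_of_real (c l) * (z l * cnj (z l)) = 0" if "l < m" for l
      using that by (subst (asm) sum_nonneg_eq_0_iff) auto
    then have z0: "z l = 0" if "l < m" for l using c[OF that] that by (metis complex_cnj_zero_iff less_irrefl mult_eq_0_iff of_real_eq_0_iff)
    have "bil d (1\<^sub>m d) w w = (\<Sum>l<m. z l * cnj (z l))"
      unfolding HH[symmetric] bil_gram[OF H] z_def ..
    then have "(\<Sum>i<d. cnj (w i) * cnj (cnj (w i))) = 0" using z0 by (simp add: bil_one)
    then show "w i = 0" using complex_sum_mult_cnj_eq_0[of "{..<d}" "\<lambda>i. cnj (w i)" i] i by simp
  qed
  from posdef_sqrt[OF psd def] obtain Q R where Q: "Q \<in> carrier_mat d d" "R \<in> carrier_mat d d"
    "mat_adjoint Q = Q" "Q * Q = S" "Q * R = 1\<^sub>m d" "R * Q = 1\<^sub>m d" by metis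
  note dQ = carrier_matD[OF Q(1)] carrier_matD[OF Q(2)]
  have "mat_adjoint R * Q = 1\<^sub>m d"
    using arg_cong[OF Q(5), of mat_adjoint] dQ Q(3) by (simp add: mat_adjoint_mult')
  then have "mat_adjoint R * Q * R = R" using dQ by simp
  moreover have "mat_adjoint R * Q * R = mat_adjoint R * (Q * R)" using dQ by (simp add: mult_mat_assoc)
  ultimately have Ra: "mat_adjoint R = R" using Q(5) dQ by simp
  have "R * S * R = (R * Q) * (Q * R)" unfolding Q(4)[symmetric] using dQ by (simp add: mult_mat_assoc)
  also have "\<dots> = 1\<^sub>m d" unfolding Q(5,6) by simp
  finally show ?thesis using Q Ra by blast
qed

text \<open>
  Scaling the terms of the Holevo form by \<open>c\<close> and by \<open>1 - c\<close> splits \<open>\<Phi>\<close> into two entanglement breaking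
  maps whose values \<open>S 0\<close>, \<open>S 1\<close> at the identity are positive definite.  Normalising each by the inverse
  root of its value makes this a \<open>C\<^sup>*\<close>-convex combination, so extremality expresses the first
  part as \<open>R\<^sup>* \<Phi> X R\<close>.
\<close>

lemma Cstar_extreme_reweight:
  assumes ext: "Cstar_extreme_UEB d1 d2 \<Phi>" and hol: "holevo d1 d2 m \<xi> H \<Phi>"
    and c: "\<And>l. l < m \<Longrightarrow> 0 < c l \<and> c l < 1"
  shows "\<exists>R \<in> carrier_mat d2 d2. \<forall>X \<in> carrier_mat d1 d1.
    H * mat_diag m (\<lambda>l. complex_of_real (c l) * bil d1 X (\<xi> l) (\<xi> l)) * mat_adjoint H = mat_adjoint R * \<Phi> X * R"
proof -
  have H: "H \<in> carrier_mat d2 m" and unit: "unit_vecs d1 m \<xi>"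
    and \<Phi>: "\<And>X. X \<in> carrier_mat d1 d1 \<Longrightarrow>
      \<Phi> X = H * mat_diag m (\<lambda>l. bil d1 X (\<xi> l) (\<xi> l)) * mat_adjoint H"
    using hol by (auto simp: holevo_def)
  note dH = carrier_matD[OF H]
  have HH: "H * mat_adjoint H = 1\<^sub>m d2"
    using holevo_unital[OF hol] ext by (simp add: Cstar_extreme_UEB_def UEB_def)
  define b where "b k l = (if k = 0 then c l else 1 - c l)" for k :: nat and l
  have b: "0 < b k l" if "l < m" for k l using c[OF that] by (simp add: b_def)
  define W where "W k f = H * mat_diag m (\<lambda>l. complex_of_real (b k l) * f l) * mat_adjoint H" for k f
  have Wc: "W k f \<in> carrier_mat d2 d2" for k f using dH by (intro carrier_matI) (auto simp: W_def)
  define S where "S k = H * mat_diag m (\<lambda>l. complex_of_real (b k l)) * mat_adjoint H" for k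
  have "\<forall>k. \<exists>Q R. Q \<in> carrier_mat d2 d2 \<and> R \<in> carrier_mat d2 d2 \<and> mat_adjoint Q = Q \<and> mat_adjoint R = R \<and>
    Q * Q = S k \<and> Q * R = 1\<^sub>m d2 \<and> R * Q = 1\<^sub>m d2 \<and> R * S k * R = 1\<^sub>m d2"
    unfolding S_def by (intro allI weighted_frame_sqrt[OF H HH] b)
  then obtain Q R where Q: "\<And>k. Q k \<in> carrier_mat d2 d2" "\<And>k. R k \<in> carrier_mat d2 d2"
    "\<And>k. mat_adjoint (Q k) = Q k" "\<And>k. mat_adjoint (R k) = R k" "\<And>k. Q k * Q k = S k"
    "\<And>k. Q k * R k = 1\<^sub>m d2" "\<And>k. R k * Q k = 1\<^sub>m d2" "\<And>k. R k * S k * R k = 1\<^sub>m d2"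
    by metis
  define \<Psi> where "\<Psi> k X = mat_adjoint (R k) * W k (\<lambda>l. bil d1 X (\<xi> l) (\<xi> l)) * R k" for k X
  have \<Psi>UEB: "\<Psi> k \<in> UEB d1 d2" for k
    unfolding \<Psi>_def[abs_def] W_def using Q(8)[of k] b
    by (intro holevo_reweight_UEB[OF H Q(2) _ _ unit]) (auto simp: Q(4) S_def less_imp_le)
  have Ad\<Psi>: "Ad (Q k) (\<Psi> k X) = W k (\<lambda>l. bil d1 X (\<xi> l) (\<xi> l))" for k X
  proof -
    note d = carrier_matD[OF Q(1)[of k]] carrier_matD[OF Q(2)[of k]] carrier_matD[OF Wc[of k "\<lambda>l. bil d1 X (\<xi> l) (\<xi> l)"]]
    have "Ad (Q k) (\<Psi> k X) = (Q k * R k) * W k (\<lambda>l. bil d1 X (\<xi> l) (\<xi> l)) * (R k * Q k)"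
      unfolding Ad_def \<Psi>_def Q(3,4) using d by (simp add: mult_mat_assoc)
    then show ?thesis unfolding Q(6,7) using d by simp
  qed
  have inv: "invertible_mat (Q k)" for k
    using Q(1,2)[of k] Q(6,7)[of k] by (auto simp: invertible_mat_def inverts_mat_def intro!: exI[of _ "R k"])
  have sumW: "W 0 f $$ (i, j) + W 1 f $$ (i, j) = (\<Sum>l<m. f l * H $$ (i, l) * cnj (H $$ (j, l)))"
    if "i < d2" "j < d2" for f i j
    unfolding W_def sandwich_diag_index[OF H H that] sum.distrib[symmetric]
    by (intro sum.cong refl) (simp add: b_def algebra_simps)
  have "mat_sum d2 2 (\<lambda>k. mat_adjoint (Q k) * Q k) = 1\<^sub>m d2"
  proof (rule eq_matI)
    fix i j assume "i < dim_row (1\<^sub>m d2 :: cmat)" "j < dim_col (1\<^sub>m d2 :: cmat)"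
    then have ij: "i < d2" "j < d2" by auto
    have SW: "S k = W k (\<lambda>l. 1)" for k by (simp add: S_def W_def)
    have "mat_sum d2 2 (\<lambda>k. mat_adjoint (Q k) * Q k) $$ (i, j) = S 0 $$ (i, j) + S 1 $$ (i, j)"
      using ij by (simp add: mat_sum_def Q(3,5) numeral_2_eq_2)
    also have "\<dots> = (H * mat_diag m (\<lambda>l. 1) * mat_adjoint H) $$ (i, j)"
      unfolding SW sumW[OF ij] sandwich_diag_index[OF H H ij] ..
    also have "\<dots> = 1\<^sub>m d2 $$ (i, j)" using H by (simp add: HH)
    finally show "mat_sum d2 2 (\<lambda>k. mat_adjoint (Q k) * Q k) $$ (i, j) = 1\<^sub>m d2 $$ (i, j)" .
  qed (auto simp: mat_sum_def)
  moreover have "\<Phi> X = mat_sum d2 2 (\<lambda>k. Ad (Q k) (\<Psi> k X))" if X: "X \<in> carrier_mat d1 d1" for X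
  proof (rule eq_matI)
    fix i j assume "i < dim_row (mat_sum d2 2 (\<lambda>k. Ad (Q k) (\<Psi> k X)))" "j < dim_col (mat_sum d2 2 (\<lambda>k. Ad (Q k) (\<Psi> k X)))"
    then have ij: "i < d2" "j < d2" by (auto simp: mat_sum_def)
    show "\<Phi> X $$ (i, j) = mat_sum d2 2 (\<lambda>k. Ad (Q k) (\<Psi> k X)) $$ (i, j)"
      unfolding \<Phi>[OF X] sandwich_diag_index[OF H H ij] sumW[OF ij, symmetric]
      using ij by (simp add: mat_sum_def Ad\<Psi> numeral_2_eq_2)
  qed (use dH in \<open>auto simp: mat_sum_def \<Phi>[OF X]\<close>)
  ultimately have "\<exists>U. \<forall>k<2. unitary_mat d2 (U k) \<and> (\<forall>X \<in> carrier_mat d1 d1. \<Psi> k X = Ad (U k) (\<Phi> X))"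
    using ext Q(1) \<Psi>UEB inv unfolding Cstar_extreme_UEB_def by blast
  then obtain U where U: "unitary_mat d2 U" and \<Psi>U: "\<And>X. X \<in> carrier_mat d1 d1 \<Longrightarrow> \<Psi> 0 X = Ad U (\<Phi> X)"
    by (metis zero_less_numeral)
  have Uc: "U \<in> carrier_mat d2 d2" using U by (simp add: unitary_mat_def)
  show ?thesis
  proof (intro bexI[of _ "U * Q 0"] ballI)
    show "U * Q 0 \<in> carrier_mat d2 d2" using Uc Q(1)[of 0] by auto
    fix X :: cmat assume X: "X \<in> carrier_mat d1 d1"
    have \<Phi>c: "\<Phi> X \<in> carrier_mat d2 d2" using dH by (intro carrier_matI) (auto simp: \<Phi>[OF X])
    have "H * mat_diag m (\<lambda>l. complex_of_real (c l) * bil d1 X (\<xi> l) (\<xi> l)) * mat_adjoint H = Ad (Q 0) (\<Psi> 0 X)"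
      unfolding Ad\<Psi> by (simp add: W_def b_def)
    also have "\<dots> = mat_adjoint (U * Q 0) * \<Phi> X * (U * Q 0)"
      unfolding \<Psi>U[OF X] Ad_def using carrier_matD[OF Uc] carrier_matD[OF Q(1)[of 0]] carrier_matD[OF \<Phi>c]
      by (simp add: mat_adjoint_mult' mult_mat_assoc)
    finally show "H * mat_diag m (\<lambda>l. complex_of_real (c l) * bil d1 X (\<xi> l) (\<xi> l)) * mat_adjoint H
      = mat_adjoint (U * Q 0) * \<Phi> X * (U * Q 0)" .
  qed
qed

text \<open>
  Fix a ray, let \<open>C\<close> be the set of indices on it, and let \<open>F\<close> be the sum of the \<open>\<eta>\<^sub>k \<eta>\<^sub>k\<^sup>*\<close> with \<open>k\<close> in \<open>C\<close>.  Give
  the indices in \<open>C\<close> the weight \<open>1 - e\<close> and all others the weight \<open>e\<close>, and let \<open>R\<close> be as in the previous lemma, so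
  that \<open>N = R\<^sup>* R\<close> tends to \<open>F\<close> as \<open>e\<close> tends to zero.  Testing with the projection orthogonal to the ray
  shows that \<open>tr (R\<^sup>* (1 - F) R)\<close> is of order \<open>e\<close>, so \<open>tr (N R R\<^sup>*)\<close> is almost \<open>tr N\<close>.  Being at most \<open>tr N\<^sup>2\<close>, it yields
  \<open>tr F \<le> tr F\<^sup>2\<close> in the limit.  But \<open>tr F - tr F\<^sup>2\<close> is the sum of the \<open>|\<eta>\<^sub>j\<^sup>* \<eta>\<^sub>k|\<^sup>2\<close> with \<open>k\<close> in \<open>C\<close> and \<open>j\<close> outside \<open>C\<close>.
\<close>

lemma orthogonal_classes_of_Cstar_extreme:
  assumes ext: "Cstar_extreme_UEB d1 d2 \<Phi>" and hol: "holevo d1 d2 m \<xi> H \<Phi>"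
  shows "orthogonal_classes d1 m \<xi> H"
proof -
  have H: "H \<in> carrier_mat d2 m" and unit: "\<And>l. l < m \<Longrightarrow> (\<Sum>i<d1. cnj (\<xi> l i) * \<xi> l i) = 1"
    and \<Phi>: "\<And>X. X \<in> carrier_mat d1 d1 \<Longrightarrow>
      \<Phi> X = H * mat_diag m (\<lambda>l. bil d1 X (\<xi> l) (\<xi> l)) * mat_adjoint H"
    using hol by (auto simp: holevo_def unit_vecs_def)
  note dH = carrier_matD[OF H]
  have HH: "H * mat_adjoint H = 1\<^sub>m d2"
    using holevo_unital[OF hol] ext by (simp add: Cstar_extreme_UEB_def UEB_def)
  have ray: "same_ray d1 (\<xi> p) (\<xi> t)" if t: "t < m" and p: "p < m" and nz: "(mat_adjoint H * H) $$ (p, t) \<noteq> 0" for t p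
  proof (rule ccontr)
    assume ns: "\<not> same_ray d1 (\<xi> p) (\<xi> t)"
    define C where "C = {k \<in> {..<m}. same_ray d1 (\<xi> k) (\<xi> t)}"
    define D where "D = {..<m} - C"
    have fin: "finite C" "finite D" and CD: "C \<union> D = {..<m}" "C \<inter> D = {}" by (auto simp: C_def D_def)
    have split: "(\<Sum>k<m. f k) = (\<Sum>k\<in>C. f k) + (\<Sum>k\<in>D. f k)" for f :: "nat \<Rightarrow> real"
      using sum.union_disjoint[OF fin CD(2)] CD(1) by metis
    have tC: "t \<in> C" and pD: "p \<in> D" using t p ns by (auto simp: C_def D_def)
    define X0 where "X0 = ray_complement d1 (\<xi> t)"
    have X0: "X0 \<in> carrier_mat d1 d1" by (simp add: X0_def)
    have pX0: "psd d1 X0" unfolding X0_def by (rule psd_ray_complement[OF unit[OF t]])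
    define q where "q k = Re (bil d1 X0 (\<xi> k) (\<xi> k))" for k
    have q: "bil d1 X0 (\<xi> k) (\<xi> k) = of_real (q k)" and q0: "0 \<le> q k" for k
      using psd_bil_nonneg[OF pX0, of "\<xi> k"] by (auto simp: q_def less_eq_complex_def complex_eq_iff)
    have qC: "q k = 0" if "k \<in> C" for k
    proof -
      have "bil d1 X0 (\<xi> k) (\<xi> k) = bil d1 X0 (\<xi> t) (\<xi> t)"
        using that by (intro same_ray_bil) (simp add: C_def)
      then show ?thesis using bil_ray_complement_self[OF unit[OF t]] q[of k] by (simp add: X0_def)
    qed
    have qD: "0 < q k" if "k \<in> D" for k
    proof (rule ccontr)
      assume "\<not> 0 < q k"
      then have "bil d1 X0 (\<xi> k) (\<xi> k) = 0" using q0[of k] q[of k] by simp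
      then have "same_ray d1 (\<xi> k) (\<xi> t)" unfolding X0_def
        using that t by (intro bil_ray_complement_eq_0 unit) (auto simp: D_def)
      then show False using that by (auto simp: D_def C_def)
    qed
    define G where "G j k = (mat_adjoint H * H) $$ (j, k)" for j k
    define g where "g j k = (cmod (G j k))\<^sup>2" for j k
    define h where "h k = (\<Sum>j<m. g j k)" for k
    have gg: "of_real (g j k) = G j k * cnj (G j k)" for j k by (simp only: g_def complex_norm_square)
    \<comment> \<open>\<open>h k\<close> is the squared norm of \<open>\<eta>\<^sub>k\<close>, because the Gram matrix is a projection.\<close>
    have hG: "G k k = of_real (h k)" if k: "k < m" for k
    proof -
      have "of_real (h k) = (\<Sum>j<m. G j k * cnj (G j k))" by (simp add: h_def gg)
      also have "\<dots> = (\<Sum>j<m. G k j * G j k)"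
        using k by (intro sum.cong refl) (simp add: G_def gram_hermitian[OF H])
      also have "\<dots> = G k k" unfolding G_def by (rule gram_projection[OF H HH k k])
      finally show ?thesis by simp
    qed
    define M where "M = (\<Sum>k\<in>D. (\<Sum>l\<in>D. q l * h l) / q k)"
    \<comment> \<open>The left-hand side bounds \<open>tr (N R R\<^sup>*)\<close> from below, the right-hand side is \<open>tr N\<^sup>2\<close>.\<close>
    have main: "(1 - e) * ((1 - e) * (\<Sum>k\<in>C. h k) - e * M) \<le> (\<Sum>j<m. \<Sum>k<m. (if j \<in> C then 1 - e else e) * (if k \<in> C then 1 - e else e) * g j k)"
      if e: "0 < e" "e < 1" for e
    proof -
      define c where "c k = (if k \<in> C then 1 - e else e)" for k
      have c: "0 < c l \<and> c l < 1" for l using e by (simp add: c_def)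
      obtain R where R: "R \<in> carrier_mat d2 d2" and R\<Phi>: "\<And>X. X \<in> carrier_mat d1 d1 \<Longrightarrow>
         H * mat_diag m (\<lambda>l. complex_of_real (c l) * bil d1 X (\<xi> l) (\<xi> l)) * mat_adjoint H = mat_adjoint R * \<Phi> X * R"
        using Cstar_extreme_reweight[OF ext hol, of c] c by blast
      note dR = carrier_matD[OF R]
      have Ra: "mat_adjoint R \<in> carrier_mat d2 d2" using R by simp
      define N where "N = mat_adjoint R * R"
      define P where "P = R * mat_adjoint R"
      have P: "P \<in> carrier_mat d2 d2" using R by (auto simp: P_def)
      have \<Phi>1: "\<Phi> (1\<^sub>m d1) = 1\<^sub>m d2" using holevo_unital[OF hol] HH by simp
      have N: "N = H * mat_diag m (\<lambda>l. complex_of_real (c l)) * mat_adjoint H"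
      proof -
        have "mat_diag m (\<lambda>l. complex_of_real (c l) * bil d1 (1\<^sub>m d1) (\<xi> l) (\<xi> l)) = mat_diag m (\<lambda>l. complex_of_real (c l))"
          using unit by (intro mat_diag_cong) (simp add: bil_one)
        then show ?thesis using R\<Phi>[of "1\<^sub>m d1"] dR by (simp add: \<Phi>1 N_def)
      qed
      have "psd d2 P" unfolding P_def by (rule psd_mult_adjoint[OF R])
      \<comment> \<open>The squared norm of \<open>R\<^sup>* \<eta>\<^sub>k\<close>.\<close>
      define \<rho> where "\<rho> k = Re (bil d2 P (\<lambda>i. H $$ (i, k)) (\<lambda>i. H $$ (i, k)))" for k
      have \<rho>: "bil d2 P (\<lambda>i. H $$ (i, k)) (\<lambda>i. H $$ (i, k)) = of_real (\<rho> k)" and \<rho>0: "0 \<le> \<rho> k" for k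
        using psd_bil_nonneg[OF \<open>psd d2 P\<close>, of "\<lambda>i. H $$ (i, k)"]
        by (auto simp: \<rho>_def less_eq_complex_def complex_eq_iff)
      have trace: "trace_mult d2 (\<Phi> X) P = trace_mult d2 (1\<^sub>m d2) (mat_adjoint R * \<Phi> X * R)" if X: "X \<in> carrier_mat d1 d1" for X
      proof -
        have \<Phi>c: "\<Phi> X \<in> carrier_mat d2 d2" using dH by (intro carrier_matI) (auto simp: \<Phi>[OF X])
        have "trace_mult d2 (\<Phi> X) P = trace_mult d2 (\<Phi> X * R) (mat_adjoint R)"
          unfolding P_def by (rule trace_mult_mult_shift[OF \<Phi>c R Ra, symmetric])
        also have "\<dots> = trace_mult d2 (1\<^sub>m d2 * mat_adjoint R) (\<Phi> X * R)" using dR trace_mult_commute by simp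
        also have "\<dots> = trace_mult d2 (1\<^sub>m d2) (mat_adjoint R * (\<Phi> X * R))"
          using \<Phi>c R Ra by (intro trace_mult_mult_shift) auto
        also have "mat_adjoint R * (\<Phi> X * R) = mat_adjoint R * \<Phi> X * R"
          using dR carrier_matD[OF \<Phi>c] by (simp add: mult_mat_assoc)
        finally show ?thesis .
      qed
      have colG: "bil d2 (1\<^sub>m d2) (\<lambda>i. H $$ (i, k)) (\<lambda>i. H $$ (i, k)) = of_real (h k)" if "k < m" for k
        using hG[OF that] unfolding bil_one G_def gram_entry[OF H that that] .
      \<comment> \<open>The trace of \<open>R\<^sup>* \<Phi> X R\<close> in two ways.\<close>
      have tr: "(\<Sum>k<m. bil d1 X (\<xi> k) (\<xi> k) * of_real (\<rho> k)) = (\<Sum>k<m. of_real (c k) * bil d1 X (\<xi> k) (\<xi> k) * of_real (h k))"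
        if X: "X \<in> carrier_mat d1 d1" for X
      proof -
        have "(\<Sum>k<m. bil d1 X (\<xi> k) (\<xi> k) * of_real (\<rho> k)) = trace_mult d2 (\<Phi> X) P"
          unfolding \<Phi>[OF X] trace_mult_sandwich_diag[OF H] \<rho> ..
        also have "\<dots> = trace_mult d2 (H * mat_diag m (\<lambda>l. complex_of_real (c l) * bil d1 X (\<xi> l) (\<xi> l)) * mat_adjoint H) (1\<^sub>m d2)"
          unfolding trace[OF X] R\<Phi>[OF X] by (rule trace_mult_commute)
        also have "\<dots> = (\<Sum>k<m. of_real (c k) * bil d1 X (\<xi> k) (\<xi> k) * of_real (h k))"
          unfolding trace_mult_sandwich_diag[OF H] by (intro sum.cong refl) (simp add: colG)
        finally show ?thesis .
      qed
      have "complex_of_real (\<Sum>k<m. \<rho> k) = of_real (\<Sum>k<m. c k * h k)"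
        using tr[of "1\<^sub>m d1"] unit by (simp add: bil_one)
      then have sum\<rho>: "(\<Sum>k<m. \<rho> k) = (\<Sum>k<m. c k * h k)" by (simp only: of_real_eq_iff)
      have "complex_of_real (\<Sum>k<m. q k * \<rho> k) = of_real (\<Sum>k<m. c k * q k * h k)"
        using tr[OF X0] by (simp add: q)
      then have "(\<Sum>k<m. q k * \<rho> k) = (\<Sum>k<m. c k * q k * h k)" by (simp only: of_real_eq_iff)
      then have q\<rho>: "(\<Sum>k\<in>D. q k * \<rho> k) = e * (\<Sum>k\<in>D. q k * h k)"
        unfolding split sum_distrib_left by (simp add: qC c_def D_def mult.assoc)
      have \<rho>D: "\<rho> k \<le> e * ((\<Sum>l\<in>D. q l * h l) / q k)" if k: "k \<in> D" for k
      proof -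
        have "q k * \<rho> k \<le> (\<Sum>k\<in>D. q k * \<rho> k)"
          using fin(2) k q0 \<rho>0 by (intro member_le_sum) auto
        then show ?thesis using qD[OF k] unfolding q\<rho> by (simp add: field_simps)
      qed
      have \<rho>M: "(\<Sum>k\<in>D. \<rho> k) \<le> e * M"
        unfolding M_def sum_distrib_left by (intro sum_mono \<rho>D)
      have h0: "0 \<le> h k" for k by (simp add: h_def g_def sum_nonneg)
      have "(1 - e) * (\<Sum>k\<in>C. h k) \<le> (\<Sum>k<m. c k * h k)"
        unfolding split sum_distrib_left using e h0
        by (simp add: c_def D_def sum_nonneg)
      also have "\<dots> = (\<Sum>k\<in>C. \<rho> k) + (\<Sum>k\<in>D. \<rho> k)" using sum\<rho> split by simp
      finally have "(1 - e) * (\<Sum>k\<in>C. h k) - e * M \<le> (\<Sum>k\<in>C. \<rho> k)" using \<rho>M by simp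
      then have "(1 - e) * ((1 - e) * (\<Sum>k\<in>C. h k) - e * M) \<le> (1 - e) * (\<Sum>k\<in>C. \<rho> k)"
        using e by (intro mult_left_mono) auto
      also have "\<dots> \<le> (\<Sum>k<m. c k * \<rho> k)"
        unfolding split sum_distrib_left using e \<rho>0 by (simp add: c_def D_def sum_nonneg)
      also have "\<dots> \<le> (\<Sum>j<m. \<Sum>k<m. c j * c k * g j k)"
      proof -
        have "trace_mult d2 N P = of_real (\<Sum>k<m. c k * \<rho> k)"
          unfolding N trace_mult_sandwich_diag[OF H] \<rho> by simp
        moreover have "trace_mult d2 N N = of_real (\<Sum>j<m. \<Sum>k<m. c j * c k * g j k)"
        proof -
          have "bil d2 N (\<lambda>i. H $$ (i, j)) (\<lambda>i. H $$ (i, j)) = of_real (\<Sum>k<m. c k * g j k)" if j: "j < m" for j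
            unfolding N bil_sandwich_diag[OF H] of_real_sum
            using j by (intro sum.cong refl) (simp add: gg G_def gram_entry[OF H] mult.assoc)
          then have "trace_mult d2 N N = (\<Sum>j<m. of_real (c j) * of_real (\<Sum>k<m. c k * g j k))"
            unfolding N trace_mult_sandwich_diag[OF H] by (intro sum.cong refl) (simp add: N)
          also have "\<dots> = of_real (\<Sum>j<m. \<Sum>k<m. c j * c k * g j k)"
            by (simp add: sum_distrib_left mult.assoc)
          finally show ?thesis .
        qed
        ultimately show ?thesis using trace_mult_polar_le[OF R] by (simp add: N_def P_def less_eq_complex_def)
      qed
      finally show ?thesis unfolding c_def .
    qed
    have "(\<Sum>k\<in>C. h k) \<le> (\<Sum>j<m. \<Sum>k<m. (if j \<in> C then 1 else 0) * (if k \<in> C then 1 else 0) * g j k)"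
    proof (rule tendsto_le[OF trivial_limit_at_right_real])
      show "((\<lambda>e. (1 - e) * ((1 - e) * (\<Sum>k\<in>C. h k) - e * M)) \<longlongrightarrow> (\<Sum>k\<in>C. h k)) (at_right 0)"
        by (rule tendsto_eq_intros refl | simp)+
      show "((\<lambda>e. \<Sum>j<m. \<Sum>k<m. (if j \<in> C then 1 - e else e) * (if k \<in> C then 1 - e else e) * g j k)
         \<longlongrightarrow> (\<Sum>j<m. \<Sum>k<m. (if j \<in> C then 1 else 0) * (if k \<in> C then 1 else 0) * g j k)) (at_right 0)"
      proof (intro tendsto_sum tendsto_mult tendsto_const)
        show "((\<lambda>e. if k \<in> C then 1 - e else e) \<longlongrightarrow> (if k \<in> C then 1 else 0 :: real)) (at_right 0)" for k
          by (cases "k \<in> C") (auto intro!: tendsto_eq_intros)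
        then show "((\<lambda>e. if j \<in> C then 1 - e else e) \<longlongrightarrow> (if j \<in> C then 1 else 0 :: real)) (at_right 0)" for j .
      qed
      show "\<forall>\<^sub>F e in at_right 0. (1 - e) * ((1 - e) * (\<Sum>k\<in>C. h k) - e * M)
          \<le> (\<Sum>j<m. \<Sum>k<m. (if j \<in> C then 1 - e else e) * (if k \<in> C then 1 - e else e) * g j k)"
        using main eventually_at_right_less[of "0::real"] by (auto simp: eventually_at_right[of 0 1] intro!: exI[of _ 1])
    qed
    also have "\<dots> = (\<Sum>k\<in>C. \<Sum>j\<in>C. g j k)"
    proof -
      have "(\<Sum>j<m. \<Sum>k<m. (if j \<in> C then 1 else 0) * (if k \<in> C then 1 else 0) * g j k) = (\<Sum>j\<in>C. \<Sum>k\<in>C. g j k)"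
        unfolding split by (simp add: D_def)
      also have "\<dots> = (\<Sum>k\<in>C. \<Sum>j\<in>C. g j k)" by (rule sum.swap)
      finally show ?thesis .
    qed
    finally have "(\<Sum>k\<in>C. \<Sum>j\<in>D. g j k) \<le> 0" unfolding h_def split by (simp add: sum.distrib)
    moreover have "g p t \<le> (\<Sum>j\<in>D. g j t)" using fin pD by (intro member_le_sum) (auto simp: g_def)
    moreover have "(\<Sum>j\<in>D. g j t) \<le> (\<Sum>k\<in>C. \<Sum>j\<in>D. g j k)"
      using fin tC by (intro member_le_sum[where f = "\<lambda>k. \<Sum>j\<in>D. g j k"]) (auto simp: g_def sum_nonneg)
    ultimately have "g p t \<le> 0" by simp
    then show False using nz by (simp add: g_def G_def)
  qed
  show ?thesis unfolding orthogonal_classes_def using ray by blast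
qed

theorem theorem4p1:
  fixes d1 d2 :: nat and \<Phi> :: "complex mat \<Rightarrow> complex mat"
  assumes "\<Phi> \<in> UEB d1 d2"
  shows "degradable d1 d2 \<Phi> \<longleftrightarrow> Cstar_extreme_UEB d1 d2 \<Phi>"
proof -
  have EB: "entanglement_breaking d1 d2 \<Phi>" and unital: "\<Phi> (1\<^sub>m d1) = 1\<^sub>m d2"
    using assms by (auto simp: UEB_def)
  obtain m \<xi> H where hol: "holevo d1 d2 m \<xi> H \<Phi>" using EB_holevo[OF EB] by blast
  have HH: "H * mat_adjoint H = 1\<^sub>m d2" using holevo_unital[OF hol] unital by simp
  have cp: "completely_positive d1 d2 \<Phi>" using EB by (simp add: entanglement_breaking_def)
  show ?thesis
    using orthogonal_classes_of_degradable[OF hol] degradable_of_orthogonal_classes[OF hol cp HH]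
      Cstar_extreme_of_orthogonal_classes[OF assms hol] orthogonal_classes_of_Cstar_extreme[OF _ hol]
    by blast
qed

end
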